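(* $K$ is the prime model of the complete $L_{\mathcal O}$-theory of $\mathbb{F}_d((X))$; that is, $K$ is a model of this theory and $K$ embeds elementarily (as an $L_{\mathcal O}$-structure) into every model of this theory.
   Context: Let $p$ be a prime, $k\ge 1$ an integer and $d:=p^k$. Let $K=\mathbb{F}_d(X)^h$ be the henselization of the rational function field $\mathbb{F}_d(X)$ with respect to the $X$-adic valuation, and let $\varphi:K\to K$, $\varphi(a)=a^{\varphi}=a^d$. Let $R:=K\langle t\mid t a^{\varphi}=a t\ (a\in K)\rangle$; every nonzero element of $R$ is uniquely of the form $t^n a_n+\dots+t a_1+a_0$ with $a_i\in K$, $a_n\ne 0$ (it corresponds to the additive polynomial $a_nT^{d^n}+\dots+a_1T^d+a_0T$). The fields $K$ and $\mathbb{F}_d((X))$ are right $R$-modules via $x.a=ax$ for $a\in K$ and $x.t=x^d$. $L$ is the language of right $R$-modules ($+,-,0$ and a unary function symbol for each $r\in R$), and $L_{\mathcal O}$ is $L$ together with a unary predicate $\mathcal O$. In $\mathbb{F}_d((X))$ the predicate $\mathcal O$ is interpreted as the valuation ring $\mathbb{F}_d[[X]]$, and in $K$ as the valuation ring of the $X$-adic valuation. *)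

theory Defs
  imports
    "HOL-Computational_Algebra.Computational_Algebra"
    "HOL-Algebra.Ring"
begin

section \<open>Henselian fields and the henselization of the rational function field\<close>

text \<open>All fields below are subfields of a field given as a type, and valuations are represented by
  their valuation rings.\<close>

definition is_subring :: "'k::comm_ring_1 set \<Rightarrow> bool" where
  "is_subring S \<longleftrightarrow> 1 \<in> S \<and> (\<forall>x\<in>S. \<forall>y\<in>S. x - y \<in> S \<and> x * y \<in> S)"

definition is_subfield :: "'k::field set \<Rightarrow> bool" where
  "is_subfield S \<longleftrightarrow> is_subring S \<and> (\<forall>x\<in>S. inverse x \<in> S)"

definition valued_field :: "'k::field set \<Rightarrow> 'k set \<Rightarrow> bool" where
  "valued_field S V \<longleftrightarrow>
     is_subfield S \<and> V \<subseteq> S \<and> is_subring V \<and> (\<forall>x\<in>S. x \<in> V \<or> inverse x \<in> V)"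

definition max_ideal :: "'k::field set \<Rightarrow> 'k set" where
  "max_ideal V = {x\<in>V. x = 0 \<or> inverse x \<notin> V}"

definition henselian :: "'k::field set \<Rightarrow> 'k set \<Rightarrow> bool" where
  "henselian S V \<longleftrightarrow> valued_field S V \<and>
     (\<forall>f. \<forall>a\<in>V. (\<forall>n. coeff f n \<in> V) \<longrightarrow> poly f a \<in> max_ideal V \<longrightarrow> poly (pderiv f) a \<notin> max_ideal V \<longrightarrow>
        (\<exists>b\<in>V. poly f b = 0 \<and> b - a \<in> max_ideal V))"

definition valued_embedding ::
    "'k::field set \<Rightarrow> 'k set \<Rightarrow> 'm::field set \<Rightarrow> 'm set \<Rightarrow> ('k \<Rightarrow> 'm) \<Rightarrow> bool" where
  "valued_embedding S V T W h \<longleftrightarrow> h ` S \<subseteq> T \<and> h 1 = 1 \<and>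
     (\<forall>x\<in>S. \<forall>y\<in>S. h (x + y) = h x + h y \<and> h (x * y) = h x * h y) \<and> (\<forall>x\<in>S. h x \<in> W \<longleftrightarrow> x \<in> V)"

text \<open>The henselization of a subfield \<open>F\<close> of an ambient henselian field with valuation ring \<open>V\<close>:
  the smallest subfield containing \<open>F\<close> that is henselian for the induced valuation.\<close>

definition henselization :: "'k::field set \<Rightarrow> 'k set \<Rightarrow> 'k set" where
  "henselization V F = \<Inter>{S. F \<subseteq> S \<and> henselian S (V \<inter> S)}"

definition fls_integers :: "'a::field fls set" where
  "fls_integers = range fps_to_fls"

definition rational_functions :: "'a::field fls set" where
  "rational_functions =
     {fps_to_fls (fps_of_poly f) / fps_to_fls (fps_of_poly g) | f g. g \<noteq> 0}"

definition rat_henselization :: "'a::field fls set" where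
  "rat_henselization = henselization fls_integers rational_functions"


subsection \<open>The universal property\<close>

text \<open>The main result of this subsection, \<open>rat_henselization_universal\<close>, shows that
  \<open>rat_henselization\<close> is the henselization of the rational function field in the sense of the
  universal property: it is henselian, and every valued embedding of the rational function field into
  a henselian field extends uniquely to it.\<close>

unbundle fps_syntax

lemma subringD:
  assumes "is_subring W"
  shows "0 \<in> W" "1 \<in> W" "x \<in> W \<Longrightarrow> y \<in> W \<Longrightarrow> x - y \<in> W" "x \<in> W \<Longrightarrow> y \<in> W \<Longrightarrow> x * y \<in> W"
    "x \<in> W \<Longrightarrow> - x \<in> W" "x \<in> W \<Longrightarrow> y \<in> W \<Longrightarrow> x + y \<in> W" "of_nat n \<in> W" "x \<in> W \<Longrightarrow> x ^ n \<in> W"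
proof -
  show d: "x - y \<in> W" and m: "x * y \<in> W" if "x \<in> W" "y \<in> W" for x y
    using assms that by (auto simp: is_subring_def)
  show o: "1 \<in> W" using assms by (simp add: is_subring_def)
  show z: "0 \<in> W" using d[OF o o] by simp
  show u: "- x \<in> W" if "x \<in> W" for x using d[OF z that] by simp
  show p: "x + y \<in> W" if "x \<in> W" "y \<in> W" for x y using d[OF that(1) u[OF that(2)]] by simp
  show "of_nat n \<in> W" by (induction n) (auto simp: z o p)
  show "x ^ n \<in> W" if "x \<in> W" by (induction n) (auto simp: o m that)
qed

lemma subfieldD:
  assumes "is_subfield S"
  shows "is_subring S" "x \<in> S \<Longrightarrow> inverse x \<in> S" "x \<in> S \<Longrightarrow> y \<in> S \<Longrightarrow> x / y \<in> S"
  using assms subringD(4)[of S x "inverse y"] by (auto simp: is_subfield_def divide_inverse)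

lemma valued_fieldD:
  assumes "valued_field S V"
  shows "is_subfield S" "V \<subseteq> S" "is_subring V" "x \<in> S \<Longrightarrow> x \<notin> V \<Longrightarrow> inverse x \<in> V"
  using assms by (auto simp: valued_field_def)

lemma valued_field_Int:
  assumes "valued_field UNIV V" "is_subfield S"
  shows "valued_field S (V \<inter> S)"
  using assms by (auto simp: valued_field_def is_subring_def is_subfield_def)

lemma max_ideal_Int: "is_subfield S \<Longrightarrow> max_ideal (V \<inter> S) = max_ideal V \<inter> S"
  by (auto simp: max_ideal_def is_subfield_def)

context
  fixes S V :: "'k::field set"
  assumes vf: "valued_field S V"
begin

private lemmas V = subringD[OF valued_fieldD(3)[OF vf]]
private lemmas SV = subsetD[OF valued_fieldD(2)[OF vf]]

lemma max_idealD: "x \<in> max_ideal V \<Longrightarrow> x \<in> V"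
  by (simp add: max_ideal_def)

lemma unitD: "x \<in> V \<Longrightarrow> x \<notin> max_ideal V \<Longrightarrow> x \<noteq> 0 \<and> inverse x \<in> V"
  by (auto simp: max_ideal_def)

lemma one_notin_max_ideal: "1 \<notin> max_ideal V"
  by (simp add: max_ideal_def V)

lemma max_ideal_mult: "x \<in> max_ideal V \<Longrightarrow> y \<in> V \<Longrightarrow> x * y \<in> max_ideal V"
  using V(4)[of y "inverse (x * y)"] V(4)[of x y]
  by (cases "x = 0"; cases "y = 0") (auto simp: max_ideal_def V field_simps)

lemma max_ideal_uminus: "x \<in> max_ideal V \<Longrightarrow> - x \<in> max_ideal V"
  using max_ideal_mult[of x "-1"] V by simp

lemma max_ideal_add:
  assumes "x \<in> max_ideal V" "y \<in> max_ideal V"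
  shows "x + y \<in> max_ideal V"
proof -
  have *: "u + v \<in> max_ideal V" if "u \<in> max_ideal V" "v \<in> max_ideal V" "u / v \<in> V" for u v
  proof (cases "v = 0")
    case False
    then have "u + v = v * (u / v + 1)" by (simp add: field_simps)
    then show ?thesis using max_ideal_mult[OF that(2)] V that(3) by auto
  qed (use that in auto)
  have "x \<in> S" "y \<in> S" using assms SV max_idealD by auto
  then have "x / y \<in> S" using subfieldD(3)[OF valued_fieldD(1)[OF vf]] by auto
  then have "x / y \<in> V \<or> y / x \<in> V" using valued_fieldD(4)[OF vf, of "x / y"] by auto
  then show ?thesis using *[OF assms] *[OF assms(2,1)] by (auto simp: add.commute)
qed

lemma max_ideal_diff: "x \<in> max_ideal V \<Longrightarrow> y \<in> max_ideal V \<Longrightarrow> x - y \<in> max_ideal V"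
  using max_ideal_add[of x "- y"] max_ideal_uminus by simp

lemma unit_cong: "x - y \<in> max_ideal V \<Longrightarrow> y \<notin> max_ideal V \<Longrightarrow> x \<notin> max_ideal V"
  using max_ideal_diff[of x "x - y"] by auto

end

lemma coeff_pderiv_in:
  assumes "is_subring W" "\<forall>n. coeff f n \<in> W"
  shows "\<forall>n. coeff (pderiv f) n \<in> W"
  using subringD(4,7)[OF assms(1)] assms(2) by (simp add: coeff_pderiv del: of_nat_Suc)

lemma poly_in:
  assumes "is_subring W" "\<forall>n. coeff f n \<in> W" "x \<in> W"
  shows "poly f x \<in> W"
  using assms(2)
proof (induction f)
  case (pCons a f)
  have "a \<in> W" "\<forall>n. coeff f n \<in> W"
    using pCons.prems[rule_format, of 0] pCons.prems[rule_format, of "Suc _"] by auto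
  then show ?case using pCons.IH subringD[OF assms(1)] assms(3) by simp
qed (simp add: subringD[OF assms(1)])

lemma taylor2:
  assumes W: "is_subring W" and "\<forall>n. coeff f n \<in> W" "x \<in> W" "y \<in> W"
  shows "\<exists>w\<in>W. poly f x = poly f y + (x - y) * (poly (pderiv f) y + (x - y) * w)"
  using assms(2)
proof (induction f)
  case (pCons a f)
  have a: "a \<in> W" "\<forall>n. coeff f n \<in> W"
    using pCons.prems[rule_format, of 0] pCons.prems[rule_format, of "Suc _"] by auto
  obtain w where w: "w \<in> W" "poly f x = poly f y + (x - y) * (poly (pderiv f) y + (x - y) * w)"
    using pCons.IH[OF a(2)] by blast
  have "poly (pderiv f) y + x * w \<in> W"
    using subringD[OF W] poly_in[OF W coeff_pderiv_in[OF W a(2)] assms(4)] w assms by auto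
  moreover have "poly (pCons a f) x = poly (pCons a f) y + (x - y) *
      (poly (pderiv (pCons a f)) y + (x - y) * (poly (pderiv f) y + x * w))"
    by (simp add: w(2) pderiv_pCons algebra_simps)
  ultimately show ?case by blast
qed (use subringD[OF W] in auto)

lemma taylor1:
  fixes f :: "'k::idom poly"
  assumes W: "is_subring W" and "\<forall>n. coeff f n \<in> W" "x \<in> W" "y \<in> W"
  shows "\<exists>w\<in>W. poly f x = poly f y + (x - y) * w"
proof -
  obtain w where "w \<in> W" "poly f x = poly f y + (x - y) * (poly (pderiv f) y + (x - y) * w)"
    using taylor2[OF assms] by blast
  then show ?thesis using poly_in[OF W coeff_pderiv_in[OF W assms(2)] assms(4)] subringD[OF W] assms(3,4)
    by (intro bexI[of _ "poly (pderiv f) y + (x - y) * w"]) auto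
qed

lemma henselian_root_unique:
  assumes vf: "valued_field S V" and f: "\<forall>n. coeff f n \<in> V" and V: "a \<in> V" "b \<in> V" "c \<in> V"
    and r: "poly f b = 0" "poly f c = 0" "b - a \<in> max_ideal V" "c - a \<in> max_ideal V"
    and d: "poly (pderiv f) a \<notin> max_ideal V"
  shows "b = c"
proof -
  note W = valued_fieldD(3)[OF vf]
  obtain w where w: "w \<in> V" "poly f c = poly f b + (c - b) * (poly (pderiv f) b + (c - b) * w)"
    using taylor2[OF W f V(3,2)] by blast
  obtain w' where w': "w' \<in> V" "poly (pderiv f) b = poly (pderiv f) a + (b - a) * w'"
    using taylor1[OF W coeff_pderiv_in[OF W f] V(2,1)] by blast
  have cb: "c - b \<in> max_ideal V" using max_ideal_diff[OF vf r(4,3)] by simp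
  have "poly (pderiv f) b \<notin> max_ideal V"
    using unit_cong[OF vf _ d, of "poly (pderiv f) b"] w' max_ideal_mult[OF vf r(3) w'(1)] by simp
  then have "poly (pderiv f) b + (c - b) * w \<notin> max_ideal V"
    using unit_cong[OF vf, of "poly (pderiv f) b + (c - b) * w" "poly (pderiv f) b"]
      max_ideal_mult[OF vf cb w(1)] by simp
  then have "poly (pderiv f) b + (c - b) * w \<noteq> 0"
    using W subringD(1) by (force simp: max_ideal_def)
  then show ?thesis using w(2) r by simp
qed

lemma fls_integers_iff: "x \<in> fls_integers \<longleftrightarrow> (\<forall>n<0. x $$ n = 0)"
proof
  assume "\<forall>n<0. x $$ n = 0"
  then have "x = fps_to_fls (fls_regpart x)" by (intro fls_eqI) auto
  then show "x \<in> fls_integers" unfolding fls_integers_def by blast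
qed (auto simp: fls_integers_def)

lemma fls_integers_subdegree: "x \<in> fls_integers \<longleftrightarrow> fls_subdegree x \<ge> 0"
  by (metis fls_integers_iff fls_eq0_below_subdegree fls_subdegree_ge0I order_less_le_trans)

lemma valued_field_fls: "valued_field UNIV (fls_integers :: 'a::field fls set)"
proof -
  have "x * y \<in> fls_integers" if "x \<in> fls_integers" "y \<in> fls_integers" for x y :: "'a fls"
    using that by (cases "x = 0"; cases "y = 0") (auto simp: fls_integers_subdegree)
  then have "is_subring (fls_integers :: 'a fls set)"
    by (auto simp: is_subring_def fls_integers_iff)
  then show ?thesis
    by (auto simp: valued_field_def is_subfield_def fls_integers_subdegree is_subring_def fls_inverse_subdegree)
qed

lemma max_ideal_fls: "x \<in> max_ideal fls_integers \<longleftrightarrow> x \<in> fls_integers \<and> x $$ 0 = 0"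
proof -
  have "x = 0 \<or> fls_subdegree x > 0" if "x \<in> fls_integers" "x $$ 0 = 0"
    using that by (metis fls_integers_subdegree nth_fls_subdegree_nonzero order_le_less)
  then show ?thesis
    by (auto simp: max_ideal_def fls_integers_subdegree fls_inverse_subdegree)
qed

lemma fls_X_power_dvd:
  "(\<exists>v\<in>fls_integers. x = fls_X ^ N * v) \<longleftrightarrow> (\<forall>n<int N. x $$ n = (0::'a::field))"
proof
  assume *: "\<forall>n<int N. x $$ n = 0"
  have "fls_shift (int N) x \<in> fls_integers" using * by (auto simp: fls_integers_iff)
  moreover have "x = fls_X ^ N * fls_shift (int N) x"
    by (simp add: fls_X_power_times_conv_shift)
  ultimately show "\<exists>v\<in>fls_integers. x = fls_X ^ N * v" by blast
qed (auto simp: fls_integers_iff fls_X_power_times_conv_shift)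

lemma henselian_fls: "henselian UNIV (fls_integers :: 'a::field fls set)"
  unfolding henselian_def
proof (intro conjI valued_field_fls allI ballI impI)
  let ?V = "fls_integers :: 'a fls set"
  note vf = valued_field_fls[where ?'a = 'a]
  note W = valued_fieldD(3)[OF vf]
  note V = subringD[OF W]
  fix f :: "'a fls poly" and a
  assume a: "a \<in> ?V" and f: "\<forall>n. coeff f n \<in> ?V" and fa: "poly f a \<in> max_ideal ?V"
    and f'a: "poly (pderiv f) a \<notin> max_ideal ?V"
  note f' = coeff_pderiv_in[OF W f]
  define u where "u = inverse (poly (pderiv f) a)"
  have u: "u \<in> ?V" "u * poly (pderiv f) a = 1"
    using unitD[OF vf poly_in[OF W f' a] f'a] by (auto simp: u_def)
  define A where "A = rec_nat a (\<lambda>_ x. x - poly f x * u)"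
  have A0: "A 0 = a" and AS: "\<And>n. A (Suc n) = A n - poly f (A n) * u"
    by (simp_all add: A_def)
  have X: "fls_X * v \<in> max_ideal ?V" if "v \<in> ?V" for v
    using that by (simp add: max_ideal_fls fls_integers_iff fls_X_times_conv_shift)
  have m: "\<exists>v\<in>?V. x = fls_X * v" if "x \<in> max_ideal ?V" for x
  proof -
    have "x $$ n = 0" if "n < int 1" for n
      using that \<open>x \<in> max_ideal ?V\<close> by (cases "n = 0") (auto simp: max_ideal_fls fls_integers_iff)
    then show ?thesis using fls_X_power_dvd[where N = 1 and x = x] by simp
  qed
  have inv: "A n \<in> ?V \<and> A n - a \<in> max_ideal ?V \<and> (\<exists>v\<in>?V. poly f (A n) = fls_X ^ Suc n * v)" for n
  proof (induction n)
    case 0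
    then show ?case using a m[OF fa] by (auto simp: A0 max_ideal_fls V)
  next
    case (Suc n)
    then obtain v where v: "v \<in> ?V" "poly f (A n) = fls_X ^ Suc n * v" and An: "A n \<in> ?V" "A n - a \<in> max_ideal ?V"
      by blast
    have fAn: "poly f (A n) = fls_X * (fls_X ^ n * v)" by (simp add: v)
    have Xn: "fls_X ^ n \<in> ?V" for n using V(8)[of "fls_X :: 'a fls"] by (auto simp: fls_integers_iff)
    have d: "poly f (A n) * u \<in> max_ideal ?V"
      unfolding fAn using max_ideal_mult[OF vf X u(1)] V(4)[OF Xn v(1)] by blast
    have i: "A (Suc n) \<in> ?V" using d An V(3) by (auto simp: AS max_ideal_def)
    have ii: "A (Suc n) - a \<in> max_ideal ?V"
      using max_ideal_diff[OF vf An(2) d] by (simp add: AS algebra_simps)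
    obtain w where w: "w \<in> ?V" "poly f (A (Suc n)) = poly f (A n) + (A (Suc n) - A n) *
        (poly (pderiv f) (A n) + (A (Suc n) - A n) * w)"
      using taylor2[OF W f i An(1)] by blast
    obtain w1 where w1: "w1 \<in> ?V" "poly (pderiv f) (A n) = poly (pderiv f) a + (A n - a) * w1"
      using taylor1[OF W f' An(1) a] by blast
    obtain w2 where w2: "w2 \<in> ?V" "A n - a = fls_X * w2" using m[OF An(2)] by blast
    have e: "A (Suc n) - A n = - (fls_X ^ Suc n * v * u)" by (simp add: AS v)
    have uf: "u * poly (pderiv f) (A n) = 1 + fls_X * (u * w2 * w1)"
      by (simp add: w1(2) w2(2) algebra_simps u(2))
    have "poly f (A (Suc n)) = fls_X ^ Suc n * v
        - fls_X ^ Suc n * v * (u * poly (pderiv f) (A n)) + (fls_X ^ Suc n * v * u)\<^sup>2 * w"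
      by (simp add: w(2) e v(2) algebra_simps power2_eq_square)
    also have "\<dots> = fls_X ^ Suc (Suc n) * (- v * (u * w2 * w1) + fls_X ^ n * (v * u)\<^sup>2 * w)"
      by (simp only: uf) (simp add: algebra_simps power2_eq_square)
    finally have "poly f (A (Suc n)) = fls_X ^ Suc (Suc n) * (- v * (u * w2 * w1) + fls_X ^ n * (v * u)\<^sup>2 * w)" .
    moreover have "- v * (u * w2 * w1) + fls_X ^ n * (v * u)\<^sup>2 * w \<in> ?V"
      by (intro V(4,5,6,8) Xn v u w w1 w2)
    ultimately show ?case using i ii by blast
  qed
  have step: "A (Suc n) $$ k = A n $$ k" if "k < int (Suc n)" for n k
  proof -
    obtain v where v: "v \<in> ?V" "poly f (A n) = fls_X ^ Suc n * v" using inv by blast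
    have "\<exists>w\<in>?V. A n - A (Suc n) = fls_X ^ Suc n * w"
      using V(4)[OF v(1) u(1)] by (intro bexI[of _ "v * u"]) (simp_all add: AS v(2))
    then have "(A n - A (Suc n)) $$ k = 0" using that fls_X_power_dvd by blast
    then show ?thesis by simp
  qed
  define b where "b = fps_to_fls (Abs_fps (\<lambda>k. A k $$ int k))"
  have b: "b \<in> ?V" by (simp add: b_def fls_integers_def)
  have stab: "A (k + j) $$ int k = A k $$ int k" for k j
    by (induction j) (auto simp: step)
  have bA: "\<exists>v\<in>?V. b - A n = fls_X ^ Suc n * v" for n
    unfolding fls_X_power_dvd
  proof (intro allI impI)
    fix k assume k: "k < int (Suc n)"
    show "(b - A n) $$ k = 0"
    proof (cases "k < 0")
      case True
      then show ?thesis using b inv[of n] by (auto simp: fls_integers_iff)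
    next
      case False
      then obtain k' where k': "k = int k'" using nonneg_int_cases[of k] by force
      then have "A n $$ k = A k' $$ k" using stab[of k' "n - k'"] k by simp
      then show ?thesis by (simp add: b_def k')
    qed
  qed
  have "\<exists>v\<in>?V. poly f b = fls_X ^ Suc n * v" for n
  proof -
    obtain v where v: "v \<in> ?V" "b - A n = fls_X ^ Suc n * v" using bA by blast
    obtain v' where v': "v' \<in> ?V" "poly f (A n) = fls_X ^ Suc n * v'" using inv by blast
    obtain w where "w \<in> ?V" "poly f b = poly f (A n) + (b - A n) * w"
      using taylor1[OF W f b] inv by blast
    then have "poly f b = fls_X ^ Suc n * (v' + v * w)" "v' + v * w \<in> ?V"
      by (auto simp: v v' algebra_simps intro!: V(4,6))
    then show ?thesis by blast
  qed
  then have van: "poly f b $$ k = 0" if "k < int (Suc n)" for n k using that fls_X_power_dvd by blast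
  have "poly f b $$ k = 0" for k
    by (rule van[where n = "nat k"]) simp
  then have "poly f b = 0" by (intro fls_eqI) auto
  moreover have "b - a \<in> max_ideal ?V"
    using bA[of 0] X by (auto simp: A0)
  ultimately show "\<exists>b\<in>?V. poly f b = 0 \<and> b - a \<in> max_ideal ?V" using b by blast
qed

context
  fixes S V :: "'k::field set" and T W :: "'m::field set" and h :: "'k \<Rightarrow> 'm"
  assumes S: "is_subfield S" and emb: "valued_embedding S V T W h"
begin

private lemmas S' = subringD[OF subfieldD(1)[OF S]] subfieldD(2,3)[OF S]

lemma emb_simps:
  "x \<in> S \<Longrightarrow> h x \<in> T" "h 1 = 1" "x \<in> S \<Longrightarrow> y \<in> S \<Longrightarrow> h (x + y) = h x + h y"
  "x \<in> S \<Longrightarrow> y \<in> S \<Longrightarrow> h (x * y) = h x * h y" "x \<in> S \<Longrightarrow> h x \<in> W \<longleftrightarrow> x \<in> V"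
  using emb by (auto simp: valued_embedding_def)

lemma emb_0: "h 0 = 0"
  using emb_simps(3)[OF S'(1) S'(1)] by (metis add_0 add_cancel_right_right)

lemma emb_uminus: "x \<in> S \<Longrightarrow> h (- x) = - h x"
  using emb_simps(3)[of x "- x"] S' emb_0 by (simp add: add_eq_0_iff)

lemma emb_diff: "x \<in> S \<Longrightarrow> y \<in> S \<Longrightarrow> h (x - y) = h x - h y"
  using emb_simps(3)[of x "- y"] S' emb_uminus by simp

lemma emb_inverse: "x \<in> S \<Longrightarrow> h (inverse x) = inverse (h x)"
  using emb_simps(4)[of x "inverse x"] S' emb_0 emb_simps(2)
  by (cases "x = 0") (auto simp: inverse_unique)

lemma emb_eq_0: "x \<in> S \<Longrightarrow> h x = 0 \<longleftrightarrow> x = 0"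
  using emb_simps(4)[of x "inverse x"] S' emb_0 emb_simps(2) by (cases "x = 0") auto

lemma emb_divide: "x \<in> S \<Longrightarrow> y \<in> S \<Longrightarrow> h (x / y) = h x / h y"
  using emb_simps(4)[of x "inverse y"] S' emb_inverse by (simp add: divide_inverse)

lemma emb_power: "x \<in> S \<Longrightarrow> h (x ^ n) = h x ^ n"
  by (induction n) (auto simp: emb_simps S')

lemma emb_of_nat: "h (of_nat n) = of_nat n"
  by (induction n) (auto simp: emb_simps S' emb_0)

lemma emb_max_ideal: "V \<subseteq> S \<Longrightarrow> x \<in> S \<Longrightarrow> h x \<in> max_ideal W \<longleftrightarrow> x \<in> max_ideal V"
  using emb_simps(5)[of x] emb_simps(5)[of "inverse x"] S' emb_inverse emb_eq_0
  by (auto simp: max_ideal_def)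

lemma emb_sum: "(\<And>i. i \<in> I \<Longrightarrow> f i \<in> S) \<Longrightarrow> h (sum f I) = (\<Sum>i\<in>I. h (f i)) \<and> sum f I \<in> S"
  by (induction I rule: infinite_finite_induct) (auto simp: emb_simps emb_0 S')

lemma emb_coeff: "coeff (map_poly h p) n = h (coeff p n)"
  by (simp add: coeff_map_poly emb_0)

lemma emb_map_poly_add:
  "\<forall>n. coeff p n \<in> S \<Longrightarrow> \<forall>n. coeff q n \<in> S \<Longrightarrow> map_poly h (p + q) = map_poly h p + map_poly h q"
  by (intro poly_eqI) (simp add: emb_coeff emb_simps)

lemma emb_map_poly_diff:
  "\<forall>n. coeff p n \<in> S \<Longrightarrow> \<forall>n. coeff q n \<in> S \<Longrightarrow> map_poly h (p - q) = map_poly h p - map_poly h q"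
  by (intro poly_eqI) (simp add: emb_coeff emb_diff)

lemma emb_map_poly_mult:
  "\<forall>n. coeff p n \<in> S \<Longrightarrow> \<forall>n. coeff q n \<in> S \<Longrightarrow> map_poly h (p * q) = map_poly h p * map_poly h q"
  by (intro poly_eqI) (simp add: emb_coeff coeff_mult emb_sum emb_simps S')

lemma emb_map_poly_pderiv: "\<forall>n. coeff p n \<in> S \<Longrightarrow> map_poly h (pderiv p) = pderiv (map_poly h p)"
  by (intro poly_eqI)
    (simp add: emb_coeff coeff_pderiv emb_simps emb_of_nat S' del: of_nat_Suc)

lemma emb_poly: "\<forall>n. coeff p n \<in> S \<Longrightarrow> x \<in> S \<Longrightarrow> poly (map_poly h p) (h x) = h (poly p x)"
proof (induction p)
  case (pCons a p)
  have a: "a \<in> S" "\<forall>n. coeff p n \<in> S"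
    using pCons.prems(1)[rule_format, of 0] pCons.prems(1)[rule_format, of "Suc _"] by auto
  have "map_poly h (pCons a p) = pCons (h a) (map_poly h p)"
    by (intro poly_eqI) (simp add: emb_coeff coeff_pCons split: nat.split)
  then show ?case
    using pCons.IH[OF a(2) pCons.prems(2)] a pCons.prems(2)
      poly_in[OF subfieldD(1)[OF S] a(2) pCons.prems(2)]
    by (simp add: emb_simps S')
qed (simp add: emb_0)

end

lemma poly_in_mult:
  assumes "is_subring S" "\<forall>n. coeff p n \<in> S" "\<forall>n. coeff q n \<in> S"
  shows "\<forall>n. coeff (p * q) n \<in> S" "\<forall>n. coeff (p + q) n \<in> S" "\<forall>n. coeff (p - q) n \<in> S"
proof -
  note S = subringD[OF assms(1)]
  have "sum f I \<in> S" if "\<And>i. i \<in> I \<Longrightarrow> f i \<in> S" for f and I :: "nat set"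
    using that by (induction I rule: infinite_finite_induct) (auto simp: S)
  then show "\<forall>n. coeff (p * q) n \<in> S" using assms(2,3) S by (simp add: coeff_mult)
qed (use assms subringD[OF assms(1)] in auto)

lemma poly_div_subfield:
  assumes S: "is_subfield S" and m: "\<forall>n. coeff m n \<in> S" "m \<noteq> 0"
  shows "\<forall>n. coeff p n \<in> S \<Longrightarrow>
    \<exists>q r. (\<forall>n. coeff q n \<in> S) \<and> (\<forall>n. coeff r n \<in> S) \<and> p = m * q + r \<and> (r = 0 \<or> degree r < degree m)"
proof (induction "degree p" arbitrary: p rule: less_induct)
  case less
  note S' = subringD[OF subfieldD(1)[OF S]] subfieldD(2,3)[OF S]
  show ?case
  proof (cases "p = 0 \<or> degree p < degree m")
    case True
    then show ?thesis using less.prems S' by (intro exI[of _ 0] exI[of _ p]) auto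
  next
    case False
    define u where "u = monom (lead_coeff p / lead_coeff m) (degree p - degree m)"
    have u: "\<forall>n. coeff u n \<in> S" using less.prems m S' by (auto simp: u_def)
    define p' where "p' = p - m * u"
    have p': "\<forall>n. coeff p' n \<in> S"
      unfolding p'_def by (intro poly_in_mult subfieldD[OF S] u less.prems m)
    have c: "lead_coeff p / lead_coeff m \<noteq> 0" using False m(2) by auto
    then have "u \<noteq> 0" "degree u = degree p - degree m" unfolding u_def degree_monom_eq[OF c] monom_eq_0_iff using c by simp_all
    then have du: "degree (m * u) = degree p" using m(2) False by (simp add: degree_mult_eq)
    have "lead_coeff (m * u) = lead_coeff p"
      unfolding lead_coeff_mult \<open>degree u = _\<close> using m(2) by (simp add: u_def)
    then have "coeff p' (degree p) = 0" by (simp add: p'_def du)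
    moreover have "degree p' \<le> degree p" unfolding p'_def by (intro degree_diff_le) (auto simp: du)
    ultimately have "p' = 0 \<or> degree p' < degree p" using eq_zero_or_degree_less by blast
    then obtain q r where qr: "\<forall>n. coeff q n \<in> S" "\<forall>n. coeff r n \<in> S" "p' = m * q + r"
        "r = 0 \<or> degree r < degree m"
    proof
      assume "p' = 0"
      then show ?thesis using that[of 0 0] S' by simp
    qed (use less.hyps p' in blast)
    have "p = m * (q + u) + r" using qr(3) by (simp add: p'_def algebra_simps)
    then show ?thesis using qr poly_in_mult(2)[OF subfieldD(1)[OF S] qr(1) u] by blast
  qed
qed

lemma henselization_least: "F \<subseteq> S \<Longrightarrow> henselian S (V \<inter> S) \<Longrightarrow> henselization V F \<subseteq> S"
  by (auto simp: henselization_def)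

lemma subset_henselization: "F \<subseteq> henselization V F"
  by (auto simp: henselization_def)

lemma henselian_henselization:
  fixes V F :: "'k::field set"
  assumes "henselian UNIV V"
  shows "henselian (henselization V F) (V \<inter> henselization V F)" (is "henselian ?K (V \<inter> ?K)")
proof -
  define \<S> where "\<S> = {S. F \<subseteq> S \<and> henselian S (V \<inter> S)}"
  have K: "?K = \<Inter>\<S>" by (simp add: \<S>_def henselization_def)
  have U: "UNIV \<in> \<S>" using assms by (simp add: \<S>_def)
  have vU: "valued_field UNIV V" using assms by (simp add: henselian_def)
  have \<S>: "is_subfield S" "henselian S (V \<inter> S)" if "S \<in> \<S>" for S
    using that by (auto simp: \<S>_def henselian_def valued_field_def)
  have sf: "is_subfield ?K"
    unfolding K using \<S>(1) by (auto simp: is_subfield_def is_subring_def)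
  show ?thesis
    unfolding henselian_def
  proof (intro conjI valued_field_Int[OF vU sf] allI ballI impI)
    fix f a assume a: "a \<in> V \<inter> ?K" and f: "\<forall>n. coeff f n \<in> V \<inter> ?K"
      and r: "poly f a \<in> max_ideal (V \<inter> ?K)" "poly (pderiv f) a \<notin> max_ideal (V \<inter> ?K)"
    note vK = valued_field_Int[OF vU sf]
    have in_K: "poly (pderiv f) a \<in> ?K"
      using poly_in[OF valued_fieldD(3)[OF vK] coeff_pderiv_in[OF valued_fieldD(3)[OF vK] f] a] by simp
    have r': "poly f a \<in> max_ideal V" "poly (pderiv f) a \<notin> max_ideal V"
      using r in_K by (auto simp: max_ideal_Int[OF sf])
    have ex: "\<exists>b\<in>V \<inter> S. poly f b = 0 \<and> b - a \<in> max_ideal V" if S: "S \<in> \<S>" for S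
    proof -
      have KS: "?K \<subseteq> S" using S by (auto simp: K)
      have "poly f a \<in> S" using r(1) KS by (auto simp: max_ideal_def)
      then have "\<exists>b\<in>V \<inter> S. poly f b = 0 \<and> b - a \<in> max_ideal (V \<inter> S)"
        using \<S>(2)[OF S, unfolded henselian_def] a f r' KS
        unfolding max_ideal_Int[OF \<S>(1)[OF S]] by blast
      then show ?thesis using max_ideal_Int[OF \<S>(1)[OF S]] by auto
    qed
    obtain b where b: "b \<in> V" "poly f b = 0" "b - a \<in> max_ideal V" using ex[OF U] by auto
    have "b \<in> S" if "S \<in> \<S>" for S
    proof -
      obtain c where c: "c \<in> V \<inter> S" "poly f c = 0" "c - a \<in> max_ideal V" using ex[OF \<open>S \<in> \<S>\<close>] by blast
      then have "b = c"
        using henselian_root_unique[OF vU, of f a b c] a f b r' by auto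
      then show ?thesis using c by simp
    qed
    then have bK: "b \<in> ?K" by (simp add: K)
    then have "b - a \<in> max_ideal (V \<inter> ?K)"
      using b a max_ideal_Int[OF sf] subringD(3)[OF subfieldD(1)[OF sf]] by auto
    then show "\<exists>b\<in>V \<inter> ?K. poly f b = 0 \<and> b - a \<in> max_ideal (V \<inter> ?K)" using b bK by blast
  qed
qed

lemma henselization_embedding_unique:
  fixes V F :: "'k::field set" and T W :: "'m::field set"
  assumes U: "henselian UNIV V" and T: "henselian T W"
    and "valued_embedding (henselization V F) (V \<inter> henselization V F) T W h1"
      "valued_embedding (henselization V F) (V \<inter> henselization V F) T W h2"
    and F: "\<forall>x\<in>F. h1 x = h2 x"
  shows "\<forall>x\<in>henselization V F. h1 x = h2 x"
proof -
  let ?K = "henselization V F"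
  define E where "E = {x\<in>?K. h1 x = h2 x}"
  have hK: "henselian ?K (V \<inter> ?K)" by (rule henselian_henselization[OF U])
  have K: "is_subfield ?K" using hK by (simp add: henselian_def valued_field_def)
  have vU: "valued_field UNIV V" and vT: "valued_field T W"
    using U T by (auto simp: henselian_def)
  note e1 = emb_simps[OF K assms(3)] and e2 = emb_simps[OF K assms(4)]
  note d1 = emb_diff[OF K assms(3)] and d2 = emb_diff[OF K assms(4)]
  note i1 = emb_inverse[OF K assms(3)] and i2 = emb_inverse[OF K assms(4)]
  note S' = subringD[OF subfieldD(1)[OF K]] subfieldD(2,3)[OF K]
  have sE: "is_subfield E"
    by (auto simp: E_def is_subfield_def is_subring_def S' e1 e2 d1 d2 i1 i2)
  have "henselian E (V \<inter> E)"
    unfolding henselian_def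
  proof (intro conjI valued_field_Int[OF vU sE] allI ballI impI)
    fix f a assume a: "a \<in> V \<inter> E" and f: "\<forall>n. coeff f n \<in> V \<inter> E"
      and r: "poly f a \<in> max_ideal (V \<inter> E)" "poly (pderiv f) a \<notin> max_ideal (V \<inter> E)"
    note vK = valued_field_Int[OF vU K] and vE = valued_field_Int[OF vU sE]
    have EK: "E \<subseteq> ?K" by (auto simp: E_def)
    have aK: "a \<in> V \<inter> ?K" and fK: "\<forall>n. coeff f n \<in> V \<inter> ?K" using a f EK by auto
    have fK': "\<forall>n. coeff f n \<in> ?K" using fK by auto
    have fE: "\<forall>n. coeff f n \<in> E" using f by auto
    note f'K = coeff_pderiv_in[OF subfieldD(1)[OF K] fK']
    have "poly (pderiv f) a \<in> E"
      using poly_in[OF subfieldD(1)[OF sE] coeff_pderiv_in[OF subfieldD(1)[OF sE] fE]] a by auto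
    then have r': "poly f a \<in> max_ideal V" "poly f a \<in> ?K" "poly (pderiv f) a \<notin> max_ideal V"
        "poly (pderiv f) a \<in> ?K"
      using r EK by (auto simp: max_ideal_Int[OF sE])
    then obtain b where b: "b \<in> V \<inter> ?K" "poly f b = 0" "b - a \<in> max_ideal (V \<inter> ?K)"
      using hK[unfolded henselian_def, THEN conjunct2, rule_format, OF aK, of f] fK
      by (auto simp: max_ideal_Int[OF K])
    have VK: "V \<inter> ?K \<subseteq> ?K" by simp
    have eq: "map_poly h1 f = map_poly h2 f"
      using f by (intro poly_eqI) (simp add: emb_coeff[OF K assms(3)] emb_coeff[OF K assms(4)] E_def)
    have a12: "h1 a = h2 a" using a by (simp add: E_def)
    have "h1 b = h2 b"
    proof (rule henselian_root_unique[OF vT, of "map_poly h1 f" "h1 a"])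
      show "\<forall>n. coeff (map_poly h1 f) n \<in> W"
        using fK by (simp add: emb_coeff[OF K assms(3)] e1)
      show "h1 a \<in> W" "h1 b \<in> W" "h2 b \<in> W" using aK b by (auto simp: e1 e2)
      show "poly (map_poly h1 f) (h1 b) = 0"
        using b by (simp add: emb_poly[OF K assms(3) fK'] emb_0[OF K assms(3)])
      show "poly (map_poly h1 f) (h2 b) = 0"
        using b by (simp add: eq emb_poly[OF K assms(4) fK'] emb_0[OF K assms(4)])
      show "h1 b - h1 a \<in> max_ideal W"
        using emb_max_ideal[OF K assms(3) VK, of "b - a"] b aK by (auto simp: d1 S')
      show "h2 b - h1 a \<in> max_ideal W"
        using emb_max_ideal[OF K assms(4) VK, of "b - a"] b aK by (auto simp: d2 S' a12)
      show "poly (pderiv (map_poly h1 f)) (h1 a) \<notin> max_ideal W"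
        using emb_max_ideal[OF K assms(3) VK r'(4)] r'(3,4) aK
        by (simp add: emb_poly[OF K assms(3) f'K] max_ideal_Int[OF K]
            flip: emb_map_poly_pderiv[OF K assms(3) fK'])
    qed
    then have bE: "b \<in> E" using b by (simp add: E_def)
    then show "\<exists>b\<in>V \<inter> E. poly f b = 0 \<and> b - a \<in> max_ideal (V \<inter> E)"
      using b a subringD(3)[OF subfieldD(1)[OF sE]] by (auto simp: max_ideal_Int[OF sE] max_ideal_Int[OF K])
  qed
  moreover have "F \<subseteq> E" using F subset_henselization[of F V] by (auto simp: E_def)
  ultimately have "?K \<subseteq> E" by (rule henselization_least[rotated])
  then show ?thesis by (auto simp: E_def)
qed

lemma rational_functionsI: "fps_to_fls (fps_of_poly p) \<in> rational_functions"
  unfolding rational_functions_def by (rule CollectI, rule exI[of _ p], rule exI[of _ 1]) simp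

lemma fls_X_rational: "fls_X \<in> rational_functions"
  using rational_functionsI[of "[:0, 1:]"] by simp

lemma rational_approximation:
  fixes b :: "'a::field fls"
  assumes "b \<in> fls_integers"
  shows "\<exists>a\<in>rational_functions \<inter> fls_integers. \<exists>v\<in>fls_integers. b - a = fls_X ^ N * v"
proof -
  define p where "p = Poly (map (\<lambda>i. b $$ int i) [0..<N])"
  define a where "a = fps_to_fls (fps_of_poly p)"
  have "a \<in> rational_functions \<inter> fls_integers"
    unfolding a_def using rational_functionsI by (auto simp: fls_integers_def)
  moreover have "(b - a) $$ n = 0" if "n < int N" for n
    using that assms
    by (cases "n < 0") (auto simp: a_def p_def coeff_Poly_eq nth_default_def fls_integers_iff)
  then have "\<exists>v\<in>fls_integers. b - a = fls_X ^ N * v" unfolding fls_X_power_dvd by blast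
  ultimately show ?thesis by blast
qed

lemma fls_poly_denominator:
  fixes p :: "'a::field fls poly"
  shows "\<exists>s. \<forall>n. fls_X ^ s * coeff p n \<in> fls_integers"
proof -
  define s where "s = Max ((\<lambda>n. nat (- fls_subdegree (coeff p n))) ` {..degree p})"
  have "fls_X ^ s * coeff p n \<in> fls_integers" for n
  proof (cases "coeff p n = 0")
    case False
    then have "nat (- fls_subdegree (coeff p n)) \<le> s"
      unfolding s_def by (intro Max_ge) (auto simp: le_degree)
    then show ?thesis using False by (simp add: fls_integers_subdegree)
  qed (simp add: fls_integers_iff)
  then show ?thesis by blast
qed

lemma embedding_extend:
  fixes A :: "'a::field fls set" and T W :: "'m::field set" and h :: "'a fls \<Rightarrow> 'm"
  assumes A: "is_subfield A" and FA: "rational_functions \<subseteq> A" and T: "henselian T W"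
    and emb: "valued_embedding A (fls_integers \<inter> A) T W h"
    and nh: "\<not> henselian A (fls_integers \<inter> A)"
  shows "\<exists>A' h'. A \<subset> A' \<and> is_subfield A' \<and> valued_embedding A' (fls_integers \<inter> A') T W h' \<and>
    (\<forall>x\<in>A. h' x = h x)"
proof -
  let ?V = "fls_integers :: 'a fls set"
  let ?X = "fls_X :: 'a fls"
  note vf = valued_field_fls[where ?'a = 'a]
  note vA = valued_field_Int[OF vf A]
  have vT: "valued_field T W" using T by (simp add: henselian_def)
  note V = subringD[OF valued_fieldD(3)[OF vf]]
  note W = subringD[OF valued_fieldD(3)[OF vT]]
  note A' = subringD[OF subfieldD(1)[OF A]] subfieldD(2,3)[OF A]
  have sT: "is_subfield T" using valued_fieldD(1)[OF vT] .
  note T' = subringD[OF subfieldD(1)[OF sT]] subfieldD(2,3)[OF sT]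
  note WT = subsetD[OF valued_fieldD(2)[OF vT]]
  note h = emb_simps[OF A emb]
  have VA: "?V \<inter> A \<subseteq> A" by simp
  have hm: "x \<in> A \<Longrightarrow> h x \<in> max_ideal W \<longleftrightarrow> x \<in> max_ideal ?V" for x
    using emb_max_ideal[OF A emb VA, of x] by (auto simp: max_ideal_Int[OF A])
  have hW: "x \<in> A \<Longrightarrow> h x \<in> W \<longleftrightarrow> x \<in> ?V" for x using h(5)[of x] by auto
  have XA: "?X \<in> A" using FA fls_X_rational by auto
  define P where "P p \<longleftrightarrow> (\<forall>n. coeff p n \<in> A)" for p
  note hpoly = emb_poly[OF A emb, folded P_def]
  note hmult = emb_map_poly_mult[OF A emb, folded P_def]
  note hdiff = emb_map_poly_diff[OF A emb, folded P_def]
  note hadd = emb_map_poly_add[OF A emb, folded P_def]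
  note Pmult = poly_in_mult[OF subfieldD(1)[OF A], folded P_def]
  obtain f a where a: "a \<in> ?V \<inter> A" and f: "\<forall>n. coeff f n \<in> ?V \<inter> A"
    and fa: "poly f a \<in> max_ideal (?V \<inter> A)" "poly (pderiv f) a \<notin> max_ideal (?V \<inter> A)"
    and nb: "\<not> (\<exists>b\<in>?V \<inter> A. poly f b = 0 \<and> b - a \<in> max_ideal (?V \<inter> A))"
    using nh vA unfolding henselian_def by blast
  have fV: "\<forall>n. coeff f n \<in> ?V" and Pf: "P f" using f by (auto simp: P_def)
  have Pf': "P (pderiv f)" using coeff_pderiv_in[OF subfieldD(1)[OF A]] Pf by (auto simp: P_def)
  have fA: "poly f a \<in> A" "poly (pderiv f) a \<in> A"
    using poly_in[OF subfieldD(1)[OF A]] Pf Pf' a by (auto simp: P_def)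
  then have fa': "poly f a \<in> max_ideal ?V" "poly (pderiv f) a \<notin> max_ideal ?V"
    using fa by (auto simp: max_ideal_Int[OF A])
  obtain b where b: "b \<in> ?V" "poly f b = 0" "b - a \<in> max_ideal ?V"
    using henselian_fls[unfolded henselian_def, THEN conjunct2, rule_format, of a f] a fV fa' by auto
  have bA: "b \<notin> A"
    using nb b a A'(3)[of b a] by (auto simp: max_ideal_Int[OF A])
  let ?hf = "map_poly h f"
  have hfW: "\<forall>n. coeff ?hf n \<in> W"
    using f by (simp add: emb_coeff[OF A emb] h(5))
  have hf'a: "poly (pderiv ?hf) (h a) \<notin> max_ideal W"
    using hm[OF fA(2)] fa'(2) a Pf Pf'
    by (simp add: hpoly flip: emb_map_poly_pderiv[OF A emb Pf[unfolded P_def]])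
  obtain c where c: "c \<in> W" "poly ?hf c = 0" "c - h a \<in> max_ideal W"
    using T[unfolded henselian_def, THEN conjunct2, rule_format, of "h a" ?hf]
      hfW hf'a a fa' fA h(5)[of a] hm[OF fA(1)] Pf by (auto simp: hpoly)
  have "poly (pderiv f) b \<notin> max_ideal ?V"
  proof -
    obtain w where w: "w \<in> ?V" "poly (pderiv f) b = poly (pderiv f) a + (b - a) * w"
      using taylor1[OF valued_fieldD(3)[OF vf] coeff_pderiv_in[OF valued_fieldD(3)[OF vf] fV] b(1), of a] a
      by auto
    then show ?thesis
      using unit_cong[OF vf _ fa'(2), of "poly (pderiv f) b"] max_ideal_mult[OF vf b(3) w(1)] by simp
  qed
  then have f'b: "poly (pderiv f) b \<noteq> 0" by (auto simp: max_ideal_def V)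
  have hf'c: "poly (pderiv ?hf) c \<notin> max_ideal W"
  proof -
    obtain w where w: "w \<in> W" "poly (pderiv ?hf) c = poly (pderiv ?hf) (h a) + (c - h a) * w"
      using taylor1[OF valued_fieldD(3)[OF vT] coeff_pderiv_in[OF valued_fieldD(3)[OF vT] hfW] c(1), of "h a"]
        a h(5)[of a] by auto
    then show ?thesis
      using unit_cong[OF vT _ hf'a, of "poly (pderiv ?hf) c"] max_ideal_mult[OF vT c(3) w(1)] by simp
  qed
  have Xm: "?X * v \<in> max_ideal ?V" if "v \<in> ?V" for v
    using that by (simp add: max_ideal_fls fls_integers_iff fls_X_times_conv_shift)

  have approx: "\<exists>a'\<in>?V \<inter> A. (\<exists>v\<in>?V. b - a' = ?X ^ Suc N * v) \<and> (\<exists>w\<in>W. c - h a' = h ?X ^ Suc N * w)" for N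
  proof -
    obtain a' v where a': "a' \<in> rational_functions" "a' \<in> ?V" and v: "v \<in> ?V" "b - a' = ?X ^ Suc N * v"
      using rational_approximation[OF b(1), of "Suc N"] by blast
    have a'A: "a' \<in> A" using a' FA by auto
    obtain w where w: "w \<in> ?V" "poly f a' = poly f b + (a' - b) * w"
      using taylor1[OF valued_fieldD(3)[OF vf] fV a'(2) b(1)] by blast
    define v0 where "v0 = poly f a' / ?X ^ Suc N"
    have "a' - b = - (?X ^ Suc N * v)" using v(2) by (simp add: algebra_simps)
    then have "v0 = ?X ^ Suc N * (- v * w) / ?X ^ Suc N"
      unfolding v0_def w(2) b(2) by (simp only: mult_minus_left mult_minus_right mult.assoc add_0)
    moreover have "?X ^ Suc N \<noteq> 0" by (simp del: power_Suc)
    ultimately have "v0 = - v * w" by (metis nonzero_mult_div_cancel_left)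
    then have v0V: "v0 \<in> ?V" using V(4)[OF V(5)[OF v(1)] w(1)] by simp
    have pa'A: "poly f a' \<in> A"
      using poly_in[OF subfieldD(1)[OF A] Pf[unfolded P_def] a'A] .
    have v0A: "v0 \<in> A" unfolding v0_def by (intro A' pa'A XA)
    have fa'2: "poly f a' = ?X ^ Suc N * v0" by (simp add: v0_def)
    have hfa': "poly ?hf (h a') = h ?X ^ Suc N * h v0"
      using hpoly[OF Pf a'A] h(4)[OF A'(8)[OF XA] v0A] emb_power[OF A emb XA]
      unfolding fa'2 by metis
    have ha'W: "h a' \<in> W" using hW[OF a'A] a' by simp
    obtain w' where w': "w' \<in> W" "poly ?hf (h a') = poly ?hf c + (h a' - c) *
        (poly (pderiv ?hf) c + (h a' - c) * w')"
      using taylor2[OF valued_fieldD(3)[OF vT] hfW ha'W c(1)] by blast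
    have "b - a' \<in> max_ideal ?V"
      unfolding v(2) power_Suc mult.assoc
      by (intro Xm V v(1)) (auto simp: fls_integers_iff)
    then have "(b - a) - (b - a') \<in> max_ideal ?V" using max_ideal_diff[OF vf b(3)] by blast
    then have "h (a' - a) \<in> max_ideal W" using hm[of "a' - a"] A'(3)[OF a'A] a by simp
    then have "h a' - h a \<in> max_ideal W" using emb_diff[OF A emb a'A, of a] a by simp
    then have "h a' - h a - (c - h a) \<in> max_ideal W" by (rule max_ideal_diff[OF vT _ c(3)])
    then have d: "h a' - c \<in> max_ideal W" by simp
    define u where "u = poly (pderiv ?hf) c + (h a' - c) * w'"
    have um: "u \<notin> max_ideal W"
      using unit_cong[OF vT _ hf'c, of u] max_ideal_mult[OF vT d w'(1)] by (simp add: u_def)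
    have uW: "u \<in> W"
      unfolding u_def using coeff_pderiv_in[OF valued_fieldD(3)[OF vT] hfW]
      by (intro W poly_in[OF valued_fieldD(3)[OF vT]] c ha'W w')
    have u: "u \<noteq> 0" "inverse u \<in> W" using unitD[OF vT uW um] by auto
    have "h ?X ^ Suc N * h v0 = (h a' - c) * u" using w'(2) hfa' c(2) by (simp add: u_def)
    then have "c - h a' = h ?X ^ Suc N * (- h v0 * inverse u)" using u(1) by (simp add: field_simps)
    moreover have "- h v0 * inverse u \<in> W"
      using hW[OF v0A] v0V by (intro W u) auto
    ultimately show ?thesis using a' a'A v by blast
  qed

  have val: "\<exists>w\<in>A. w \<noteq> 0 \<and> poly p b / w \<in> ?V \<and> w / poly p b \<in> ?V \<and>
      poly (map_poly h p) c / h w \<in> W \<and> h w / poly (map_poly h p) c \<in> W \<and> poly (map_poly h p) c \<noteq> 0"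
    if p: "P p" "poly p b \<noteq> 0" for p
  proof -
    obtain s where s: "\<forall>n. ?X ^ s * coeff p n \<in> ?V" using fls_poly_denominator by blast
    have XsA: "?X ^ s \<in> A" by (rule A'(8)[OF XA])
    define p1 where "p1 = smult (?X ^ s) p"
    have p1V: "\<forall>n. coeff p1 n \<in> ?V" and Pp1: "P p1"
      using s p A'(4)[OF XsA] by (auto simp: p1_def P_def)
    define u where "u = poly p1 b"
    have u0: "u \<noteq> 0" "u \<in> ?V"
      using p poly_in[OF valued_fieldD(3)[OF vf] p1V b(1)] by (auto simp: u_def p1_def)
    define N where "N = nat (fls_subdegree u)"
    obtain a' v w where a': "a' \<in> ?V" "a' \<in> A" and v: "v \<in> ?V" "b - a' = ?X ^ Suc N * v"
      and w: "w \<in> W" "c - h a' = h ?X ^ Suc N * w" using approx[of N] by blast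
    have Xu: "?X ^ Suc N / u \<in> max_ideal ?V"
    proof -
      have "fls_subdegree u \<ge> 0" using u0 by (simp add: fls_integers_subdegree)
      moreover have "fls_subdegree (?X ^ Suc N / u) = int (Suc N) - fls_subdegree u"
        using u0 by (simp add: fls_divide_subdegree del: power_Suc)
      ultimately have "fls_subdegree (?X ^ Suc N / u) > 0" by (simp add: N_def)
      then show ?thesis by (auto simp: max_ideal_fls fls_integers_subdegree)
    qed
    define w1 where "w1 = poly p1 a'"
    have w1: "w1 \<in> ?V" "w1 \<in> A"
      using poly_in[OF valued_fieldD(3)[OF vf] p1V a'(1)]
        poly_in[OF subfieldD(1)[OF A] Pp1[unfolded P_def] a'(2)] by (auto simp: w1_def)
    obtain z where z: "z \<in> ?V" "u = w1 + (b - a') * z"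
      using taylor1[OF valued_fieldD(3)[OF vf] p1V b(1) a'(1)] by (auto simp: u_def w1_def)
    have e1: "w1 / u - 1 = - (?X ^ Suc N / u * (v * z))"
      using u0 z(2) unfolding v(2) by (simp add: field_simps)
    have e2: "w1 / u - 1 \<in> max_ideal ?V"
      unfolding e1 by (intro max_ideal_uminus[OF vf] max_ideal_mult[OF vf Xu] V v z)
    then have w1u: "w1 / u \<notin> max_ideal ?V"
      using unit_cong[OF vf _ one_notin_max_ideal[OF vf]] by blast
    have w1u': "w1 / u \<in> ?V"
      using V(6)[OF max_idealD[OF vf e2] V(2)] by simp
    have w10: "w1 \<noteq> 0" and uw1: "u / w1 \<in> ?V"
      using unitD[OF vf w1u' w1u] by auto
    have "?X ^ Suc N / u * (u / w1) \<in> max_ideal ?V" by (rule max_ideal_mult[OF vf Xu uw1])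
    then have "?X ^ Suc N / w1 \<in> max_ideal ?V" using u0 by simp
    moreover have "?X ^ Suc N / w1 \<in> A" by (intro A' XA w1)
    ultimately have "h (?X ^ Suc N / w1) \<in> max_ideal W" using hm by blast
    then have Xw: "h ?X ^ Suc N / h w1 \<in> max_ideal W"
      using emb_divide[OF A emb A'(8)[OF XA] w1(2)] emb_power[OF A emb XA] by metis
    have hw10: "h w1 \<noteq> 0" using emb_eq_0[OF A emb w1(2)] w10 by simp
    define u' where "u' = poly (map_poly h p1) c"
    have hp1W: "\<forall>n. coeff (map_poly h p1) n \<in> W"
      using p1V Pp1 by (simp add: emb_coeff[OF A emb] hW P_def)
    have ha'W: "h a' \<in> W" using hW[OF a'(2)] a' by simp
    obtain z' where z': "z' \<in> W" "u' = h w1 + (c - h a') * z'"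
      using taylor1[OF valued_fieldD(3)[OF vT] hp1W c(1) ha'W] hpoly[OF Pp1 a'(2)]
      by (auto simp: u'_def w1_def)
    have e1': "u' / h w1 - 1 = h ?X ^ Suc N / h w1 * (w * z')"
      using hw10 z'(2) unfolding w(2) by (simp add: field_simps)
    have e2': "u' / h w1 - 1 \<in> max_ideal W"
      unfolding e1' by (intro max_ideal_mult[OF vT Xw] W w z')
    then have uw': "u' / h w1 \<notin> max_ideal W"
      using unit_cong[OF vT _ one_notin_max_ideal[OF vT]] by blast
    have uw'': "u' / h w1 \<in> W"
      using W(6)[OF max_idealD[OF vT e2'] W(2)] by simp
    have u'0: "u' \<noteq> 0" and wu': "h w1 / u' \<in> W"
      using unitD[OF vT uw'' uw'] by auto
    define w0 where "w0 = w1 / ?X ^ s"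
    have w0A: "w0 \<in> A" unfolding w0_def by (intro A' XA w1)
    have hw0: "h w0 = h w1 / h ?X ^ s"
      unfolding w0_def using emb_divide[OF A emb w1(2) XsA] emb_power[OF A emb XA] by simp
    have hX0: "h ?X \<noteq> 0" using emb_eq_0[OF A emb XA] by simp
    have up: "u = ?X ^ s * poly p b" by (simp add: u_def p1_def)
    have "map_poly h p1 = smult (h ?X ^ s) (map_poly h p)"
      using p(1) XsA emb_power[OF A emb XA, of s]
      by (intro poly_eqI) (simp add: p1_def emb_coeff[OF A emb] h(4) P_def)
    then have up': "u' = h ?X ^ s * poly (map_poly h p) c" by (simp add: u'_def)
    have "poly p b / w0 = u / w1" "w0 / poly p b = w1 / u"
      by (simp_all only: up w0_def divide_divide_eq_right divide_divide_eq_left mult.commute)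
    moreover have "poly (map_poly h p) c / h w0 = u' / h w1" "h w0 / poly (map_poly h p) c = h w1 / u'"
      using hX0 by (simp_all add: up' hw0 field_simps)
    moreover have "poly (map_poly h p) c \<noteq> 0" using u'0 by (auto simp: up')
    moreover have "w0 \<noteq> 0" unfolding w0_def divide_eq_0_iff using w10 by simp
    ultimately show ?thesis using w0A uw1 w1u' uw'' wu' by metis
  qed

  have "f \<noteq> 0" using f'b by auto
  then have ex: "\<exists>p. p \<noteq> 0 \<and> P p \<and> poly p b = 0" using Pf b(2) by blast
  define m where "m = arg_min degree (\<lambda>p. p \<noteq> 0 \<and> P p \<and> poly p b = 0)"
  have m: "m \<noteq> 0" "P m" "poly m b = 0"
    and mmin: "\<And>p. p \<noteq> 0 \<Longrightarrow> P p \<Longrightarrow> poly p b = 0 \<Longrightarrow> degree m \<le> degree p"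
    using arg_min_nat_lemma[of "\<lambda>p. p \<noteq> 0 \<and> P p \<and> poly p b = 0" _ degree] ex
    unfolding m_def by blast+
  have mdvd: "\<exists>q. P q \<and> p = m * q" if p: "P p" "poly p b = 0" for p
  proof -
    obtain q r where qr: "P q" "P r" "p = m * q + r" "r = 0 \<or> degree r < degree m"
      using poly_div_subfield[OF A m(2)[unfolded P_def] m(1) p(1)[unfolded P_def]]
      unfolding P_def by blast
    then have "poly r b = 0" using p m by simp
    then have "r = 0" using mmin[of r] qr by fastforce
    then show ?thesis using qr by auto
  qed
  have hmc: "poly (map_poly h m) c = 0"
  proof -
    obtain q where q: "P q" "f = m * q" using mdvd[OF Pf b(2)] by blast
    have "poly (pderiv f) b = poly (pderiv m) b * poly q b"
      using m(3) by (simp add: q(2) pderiv_mult)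
    then have "poly q b \<noteq> 0" using f'b by auto
    then have "poly (map_poly h q) c \<noteq> 0" using val[OF q(1)] by blast
    then show ?thesis using c(2) q m(2) by (simp add: hmult)
  qed
  have ann: "poly (map_poly h p) c = 0" if p: "P p" "poly p b = 0" for p
  proof -
    obtain q where "P q" "p = m * q" using mdvd[OF p] by blast
    then show ?thesis using hmc m(2) by (simp add: hmult)
  qed

  define B where "B = {poly p b / poly q b | p q. P p \<and> P q \<and> poly q b \<noteq> 0}"
  define h' where "h' x = (SOME y. \<exists>p q. P p \<and> P q \<and> poly q b \<noteq> 0 \<and> x = poly p b / poly q b \<and>
      y = poly (map_poly h p) c / poly (map_poly h q) c)" for x
  have h': "h' (poly p b / poly q b) = poly (map_poly h p) c / poly (map_poly h q) c"
    if pq: "P p" "P q" "poly q b \<noteq> 0" for p q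
  proof -
    have "\<exists>p' q'. P p' \<and> P q' \<and> poly q' b \<noteq> 0 \<and> poly p b / poly q b = poly p' b / poly q' b \<and>
        h' (poly p b / poly q b) = poly (map_poly h p') c / poly (map_poly h q') c"
      unfolding h'_def by (rule someI_ex) (use pq in blast)
    then obtain p' q' where pq': "P p'" "P q'" "poly q' b \<noteq> 0"
        "poly p b / poly q b = poly p' b / poly q' b"
        "h' (poly p b / poly q b) = poly (map_poly h p') c / poly (map_poly h q') c" by blast
    have "poly (p * q' - p' * q) b = 0" using pq pq' by (simp add: field_simps)
    then have "poly (map_poly h (p * q' - p' * q)) c = 0"
      by (intro ann Pmult pq pq')
    then have "poly (map_poly h p) c * poly (map_poly h q') c = poly (map_poly h p') c * poly (map_poly h q) c"
      using pq pq' by (simp add: hdiff hmult Pmult)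
    moreover have "poly (map_poly h q) c \<noteq> 0" "poly (map_poly h q') c \<noteq> 0"
      using val pq pq' by blast+
    ultimately show ?thesis by (simp add: pq'(5) frac_eq_eq)
  qed
  have hq0: "poly (map_poly h q) c \<noteq> 0" if "P q" "poly q b \<noteq> 0" for q using val that by blast
  have P1: "P 1" "P 0" "P [:0, 1:]" and Pc: "x \<in> A \<Longrightarrow> P [:x:]" for x
    using A'(1,2) by (auto simp: P_def coeff_1 coeff_pCons split: nat.split)
  have mp1: "map_poly h 1 = 1"
    by (intro poly_eqI) (simp add: emb_coeff[OF A emb] coeff_1 h(2) emb_0[OF A emb])
  have mpc: "map_poly h [:x:] = [:h x:]" for x
    by (intro poly_eqI) (simp add: emb_coeff[OF A emb] coeff_pCons emb_0[OF A emb] split: nat.split)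
  have BI: "poly p b / poly q b \<in> B" if "P p" "P q" "poly q b \<noteq> 0" for p q
    using that unfolding B_def by blast
  have AB: "x \<in> B \<and> h' x = h x" if "x \<in> A" for x
    using BI[of "[:x:]" 1] h'[of "[:x:]" 1] Pc[OF that] P1 by (simp add: mpc mp1)
  have bB: "b \<in> B" using BI[of "[:0, 1:]" 1] P1 by simp
  have B: "is_subfield B"
    unfolding is_subfield_def is_subring_def
  proof (intro conjI ballI)
    show "1 \<in> B" using AB A'(2) by blast
  next
    fix x y assume "x \<in> B" "y \<in> B"
    then obtain p q p' q' where x: "x = poly p b / poly q b" "P p" "P q" "poly q b \<noteq> 0"
      and y: "y = poly p' b / poly q' b" "P p'" "P q'" "poly q' b \<noteq> 0" unfolding B_def by blast
    have "x - y = poly (p * q' - p' * q) b / poly (q * q') b"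
      "x * y = poly (p * p') b / poly (q * q') b"
      unfolding x(1) y(1) using x(4) y(4) by (simp_all add: field_simps)
    then show "x - y \<in> B" "x * y \<in> B"
      using BI[of "p * q' - p' * q" "q * q'"] BI[of "p * p'" "q * q'"] x y Pmult by simp_all
  next
    fix x assume "x \<in> B"
    then obtain p q where x: "x = poly p b / poly q b" "P p" "P q" "poly q b \<noteq> 0"
      unfolding B_def by blast
    then show "inverse x \<in> B"
      using BI[of q p] AB A'(1) by (cases "poly p b = 0") auto
  qed
  have "valued_embedding B (?V \<inter> B) T W h'"
    unfolding valued_embedding_def
  proof (intro conjI ballI)
    show "h' 1 = 1" using AB[OF A'(2)] h(2) by simp
  next
    show "h' ` B \<subseteq> T"
    proof
      fix y assume "y \<in> h' ` B"
      then obtain p q where x: "y = h' (poly p b / poly q b)" "P p" "P q" "poly q b \<noteq> 0"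
        unfolding B_def by blast
      have "poly (map_poly h p) c \<in> T" if "P p" for p
        using that c(1) WT h(1)
        by (intro poly_in[OF subfieldD(1)[OF sT]]) (auto simp: emb_coeff[OF A emb] P_def)
      then show "y \<in> T" unfolding x(1) h'[OF x(2-4)] using x by (intro T') auto
    qed
  next
    fix x y assume "x \<in> B" "y \<in> B"
    then obtain p q p' q' where x: "x = poly p b / poly q b" "P p" "P q" "poly q b \<noteq> 0"
      and y: "y = poly p' b / poly q' b" "P p'" "P q'" "poly q' b \<noteq> 0" unfolding B_def by blast
    have e: "x + y = poly (p * q' + p' * q) b / poly (q * q') b"
      "x * y = poly (p * p') b / poly (q * q') b"
      unfolding x(1) y(1) using x(4) y(4) by (simp_all add: field_simps)
    have qq: "P (q * q')" "poly (q * q') b \<noteq> 0" and pp: "P (p * q' + p' * q)" "P (p * p')"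
      using x y by (simp_all add: Pmult)
    have hx: "h' x = poly (map_poly h p) c / poly (map_poly h q) c"
      unfolding x(1) by (rule h'[OF x(2-4)])
    have hy: "h' y = poly (map_poly h p') c / poly (map_poly h q') c"
      unfolding y(1) by (rule h'[OF y(2-4)])
    show "h' (x + y) = h' x + h' y" "h' (x * y) = h' x * h' y"
      unfolding e hx hy h'[OF pp(1) qq] h'[OF pp(2) qq]
      using hq0[OF x(3,4)] hq0[OF y(3,4)] x y Pmult by (simp_all add: hadd hmult field_simps)
  next
    fix x assume "x \<in> B"
    then obtain p q where x: "x = poly p b / poly q b" "P p" "P q" "poly q b \<noteq> 0"
      unfolding B_def by blast
    show "h' x \<in> W \<longleftrightarrow> x \<in> ?V \<inter> B"
    proof (cases "poly p b = 0")
      case True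
      then show ?thesis using x h'[of p q] ann[of p] V W AB[OF A'(1)] by simp
    next
      case False
      obtain w where w: "w \<in> A" "w \<noteq> 0" "poly p b / w \<in> ?V" "w / poly p b \<in> ?V"
          "poly (map_poly h p) c / h w \<in> W" "h w / poly (map_poly h p) c \<in> W"
          "poly (map_poly h p) c \<noteq> 0" using val[OF x(2) False] by blast
      obtain z where z: "z \<in> A" "z \<noteq> 0" "poly q b / z \<in> ?V" "z / poly q b \<in> ?V"
          "poly (map_poly h q) c / h z \<in> W" "h z / poly (map_poly h q) c \<in> W"
          "poly (map_poly h q) c \<noteq> 0" using val[OF x(3,4)] by blast
      have wz: "w / z \<in> A" by (rule A'(10)[OF w(1) z(1)])
      have hwz: "h w \<noteq> 0" "h z \<noteq> 0" using emb_eq_0[OF A emb] w z by auto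
      have "x \<in> ?V \<longleftrightarrow> w / z \<in> ?V"
      proof
        assume "x \<in> ?V"
        then have "x * (w / poly p b) * (poly q b / z) \<in> ?V" by (intro V(4) w z)
        then show "w / z \<in> ?V" using False x by simp
      next
        assume "w / z \<in> ?V"
        then have "w / z * (poly p b / w) * (z / poly q b) \<in> ?V" by (intro V(4) w z)
        then show "x \<in> ?V" using w z x by simp
      qed
      moreover have "h' x \<in> W \<longleftrightarrow> h (w / z) \<in> W"
        unfolding x(1) h'[OF x(2-4)] emb_divide[OF A emb w(1) z(1)]
      proof
        assume "poly (map_poly h p) c / poly (map_poly h q) c \<in> W"
        then have "poly (map_poly h p) c / poly (map_poly h q) c * (h w / poly (map_poly h p) c) *
            (poly (map_poly h q) c / h z) \<in> W" by (intro W(4) w z)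
        then show "h w / h z \<in> W" using w(7) z(7) by simp
      next
        assume "h w / h z \<in> W"
        then have "h w / h z * (poly (map_poly h p) c / h w) * (h z / poly (map_poly h q) c) \<in> W"
          by (intro W(4) w z)
        then show "poly (map_poly h p) c / poly (map_poly h q) c \<in> W" using hwz by simp
      qed
      ultimately show ?thesis using hW[OF wz] \<open>x \<in> B\<close> by simp
    qed
  qed
  then show ?thesis using AB bB bA B by (intro exI[of _ B] exI[of _ h']) auto
qed

lemma rat_henselization_embedding_exists:
  fixes T W :: "'m::field set" and g :: "'a::field fls \<Rightarrow> 'm"
  assumes T: "henselian T W" and F: "is_subfield (rational_functions :: 'a fls set)"
    and g: "valued_embedding rational_functions (fls_integers \<inter> rational_functions) T W g"
  shows "\<exists>h. valued_embedding rat_henselization (fls_integers \<inter> rat_henselization) T W h \<and>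
    (\<forall>x\<in>rational_functions. h x = g x)"
proof -
  let ?V = "fls_integers :: 'a fls set"
  let ?F = "rational_functions :: 'a fls set"
  define ok where "ok A h \<longleftrightarrow> is_subfield A \<and> ?F \<subseteq> A \<and> valued_embedding A (?V \<inter> A) T W h \<and>
      (\<forall>x\<in>?F. h x = g x)" for A and h :: "'a fls \<Rightarrow> 'm"
  define \<G> where "\<G> = {(\<lambda>x. (x, h x)) ` A | A h. ok A h}"
  have "ok ?F g" using F g by (simp add: ok_def)
  then have ne: "\<G> \<noteq> {}" unfolding \<G>_def by blast
  have "\<Union>\<C> \<in> \<G>" if ne: "\<C> \<noteq> {}" and ch: "subset.chain \<G> \<C>" for \<C>
  proof -
    define B where "B = {x. \<exists>y. (x, y) \<in> \<Union>\<C>}"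
    define H where "H x = (SOME y. (x, y) \<in> \<Union>\<C>)" for x
    have in\<G>: "\<exists>A h. G = (\<lambda>x. (x, h x)) ` A \<and> ok A h" if "G \<in> \<C>" for G
      using ch that unfolding subset_chain_def \<G>_def by blast
    have common: "\<exists>G\<in>\<C>. u \<in> G \<and> v \<in> G" if "u \<in> \<Union>\<C>" "v \<in> \<Union>\<C>" for u v
      using ch that unfolding subset_chain_def by blast
    have sv: "y = z" if "(x, y) \<in> \<Union>\<C>" "(x, z) \<in> \<Union>\<C>" for x y z
      using common[OF that] in\<G> by blast
    have H: "H x = y" if "(x, y) \<in> \<Union>\<C>" for x y
      unfolding H_def using sv that by blast
    have loc: "\<exists>A h. x \<in> A \<and> y \<in> A \<and> A \<subseteq> B \<and> ok A h \<and> (\<forall>z\<in>A. H z = h z)" if xy: "x \<in> B" "y \<in> B" for x y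
    proof -
      obtain x' y' where "(x, x') \<in> \<Union>\<C>" "(y, y') \<in> \<Union>\<C>" using xy unfolding B_def by blast
      then obtain G where G: "G \<in> \<C>" "(x, x') \<in> G" "(y, y') \<in> G" using common by blast
      obtain A h where Ah: "G = (\<lambda>x. (x, h x)) ` A" "ok A h" using in\<G>[OF G(1)] by blast
      have "A \<subseteq> B" using G(1) Ah(1) unfolding B_def by blast
      moreover have "\<forall>z\<in>A. H z = h z" using H G(1) Ah(1) by blast
      moreover have "x \<in> A" "y \<in> A" using G Ah by auto
      ultimately show ?thesis using Ah(2) by blast
    qed
    obtain x0 where x0: "x0 \<in> B"
    proof -
      obtain G where "G \<in> \<C>" using ne by blast
      moreover obtain A h where "G = (\<lambda>x. (x, h x)) ` A" "ok A h" using in\<G>[OF \<open>G \<in> \<C>\<close>] by blast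
      moreover have "1 \<in> A" using \<open>ok A h\<close> by (simp add: ok_def is_subfield_def is_subring_def)
      ultimately have "1 \<in> B" unfolding B_def by blast
      then show ?thesis using that by blast
    qed
    have glob: "?F \<subseteq> B" "1 \<in> B" "H 1 = 1" "\<forall>x\<in>?F. H x = g x"
    proof -
      obtain A h where "A \<subseteq> B" "ok A h" "\<forall>z\<in>A. H z = h z" using loc[OF x0 x0] by blast
      then show "?F \<subseteq> B" "1 \<in> B" "H 1 = 1" "\<forall>x\<in>?F. H x = g x"
        unfolding ok_def is_subfield_def is_subring_def valued_embedding_def by auto
    qed
    have two: "x - y \<in> B \<and> x * y \<in> B \<and> inverse x \<in> B \<and> H (x + y) = H x + H y \<and> H (x * y) = H x * H y \<and>
        H x \<in> T \<and> (H x \<in> W \<longleftrightarrow> x \<in> ?V)" if xy: "x \<in> B" "y \<in> B" for x y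
    proof -
      obtain A h where A: "x \<in> A" "y \<in> A" "A \<subseteq> B" "ok A h" and Hh: "\<forall>z\<in>A. H z = h z"
        using loc[OF xy] by blast
      have sA: "is_subfield A" and e: "valued_embedding A (?V \<inter> A) T W h" using A by (auto simp: ok_def)
      note A' = subringD[OF subfieldD(1)[OF sA]] subfieldD(2,3)[OF sA]
      show ?thesis using A(1-3) A'(3,4,6)[OF A(1,2)] A'(9)[OF A(1)] emb_simps(1,5)[OF sA e A(1)]
          emb_simps(3,4)[OF sA e A(1,2)] Hh by auto
    qed
    have "is_subfield B" using glob two by (auto simp: is_subfield_def is_subring_def)
    moreover have "valued_embedding B (?V \<inter> B) T W H"
      using glob two by (auto simp: valued_embedding_def)
    ultimately have "ok B H" using glob by (auto simp: ok_def)
    moreover have "\<Union>\<C> = (\<lambda>x. (x, H x)) ` B"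
    proof
      show "\<Union>\<C> \<subseteq> (\<lambda>x. (x, H x)) ` B"
      proof
        fix u assume "u \<in> \<Union>\<C>"
        then have "(fst u, snd u) \<in> \<Union>\<C>" by simp
        then have "fst u \<in> B" "H (fst u) = snd u" using H unfolding B_def by blast+
        then show "u \<in> (\<lambda>x. (x, H x)) ` B" by (intro image_eqI[of _ _ "fst u"]) simp_all
      qed
      show "(\<lambda>x. (x, H x)) ` B \<subseteq> \<Union>\<C>"
      proof
        fix u assume "u \<in> (\<lambda>x. (x, H x)) ` B"
        then obtain x y where "u = (x, H x)" "(x, y) \<in> \<Union>\<C>" unfolding B_def by blast
        then show "u \<in> \<Union>\<C>" using H[of x y] by metis
      qed
    qed
    ultimately show ?thesis unfolding \<G>_def by blast
  qed
  then obtain M where M: "M \<in> \<G>" "\<And>G. G \<in> \<G> \<Longrightarrow> M \<subseteq> G \<Longrightarrow> G = M"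
    using subset_Zorn_nonempty[OF ne] by metis
  then obtain A h where A: "M = (\<lambda>x. (x, h x)) ` A" "ok A h" unfolding \<G>_def by blast
  have "henselian A (?V \<inter> A)"
  proof (rule ccontr)
    assume "\<not> ?thesis"
    then obtain A' h' where A': "A \<subset> A'" "is_subfield A'" "valued_embedding A' (?V \<inter> A') T W h'"
        "\<forall>x\<in>A. h' x = h x"
      using embedding_extend[of A T W h] A(2) T unfolding ok_def by blast
    have FA: "?F \<subseteq> A" "\<forall>x\<in>?F. h x = g x" using A(2) by (simp_all add: ok_def)
    then have "\<forall>x\<in>?F. h' x = g x" using A'(4) by (simp add: subset_eq)
    moreover have "?F \<subseteq> A'" using FA(1) A'(1) by (meson psubset_imp_subset subset_trans)
    ultimately have "ok A' h'" using A'(2,3) by (simp add: ok_def)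
    moreover have "(x, h x) \<in> (\<lambda>x. (x, h' x)) ` A'" if "x \<in> A" for x
      using A'(1,4) that by (intro image_eqI[of _ _ x]) auto
    then have "M \<subseteq> (\<lambda>x. (x, h' x)) ` A'" unfolding A(1) by blast
    ultimately have "(\<lambda>x. (x, h' x)) ` A' = M" using M(2) unfolding \<G>_def by blast
    then have "fst ` ((\<lambda>x. (x, h' x)) ` A') = fst ` ((\<lambda>x. (x, h x)) ` A)" by (simp add: A(1))
    then show False using A'(1) by (simp add: image_image)
  qed
  then have "rat_henselization \<subseteq> A"
    unfolding rat_henselization_def using A(2) by (intro henselization_least) (auto simp: ok_def)
  then have "valued_embedding rat_henselization (?V \<inter> rat_henselization) T W h"
    using A(2) unfolding ok_def valued_embedding_def by blast
  then show ?thesis using A(2) unfolding ok_def by blast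
qed

lemma is_subfield_rational_functions: "is_subfield (rational_functions :: 'a::field fls set)"
  unfolding is_subfield_def is_subring_def
proof (intro conjI ballI)
  show "1 \<in> (rational_functions :: 'a fls set)" using rational_functionsI[of 1] by simp
next
  fix x y :: "'a fls" assume "x \<in> rational_functions" "y \<in> rational_functions"
  then obtain p q p' q' :: "'a poly" where
    x: "x = fps_to_fls (fps_of_poly p) / fps_to_fls (fps_of_poly q)" "q \<noteq> 0" and
    y: "y = fps_to_fls (fps_of_poly p') / fps_to_fls (fps_of_poly q')" "q' \<noteq> 0"
    unfolding rational_functions_def by blast
  have "fps_of_poly q \<noteq> 0" "fps_of_poly q' \<noteq> 0" using x y by (metis fps_of_poly_0 fps_of_poly_eq_iff)+
  then have "x - y = fps_to_fls (fps_of_poly (p * q' - p' * q)) / fps_to_fls (fps_of_poly (q * q'))"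
    "x * y = fps_to_fls (fps_of_poly (p * p')) / fps_to_fls (fps_of_poly (q * q'))"
    by (simp_all add: x y fps_of_poly_mult fps_of_poly_diff fls_times_fps_to_fls field_simps)
  then show "x - y \<in> rational_functions" "x * y \<in> rational_functions"
    unfolding rational_functions_def using x y by (metis (mono_tags, lifting) CollectI mult_eq_0_iff)+
next
  fix x :: "'a fls" assume "x \<in> rational_functions"
  then obtain p q :: "'a poly" where
    x: "x = fps_to_fls (fps_of_poly p) / fps_to_fls (fps_of_poly q)" "q \<noteq> 0"
    unfolding rational_functions_def by blast
  show "inverse x \<in> rational_functions"
  proof (cases "p = 0")
    case True
    then show ?thesis using x rational_functionsI[of 0] by simp
  next
    case False
    then show ?thesis unfolding rational_functions_def
      by (rule_tac CollectI, rule_tac x = q in exI, rule_tac x = p in exI) (simp add: x)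
  qed
qed

theorem rat_henselization_universal:
  fixes T W :: "'m::field set" and g :: "'a::field fls \<Rightarrow> 'm"
  defines "F \<equiv> rational_functions" and "K \<equiv> rat_henselization" and "V \<equiv> fls_integers"
  shows "F \<subseteq> K" and "henselian K (V \<inter> K)"
    and "henselian T W \<Longrightarrow> valued_embedding F (V \<inter> F) T W g \<Longrightarrow>
      \<exists>h. valued_embedding K (V \<inter> K) T W h \<and> (\<forall>x\<in>F. h x = g x) \<and>
        (\<forall>h'. valued_embedding K (V \<inter> K) T W h' \<and> (\<forall>x\<in>F. h' x = g x) \<longrightarrow> (\<forall>x\<in>K. h' x = h x))"
proof -
  show "F \<subseteq> K" unfolding F_def K_def rat_henselization_def by (rule subset_henselization)
  show "henselian K (V \<inter> K)"
    unfolding V_def K_def rat_henselization_def by (intro henselian_henselization henselian_fls)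
  assume *: "henselian T W" "valued_embedding F (V \<inter> F) T W g"
  then obtain h where h: "valued_embedding K (V \<inter> K) T W h" "\<forall>x\<in>F. h x = g x"
    using rat_henselization_embedding_exists[OF *(1) is_subfield_rational_functions, of g]
    unfolding F_def K_def V_def by blast
  have "\<forall>x\<in>K. h' x = h x" if h': "valued_embedding K (V \<inter> K) T W h'" "\<forall>x\<in>F. h' x = g x" for h'
    using h h' unfolding K_def V_def F_def rat_henselization_def
    by (intro henselization_embedding_unique[OF henselian_fls *(1)]) auto
  then show "\<exists>h. valued_embedding K (V \<inter> K) T W h \<and> (\<forall>x\<in>F. h x = g x) \<and>
        (\<forall>h'. valued_embedding K (V \<inter> K) T W h' \<and> (\<forall>x\<in>F. h' x = g x) \<longrightarrow> (\<forall>x\<in>K. h' x = h x))"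
    using h by blast
qed

unbundle no fps_syntax


section \<open>Skew polynomials\<close>

text \<open>The normal form \<open>t\<^sup>n a\<^sub>n + \<dots> + t a\<^sub>1 + a\<^sub>0\<close> is represented by the
  polynomial with coefficients \<open>a\<^sub>i\<close>. The relation \<open>t a\<^sup>d = a t\<close> gives
  \<open>(t\<^sup>i a) (t\<^sup>j b) = t\<^bsup>i+j\<^esup> a\<^bsup>d^j\<^esup> b\<close>.\<close>

definition skew_mult :: "nat \<Rightarrow> 'k::field poly \<Rightarrow> 'k poly \<Rightarrow> 'k poly" where
  "skew_mult d r s =
     (\<Sum>i\<le>degree r. \<Sum>j\<le>degree s. monom (coeff r i ^ (d ^ j) * coeff s j) (i + j))"

definition skew_poly_ring :: "nat \<Rightarrow> 'k::field set \<Rightarrow> 'k poly ring" where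
  "skew_poly_ring d S =
     \<lparr>carrier = {r. \<forall>n. coeff r n \<in> S}, mult = skew_mult d, one = 1, zero = 0, add = (+)\<rparr>"

text \<open>The right action \<open>x.r\<close> determined by \<open>x.a = a x\<close> for scalars \<open>a\<close> and \<open>x.t = x\<^sup>d\<close>;
  see \<open>skew_act_mult\<close>.\<close>

definition skew_act :: "nat \<Rightarrow> 'k::field \<Rightarrow> 'k poly \<Rightarrow> 'k" where
  "skew_act d x r = (\<Sum>i\<le>degree r. coeff r i * x ^ (d ^ i))"

context
  fixes d k :: nat and dummy :: "'k::field itself"
  assumes p: "prime CHAR('k)" and d: "d = CHAR('k) ^ k" and k: "k \<ge> 1" and inf: "infinite (UNIV :: 'k set)"
begin

lemma d_gt_1: "d > 1"
  using prime_gt_1_nat[OF p] k unfolding d by (intro one_less_power) auto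

lemma frobenius_sum: "(\<Sum>i\<in>I. f i :: 'k) ^ (d ^ j) = (\<Sum>i\<in>I. f i ^ (d ^ j))"
  by (rule freshmans_dream_sum'[OF p, of _ "k * j"]) (simp add: d power_mult)

lemma skew_act_eq: "degree r \<le> N \<Longrightarrow> skew_act d (x :: 'k) r = (\<Sum>i\<le>N. coeff r i * x ^ (d ^ i))"
  unfolding skew_act_def by (rule sum.mono_neutral_left) (auto simp: coeff_eq_0)

lemma skew_act_add: "skew_act d (x :: 'k) (r + s) = skew_act d x r + skew_act d x s"
  using skew_act_eq[of "r + s" "max (degree r) (degree s)" x] skew_act_eq[of r "max (degree r) (degree s)" x]
    skew_act_eq[of s "max (degree r) (degree s)" x]
  by (simp add: degree_add_le_max sum.distrib algebra_simps)

lemma skew_act_0: "skew_act d (x :: 'k) 0 = 0"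
  by (simp add: skew_act_def)

lemma skew_act_1: "skew_act d (x :: 'k) 1 = x"
  by (simp add: skew_act_def)

lemma skew_act_sum: "skew_act d (x :: 'k) (sum f I) = (\<Sum>i\<in>I. skew_act d x (f i))"
  by (induction I rule: infinite_finite_induct) (auto simp: skew_act_0 skew_act_add)

lemma skew_act_monom: "skew_act d (x :: 'k) (monom c n) = c * x ^ (d ^ n)"
proof -
  have "(\<Sum>i\<le>n. coeff (monom c n) i * x ^ (d ^ i)) = (\<Sum>i\<le>n. if i = n then c * x ^ (d ^ n) else 0)"
    by (intro sum.cong) auto
  then show ?thesis by (subst skew_act_eq[of _ n]) (simp_all add: degree_monom_le)
qed

lemma skew_act_add_left: "skew_act d (x + y :: 'k) r = skew_act d x r + skew_act d y r"
proof -
  have "(x + y) ^ (d ^ i) = x ^ (d ^ i) + y ^ (d ^ i)" for i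
    by (rule freshmans_dream'[OF p, of _ "k * i"]) (simp add: d power_mult)
  then show ?thesis by (simp add: skew_act_def sum.distrib algebra_simps)
qed

lemma skew_act_mult: "skew_act d (x :: 'k) (skew_mult d r s) = skew_act d (skew_act d x r) s"
proof -
  have "skew_act d (skew_act d x r) s =
      (\<Sum>j\<le>degree s. \<Sum>i\<le>degree r. coeff r i ^ (d ^ j) * coeff s j * x ^ (d ^ (i + j)))"
    by (simp add: skew_act_def[of d _ s] skew_act_def[of d x r] frobenius_sum sum_distrib_left
        power_mult_distrib power_add mult_ac flip: power_mult)
  also have "\<dots> = skew_act d x (skew_mult d r s)"
    by (subst sum.swap) (simp add: skew_mult_def skew_act_sum skew_act_monom)
  finally show ?thesis by simp
qed

lemma skew_act_faithful:
  assumes "\<And>x. skew_act d (x :: 'k) r = skew_act d x s"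
  shows "r = s"
proof (rule ccontr)
  assume "r \<noteq> s"
  define q where "q = r - s"
  have q0: "q \<noteq> 0" using \<open>r \<noteq> s\<close> by (simp add: q_def)
  have q: "skew_act d x q = 0" for x
    using skew_act_add[of x q s] assms[of x] by (simp add: q_def)
  define P where "P = (\<Sum>i\<le>degree q. monom (coeff q i) (d ^ i))"
  have "poly P x = 0" for x
    using q[of x] by (simp add: P_def poly_sum poly_monom skew_act_def)
  then have "P = 0" using poly_roots_finite[of P] inf by auto
  have "coeff P (d ^ degree q) = (\<Sum>i\<le>degree q. if i = degree q then coeff q i else 0)"
    using d_gt_1 unfolding P_def coeff_sum by (intro sum.cong) (auto simp: power_inject_exp)
  then show False using q0 \<open>P = 0\<close> by simp
qed

theorem skew_poly_relation:
  "skew_mult d (monom 1 1) [:a ^ d:] = skew_mult d [:a :: 'k:] (monom 1 1)"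
  by (simp add: skew_mult_def monom_Suc numeral_eq_Suc degree_monom_eq atMost_Suc)

theorem skew_poly_ring_is_ring:
  assumes S: "is_subfield (S :: 'k set)"
  shows "Ring.ring (skew_poly_ring d S)"
proof -
  note S' = subringD[OF subfieldD(1)[OF S]]
  have cl: "coeff (skew_mult d r s) n \<in> S" if "\<forall>n. coeff r n \<in> S" "\<forall>n. coeff s n \<in> S" for r s n
  proof -
    have sum: "sum f I \<in> S" if "\<And>i. i \<in> I \<Longrightarrow> f i \<in> S" for f and I :: "nat set"
      using that by (induction I rule: infinite_finite_induct) (auto simp: S')
    show ?thesis unfolding skew_mult_def coeff_sum by (intro sum) (auto simp: S' that)
  qed
  show ?thesis
  proof (rule ringI)
    show "abelian_group (skew_poly_ring d S)"
    proof (rule abelian_groupI)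
      fix x assume "x \<in> carrier (skew_poly_ring d S)"
      then show "\<exists>y\<in>carrier (skew_poly_ring d S). y \<oplus>\<^bsub>skew_poly_ring d S\<^esub> x = \<zero>\<^bsub>skew_poly_ring d S\<^esub>"
        by (intro bexI[of _ "- x"]) (auto simp: skew_poly_ring_def S')
    qed (auto simp: skew_poly_ring_def S' algebra_simps)
    show "Group.monoid (skew_poly_ring d S)"
    proof (rule monoidI)
      fix x y z :: "'k poly"
      show "x \<otimes>\<^bsub>skew_poly_ring d S\<^esub> y \<otimes>\<^bsub>skew_poly_ring d S\<^esub> z =
          x \<otimes>\<^bsub>skew_poly_ring d S\<^esub> (y \<otimes>\<^bsub>skew_poly_ring d S\<^esub> z)"
        by (simp add: skew_poly_ring_def, rule skew_act_faithful) (simp add: skew_act_mult)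
      show "\<one>\<^bsub>skew_poly_ring d S\<^esub> \<otimes>\<^bsub>skew_poly_ring d S\<^esub> x = x"
        "x \<otimes>\<^bsub>skew_poly_ring d S\<^esub> \<one>\<^bsub>skew_poly_ring d S\<^esub> = x"
        by (simp_all add: skew_poly_ring_def, rule_tac [!] skew_act_faithful)
          (simp_all add: skew_act_mult skew_act_1)
    qed (auto simp: skew_poly_ring_def cl S' coeff_1)
  next
    fix x y z :: "'k poly"
    show "(x \<oplus>\<^bsub>skew_poly_ring d S\<^esub> y) \<otimes>\<^bsub>skew_poly_ring d S\<^esub> z =
        x \<otimes>\<^bsub>skew_poly_ring d S\<^esub> z \<oplus>\<^bsub>skew_poly_ring d S\<^esub> y \<otimes>\<^bsub>skew_poly_ring d S\<^esub> z"
      by (simp add: skew_poly_ring_def, rule skew_act_faithful)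
        (simp add: skew_act_mult skew_act_add skew_act_add_left)
    show "z \<otimes>\<^bsub>skew_poly_ring d S\<^esub> (x \<oplus>\<^bsub>skew_poly_ring d S\<^esub> y) =
        z \<otimes>\<^bsub>skew_poly_ring d S\<^esub> x \<oplus>\<^bsub>skew_poly_ring d S\<^esub> z \<otimes>\<^bsub>skew_poly_ring d S\<^esub> y"
      by (simp add: skew_poly_ring_def, rule skew_act_faithful)
        (simp add: skew_act_mult skew_act_add)
  qed
qed

end


section \<open>First-order logic of right modules with a distinguished subset\<close>

datatype (scalars: 'r) lo_term =
    LVar nat
  | LZero
  | LAdd "'r lo_term" "'r lo_term"
  | LNeg "'r lo_term"
  | LScal "'r lo_term" 'r

datatype (form_scalars: 'r) lo_form =
    FEq "'r lo_term" "'r lo_term"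
  | FVal "'r lo_term"
  | FNot "'r lo_form"
  | FAnd "'r lo_form" "'r lo_form"
  | FAll nat "'r lo_form"

primrec term_vars :: "'r lo_term \<Rightarrow> nat set" where
  "term_vars (LVar n) = {n}"
| "term_vars LZero = {}"
| "term_vars (LAdd u v) = term_vars u \<union> term_vars v"
| "term_vars (LNeg u) = term_vars u"
| "term_vars (LScal u r) = term_vars u"

primrec free_vars :: "'r lo_form \<Rightarrow> nat set" where
  "free_vars (FEq u v) = term_vars u \<union> term_vars v"
| "free_vars (FVal u) = term_vars u"
| "free_vars (FNot \<phi>) = free_vars \<phi>"
| "free_vars (FAnd \<phi> \<psi>) = free_vars \<phi> \<union> free_vars \<psi>"
| "free_vars (FAll n \<phi>) = free_vars \<phi> - {n}"

text \<open>The type \<open>'r\<close> may be larger than the ring \<open>R\<close> of scalars; only function symbols from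
  \<open>R\<close> belong to the language.\<close>

definition lo_formulas :: "'r set \<Rightarrow> 'r lo_form set" where
  "lo_formulas R = {\<phi>. form_scalars \<phi> \<subseteq> R}"

definition lo_sentences :: "'r set \<Rightarrow> 'r lo_form set" where
  "lo_sentences R = {\<phi> \<in> lo_formulas R. free_vars \<phi> = {}}"

record ('r, 'm) lo_structure =
  universe :: "'m set"
  zero_of :: "'m"
  add_of :: "'m \<Rightarrow> 'm \<Rightarrow> 'm"
  neg_of :: "'m \<Rightarrow> 'm"
  scal_of :: "'m \<Rightarrow> 'r \<Rightarrow> 'm"
  val_of :: "'m set"

definition is_lo_structure :: "'r set \<Rightarrow> ('r, 'm) lo_structure \<Rightarrow> bool" where
  "is_lo_structure R M \<longleftrightarrow>
     zero_of M \<in> universe M \<and>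
     (\<forall>x\<in>universe M. \<forall>y\<in>universe M. add_of M x y \<in> universe M) \<and>
     (\<forall>x\<in>universe M. neg_of M x \<in> universe M) \<and>
     (\<forall>x\<in>universe M. \<forall>r\<in>R. scal_of M x r \<in> universe M) \<and>
     val_of M \<subseteq> universe M"

primrec eval_term :: "('r, 'm) lo_structure \<Rightarrow> (nat \<Rightarrow> 'm) \<Rightarrow> 'r lo_term \<Rightarrow> 'm" where
  "eval_term M e (LVar n) = e n"
| "eval_term M e LZero = zero_of M"
| "eval_term M e (LAdd u v) = add_of M (eval_term M e u) (eval_term M e v)"
| "eval_term M e (LNeg u) = neg_of M (eval_term M e u)"
| "eval_term M e (LScal u r) = scal_of M (eval_term M e u) r"

primrec sat :: "('r, 'm) lo_structure \<Rightarrow> (nat \<Rightarrow> 'm) \<Rightarrow> 'r lo_form \<Rightarrow> bool" where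
  "sat M e (FEq u v) \<longleftrightarrow> eval_term M e u = eval_term M e v"
| "sat M e (FVal u) \<longleftrightarrow> eval_term M e u \<in> val_of M"
| "sat M e (FNot \<phi>) \<longleftrightarrow> \<not> sat M e \<phi>"
| "sat M e (FAnd \<phi> \<psi>) \<longleftrightarrow> sat M e \<phi> \<and> sat M e \<psi>"
| "sat M e (FAll n \<phi>) \<longleftrightarrow> (\<forall>x\<in>universe M. sat M (e(n := x)) \<phi>)"

definition holds_in :: "('r, 'm) lo_structure \<Rightarrow> 'r lo_form \<Rightarrow> bool" where
  "holds_in M \<phi> \<longleftrightarrow> (\<forall>e. range e \<subseteq> universe M \<longrightarrow> sat M e \<phi>)"

definition complete_theory :: "'r set \<Rightarrow> ('r, 'm) lo_structure \<Rightarrow> 'r lo_form set" where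
  "complete_theory R M = {\<phi> \<in> lo_sentences R. holds_in M \<phi>}"

definition is_model :: "'r set \<Rightarrow> 'r lo_form set \<Rightarrow> ('r, 'm) lo_structure \<Rightarrow> bool" where
  "is_model R T M \<longleftrightarrow> is_lo_structure R M \<and> (\<forall>\<phi>\<in>T. holds_in M \<phi>)"

definition elementary_embedding ::
    "'r set \<Rightarrow> ('r, 'm) lo_structure \<Rightarrow> ('r, 'n) lo_structure \<Rightarrow> ('m \<Rightarrow> 'n) \<Rightarrow> bool" where
  "elementary_embedding R M N h \<longleftrightarrow> h ` universe M \<subseteq> universe N \<and>
     (\<forall>\<phi>\<in>lo_formulas R. \<forall>e. range e \<subseteq> universe M \<longrightarrow> (sat M e \<phi> \<longleftrightarrow> sat N (h \<circ> e) \<phi>))"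

text \<open>The structure on a subfield \<open>S\<close> of an ambient field with valuation ring \<open>V\<close>.\<close>

definition field_structure :: "nat \<Rightarrow> 'k::field set \<Rightarrow> 'k set \<Rightarrow> ('k poly, 'k) lo_structure" where
  "field_structure d V S =
     \<lparr>universe = S, zero_of = 0, add_of = (+), neg_of = uminus, scal_of = skew_act d, val_of = V \<inter> S\<rparr>"

end

theory Submission
  imports Defs
begin

text \<open>Write \<open>L\<close> for \<open>\<bbbF>\<^sub>d((X))\<close> and \<open>K\<close> for the henselization. The heart of the matter is that \<open>K\<close> is an
  elementary substructure of \<open>L\<close> (\<open>sat_henselization_iff\<close>); then \<open>K\<close> is a model of the theory, and
  it embeds elementarily into every other model \<open>M\<close> for the following reason. As an \<open>R\<close>-module \<open>K\<close>
  is generated by \<open>1\<close>, which is a nonzero solution of \<open>z.t = z\<close>. The nonzero solutions of this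
  equation in \<open>L\<close> are the nonzero elements of \<open>\<bbbF>\<^sub>d\<close>, and multiplication by such an element is an
  automorphism of \<open>L\<close>. So all solutions \<open>z\<close> satisfy the same formulas \<open>\<phi>(z.a\<^sub>1, \<dots>, z.a\<^sub>n)\<close>, and
  which ones they satisfy is part of the theory. Hence, for any nonzero solution \<open>m\<close> in \<open>M\<close>, the map
  \<open>a \<mapsto> m.a\<close> is elementary.

  The proof that \<open>K\<close> is elementary in \<open>L\<close> rests on the fact that all the functions are additive and
  that \<open>\<O>\<close> is a subgroup. Positive primitive formulas, that is, existentially quantified conjunctions
  of atomic formulas, then define subgroups, and formulas in one variable with parameters define cosets
  of them. As in the theorem of Baur and Monk, B. H. Neumann's lemma on coverings by cosets and a count of
  cosets show that every formula is equivalent in \<open>L\<close> to a Boolean combination of positive primitive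
  formulas (\<open>pp_definable_sat\<close>). By the criterion of Tarski and Vaught it remains to find, for \<open>x\<close> in
  \<open>L\<close>, an element \<open>y\<close> of \<open>K\<close> that satisfies the same finitely many positive primitive conditions
  with parameters in \<open>K\<close>. Any \<open>y\<close> that is close to \<open>x\<close> violates the conditions that \<open>x\<close>
  violates, because positive primitive sets are closed (\<open>pp_fibre_closed\<close>), and some such \<open>y\<close>
  satisfies the conditions that \<open>x\<close> satisfies, because the points in \<open>K\<close> are dense
  (\<open>pp_fibre_dense\<close>).

  Closedness. By adding variables all equations become linear in the variables and their \<open>d\<close>-th powers.
  One has to see that a sum of images of maps \<open>x \<mapsto> p x\<^sup>d + m x\<close> from \<open>L\<close> or from \<open>\<O>\<close> to a power of
  \<open>L\<close> is closed (\<open>seq_closed_column_sum\<close>). Since \<open>\<O>\<close> is compact, only the maps defined on \<open>L\<close>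
  matter. If the vectors \<open>p\<close> have no nontrivial relation \<open>\<Sum> p\<^sub>j b\<^sub>j\<^sup>d = 0\<close>, then the sum of these maps is proper,
  since the leading terms dominate for large arguments; otherwise a change of variables makes one of the
  maps linear, and it is eliminated.

  Density. For finitely many Laurent series there is a map \<open>\<eta>\<close> to \<open>K\<close> that moves them very little,
  is the identity on \<open>K\<close> and preserves all additive relations between them (\<open>specialization\<close>). The
  field \<open>K\<close> has the same \<open>d\<close>-basis \<open>1, X, \<dots>, X\<^bsup>d - 1\<^esup>\<close> as \<open>L\<close>, so \<open>K\<close>-linearly independent
  elements of \<open>L\<close> have \<open>K\<close>-linearly independent \<open>d\<close>-th powers. In a suitable \<open>K\<close>-basis the relations
  therefore take the form \<open>w\<^sub>i = \<Sum>\<^sub>j P\<^sub>i\<^sub>j w\<^sub>j\<^sup>d\<close>, with one equation for some of the basis elements and none for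
  the others. The latter can be moved into \<open>K\<close> arbitrarily; the equations are then solved by iteration,
  and the solution is separably algebraic over \<open>K\<close>, hence in \<open>K\<close> by Hensel's lemma.\<close>

section \<open>Coverings by cosets\<close>

definition add_subgroup :: "'g::ab_group_add set \<Rightarrow> bool" where
  "add_subgroup H \<longleftrightarrow> 0 \<in> H \<and> (\<forall>x\<in>H. \<forall>y\<in>H. x - y \<in> H)"

text \<open>The empty set counts as a coset of every subgroup: the fibres of a definable subgroup are cosets of one
  subgroup or empty.\<close>

definition coset_of :: "'g::ab_group_add set \<Rightarrow> 'g set \<Rightarrow> bool" where
  "coset_of H A \<longleftrightarrow> (\<forall>x\<in>A. \<forall>y. y \<in> A \<longleftrightarrow> y - x \<in> H)"

text \<open>The set \<open>A\<close> need not be contained in \<open>H\<close>; for subgroups this says that \<open>A \<inter> H\<close> has finite index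
  in \<open>H\<close>.\<close>

definition finite_index :: "'g::ab_group_add set \<Rightarrow> 'g set \<Rightarrow> bool" where
  "finite_index H A \<longleftrightarrow> (\<exists>F. finite F \<and> (\<forall>x\<in>H. \<exists>f\<in>F. x - f \<in> A))"

lemma add_subgroupD:
  assumes "add_subgroup H"
  shows "0 \<in> H" "x \<in> H \<Longrightarrow> y \<in> H \<Longrightarrow> x - y \<in> H" "x \<in> H \<Longrightarrow> - x \<in> H"
    "x \<in> H \<Longrightarrow> y \<in> H \<Longrightarrow> x + y \<in> H"
proof -
  show z: "0 \<in> H" using assms by (simp add: add_subgroup_def)
  show d: "x - y \<in> H" if "x \<in> H" "y \<in> H" for x y
    using assms that by (simp add: add_subgroup_def)
  show m: "- x \<in> H" if "x \<in> H" for x using d[OF z that] by simp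
  show "x + y \<in> H" if "x \<in> H" "y \<in> H" for x y using d[OF that(1) m[OF that(2)]] by simp
qed

lemma add_subgroup_Int: "add_subgroup A \<Longrightarrow> add_subgroup B \<Longrightarrow> add_subgroup (A \<inter> B)"
  by (auto simp: add_subgroup_def)

lemma add_subgroup_INT: "(\<And>i. i \<in> I \<Longrightarrow> add_subgroup (A i)) \<Longrightarrow> add_subgroup (\<Inter>i\<in>I. A i)"
  by (auto simp: add_subgroup_def)

lemma coset_of_Int: "coset_of A C \<Longrightarrow> coset_of B D \<Longrightarrow> coset_of (A \<inter> B) (C \<inter> D)"
  by (auto simp: coset_of_def)

lemma coset_of_INT: "(\<And>i. i \<in> I \<Longrightarrow> coset_of (A i) (C i)) \<Longrightarrow> coset_of (\<Inter>i\<in>I. A i) (\<Inter>i\<in>I. C i)"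
  unfolding coset_of_def by blast

lemma finite_index_refl: "0 \<in> H \<Longrightarrow> finite_index H H"
  unfolding finite_index_def by (rule exI[of _ "{0}"]) auto

lemma finite_index_trans:
  assumes "finite_index H N" "finite_index N A"
  shows "finite_index H A"
proof -
  obtain F where F: "finite F" "\<And>x. x \<in> H \<Longrightarrow> \<exists>f\<in>F. x - f \<in> N"
    using assms(1) unfolding finite_index_def by blast
  obtain G where G: "finite G" "\<And>x. x \<in> N \<Longrightarrow> \<exists>g\<in>G. x - g \<in> A"
    using assms(2) unfolding finite_index_def by blast
  have "\<exists>f\<in>(\<lambda>(f, g). f + g) ` (F \<times> G). x - f \<in> A" if x: "x \<in> H" for x
  proof -
    obtain f where f: "f \<in> F" "x - f \<in> N" using F(2)[OF x] by blast
    obtain g where g: "g \<in> G" "x - f - g \<in> A" using G(2)[OF f(2)] by blast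
    have "x - (f + g) \<in> A" using g(2) by (simp add: algebra_simps)
    then show ?thesis using f(1) g(1) by force
  qed
  then show ?thesis unfolding finite_index_def using F(1) G(1)
    by (intro exI[of _ "(\<lambda>(f, g). f + g) ` (F \<times> G)"]) simp
qed

lemma finite_index_Int:
  assumes A: "add_subgroup A" and B: "add_subgroup B" and "finite_index H A" "finite_index H B"
  shows "finite_index H (A \<inter> B)"
proof -
  obtain F where F: "finite F" "\<And>x. x \<in> H \<Longrightarrow> \<exists>f\<in>F. x - f \<in> A"
    using assms(3) unfolding finite_index_def by blast
  obtain G where G: "finite G" "\<And>x. x \<in> H \<Longrightarrow> \<exists>f\<in>G. x - f \<in> B"
    using assms(4) unfolding finite_index_def by blast
  define r where "r f g = (SOME x. x - f \<in> A \<and> x - g \<in> B)" for f g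
  have "\<exists>z\<in>(\<lambda>(f, g). r f g) ` (F \<times> G). x - z \<in> A \<inter> B" if x: "x \<in> H" for x
  proof -
    obtain f g where fg: "f \<in> F" "x - f \<in> A" "g \<in> G" "x - g \<in> B" using F(2)[OF x] G(2)[OF x] by blast
    then have "r f g - f \<in> A \<and> r f g - g \<in> B" unfolding r_def
      by (rule_tac someI[of "\<lambda>x. x - f \<in> A \<and> x - g \<in> B" x]) simp
    then have "x - r f g \<in> A \<inter> B"
      using add_subgroupD(2)[OF A fg(2), of "r f g - f"] add_subgroupD(2)[OF B fg(4), of "r f g - g"]
      by simp
    then show ?thesis using fg by force
  qed
  then show ?thesis unfolding finite_index_def using F(1) G(1)
    by (intro exI[of _ "(\<lambda>(f, g). r f g) ` (F \<times> G)"]) simp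
qed

lemma finite_index_INT:
  assumes "finite I" "0 \<in> H" "\<And>i. i \<in> I \<Longrightarrow> add_subgroup (A i)" "\<And>i. i \<in> I \<Longrightarrow> finite_index H (A i)"
    and H: "add_subgroup H"
  shows "finite_index H (H \<inter> (\<Inter>i\<in>I. A i))"
  using assms(1,3,4)
proof (induction I)
  case empty
  then show ?case using finite_index_refl[OF assms(2)] by simp
next
  case (insert i I)
  have "finite_index H (A i \<inter> (H \<inter> (\<Inter>i\<in>I. A i)))"
    by (rule finite_index_Int, use insert in \<open>auto intro!: add_subgroup_Int add_subgroup_INT H\<close>)
  then show ?case by (simp add: Int_left_commute)
qed

text \<open>If \<open>A\<close> does not contribute all of its cosets, one missing coset is covered by the remaining
  subgroups; translating it covers every coset of \<open>A\<close>, so \<open>A\<close> can be discarded.\<close>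

lemma neumann_finite_index:
  assumes H: "add_subgroup H" and "finite \<K>" "finite F" "\<And>A. A \<in> \<K> \<Longrightarrow> add_subgroup A"
    and "\<And>x. x \<in> H \<Longrightarrow> \<exists>A\<in>\<K>. \<exists>f\<in>F. x - f \<in> A"
  shows "\<exists>A\<in>\<K>. finite_index H A"
  using assms(2-5)
proof (induction \<K> arbitrary: F)
  case empty
  then show ?case using add_subgroupD(1)[OF H] by blast
next
  case (insert A \<K>)
  have A: "add_subgroup A" using insert.prems by blast
  show ?case
  proof (cases "\<forall>x\<in>H. \<exists>f\<in>F. x - f \<in> A")
    case True
    then show ?thesis using insert.prems(1) unfolding finite_index_def by blast
  next
    case False
    then obtain h where h: "h \<in> H" "\<And>f. f \<in> F \<Longrightarrow> h - f \<notin> A" by blast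
    have miss: "\<exists>B\<in>\<K>. \<exists>f\<in>F. h + a - f \<in> B" if a: "a \<in> A \<inter> H" for a
    proof -
      have "h - f \<in> A" if "h + a - f \<in> A" for f
        using add_subgroupD(2)[OF A that, of a] a by (simp add: algebra_simps)
      then have "h + a - f \<notin> A" if "f \<in> F" for f using h(2)[OF that] by blast
      moreover have "h + a \<in> H" using a h(1) add_subgroupD(4)[OF H] by blast
      ultimately show ?thesis using insert.prems(3) by blast
    qed
    define s where "s f = (SOME y. y \<in> H \<and> y - f \<in> A)" for f
    define F' where "F' = F \<union> (\<lambda>(f, g). f - h + s g) ` (F \<times> F)"
    have "\<exists>B\<in>\<K>. \<exists>f\<in>F'. x - f \<in> B" if x: "x \<in> H" for x
    proof -
      obtain B f where Bf: "B \<in> insert A \<K>" "f \<in> F" "x - f \<in> B" using insert.prems(3)[OF x] by blast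
      show ?thesis
      proof (cases "B \<in> \<K>")
        case True
        then show ?thesis using Bf unfolding F'_def by blast
      next
        case False
        then have "x \<in> H \<and> x - f \<in> A" using Bf x by blast
        then have s: "s f \<in> H \<and> s f - f \<in> A" unfolding s_def by (rule someI)
        have "x - s f \<in> A \<inter> H"
          using add_subgroupD(2)[OF A, of "x - f" "s f - f"] add_subgroupD(2)[OF H x] s \<open>x \<in> H \<and> _\<close> by simp
        then obtain B' g where "B' \<in> \<K>" "g \<in> F" "h + (x - s f) - g \<in> B'" using miss by blast
        moreover have "h + (x - s f) - g = x - (g - h + s f)" by (simp add: algebra_simps)
        ultimately show ?thesis using Bf(2) unfolding F'_def by force
      qed
    qed
    moreover have "finite F'" using insert.prems(1) by (simp add: F'_def)
    ultimately have "\<exists>B\<in>\<K>. finite_index H B" using insert.IH[of F'] insert.prems(2) by blast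
    then show ?thesis by blast
  qed
qed

text \<open>A point \<open>x\<close> outside the cosets of the subgroups of finite index has a whole coset \<open>x + N\<close> outside
  them, where \<open>N\<close> is the intersection of these subgroups. It would be covered by cosets of the other
  subgroups, and by \<open>neumann_finite_index\<close> one of these would have finite index in \<open>N\<close>, hence
  in \<open>H\<close>.\<close>

lemma coset_cover_finite_index:
  assumes H: "add_subgroup H" and C: "coset_of H C" and I: "finite I"
    and A: "\<And>i. i \<in> I \<Longrightarrow> add_subgroup (A i)" "\<And>i. i \<in> I \<Longrightarrow> coset_of (A i) (D i)"
    and cover: "C \<subseteq> (\<Union>i\<in>I. D i)"
  shows "C \<subseteq> (\<Union>i\<in>{i\<in>I. finite_index H (A i)}. D i)"
proof (rule ccontr)
  define J where "J = {i\<in>I. finite_index H (A i)}"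
  define N where "N = H \<inter> (\<Inter>i\<in>J. A i)"
  assume "\<not> ?thesis"
  then obtain x where x: "x \<in> C" "\<And>i. i \<in> J \<Longrightarrow> x \<notin> D i" by (auto simp: J_def)
  have N: "add_subgroup N" "finite_index H N"
    using I A add_subgroupD(1)[OF H] H unfolding N_def J_def
    by (auto intro!: add_subgroup_Int add_subgroup_INT finite_index_INT)
  define c where "c i = (SOME y. y \<in> D i)" for i
  have "\<exists>B\<in>A ` (I - J). \<exists>f\<in>(\<lambda>i. c i - x) ` I. n - f \<in> B" if n: "n \<in> N" for n
  proof -
    have "x + n \<in> C" using C x(1) n by (auto simp: coset_of_def N_def)
    then obtain i where i: "i \<in> I" "x + n \<in> D i" using cover by blast
    have "i \<notin> J"
    proof
      assume "i \<in> J"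
      then have "- n \<in> A i" using n add_subgroupD(3)[OF A(1)[OF i(1)]] by (auto simp: N_def)
      then have "x - (x + n) \<in> A i" by simp
      then show False using x(2)[OF \<open>i \<in> J\<close>] A(2)[OF i(1)] i(2) unfolding coset_of_def by blast
    qed
    moreover have "c i \<in> D i" unfolding c_def using i(2) by (rule someI)
    then have "x + n - c i \<in> A i" using A(2)[OF i(1)] i(2) unfolding coset_of_def by blast
    then have "n - (c i - x) \<in> A i" by (simp add: algebra_simps)
    ultimately show ?thesis using i(1) by blast
  qed
  then obtain B where "B \<in> A ` (I - J)" "finite_index N B"
    using neumann_finite_index[OF N(1), of "A ` (I - J)" "(\<lambda>i. c i - x) ` I"] I A by blast
  then show False using finite_index_trans[OF N(2)] by (auto simp: J_def)
qed

text \<open>Only subgroups of finite index matter, by \<open>coset_cover_finite_index\<close>; modulo a common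
  subgroup \<open>N\<close> of finite index the uncovered part is then a finite set whose size is computed
  by inclusion and exclusion from the sizes of the intersections, and these depend only on
  which intersections are empty.\<close>

lemma coset_cover_transfer:
  assumes H: "add_subgroup H" and C: "coset_of H C" "coset_of H C'" and I: "finite I"
    and A: "\<And>i. i \<in> I \<Longrightarrow> add_subgroup (A i)"
    and D: "\<And>i. i \<in> I \<Longrightarrow> coset_of (A i) (D i)" "\<And>i. i \<in> I \<Longrightarrow> coset_of (A i) (D' i)"
    and pattern: "\<And>\<Delta>. \<Delta> \<subseteq> I \<Longrightarrow> C \<inter> (\<Inter>i\<in>\<Delta>. D i) = {} \<longleftrightarrow> C' \<inter> (\<Inter>i\<in>\<Delta>. D' i) = {}"
    and cover: "C \<subseteq> (\<Union>i\<in>I. D i)"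
  shows "C' \<subseteq> (\<Union>i\<in>I. D' i)"
proof -
  define J where "J = {i\<in>I. finite_index H (A i)}"
  have J: "finite J" "J \<subseteq> I" using I by (auto simp: J_def)
  have coverJ: "C \<subseteq> (\<Union>i\<in>J. D i)"
    unfolding J_def using coset_cover_finite_index[of H C I A D] H C(1) I A D(1) cover by simp
  define N where "N = H \<inter> (\<Inter>i\<in>J. A i)"
  have N: "add_subgroup N" "finite_index H N"
    using J A add_subgroupD(1)[OF H] H unfolding N_def
    by (auto intro!: add_subgroup_Int add_subgroup_INT finite_index_INT simp: J_def)
  define q where "q x = {y. y - x \<in> N}" for x
  have qq: "q x = q y \<longleftrightarrow> x - y \<in> N" for x y
  proof
    assume "q x = q y"
    moreover have "x \<in> q x" by (simp add: q_def add_subgroupD(1)[OF N(1)])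
    ultimately show "x - y \<in> N" by (auto simp: q_def)
  next
    assume xy: "x - y \<in> N"
    have "z - x \<in> N \<longleftrightarrow> z - y \<in> N" for z
      using add_subgroupD(4)[OF N(1) _ xy, of "z - x"] add_subgroupD(2)[OF N(1) _ xy, of "z - y"]
      by auto
    then show "q x = q y" by (simp add: q_def)
  qed
  have fin: "finite (q ` E)" if E: "coset_of H E" for E
  proof (cases "E = {}")
    case False
    then obtain e where e: "e \<in> E" by blast
    obtain F where F: "finite F" "\<And>x. x \<in> H \<Longrightarrow> \<exists>f\<in>F. x - f \<in> N"
      using N(2) unfolding finite_index_def by blast
    have "q x \<in> (\<lambda>f. q (e + f)) ` F" if x: "x \<in> E" for x
    proof -
      have "x - e \<in> H" using E e x by (auto simp: coset_of_def)
      then obtain f where "f \<in> F" "x - e - f \<in> N" using F by blast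
      then have "q x = q (e + f)" by (simp add: qq algebra_simps)
      then show ?thesis using \<open>f \<in> F\<close> by blast
    qed
    then have "q ` E \<subseteq> (\<lambda>f. q (e + f)) ` F" by blast
    then show ?thesis using F(1) finite_subset by blast
  qed simp
  \<comment> \<open>the size of a set modulo \<open>N\<close> is unchanged by translation\<close>
  have coset_card: "card (q ` E) = card (q ` E')"
    if B: "add_subgroup B" "coset_of B E" "coset_of B E'" "E = {} \<longleftrightarrow> E' = {}" for B E E'
  proof (cases "E = {}")
    case False
    then obtain e e' where e: "e \<in> E" "e' \<in> E'" using B(4) by blast
    have "x \<in> E \<longleftrightarrow> x - e \<in> B" "y \<in> E' \<longleftrightarrow> y - e' \<in> B" for x y
      using B(2,3) e unfolding coset_of_def by blast+
    then have tr: "y \<in> E' \<longleftrightarrow> y - (e' - e) \<in> E" for y by (simp add: algebra_simps)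
    have E': "E' = (\<lambda>x. x + (e' - e)) ` E"
    proof
      show "E' \<subseteq> (\<lambda>x. x + (e' - e)) ` E"
      proof
        fix y assume "y \<in> E'"
        then show "y \<in> (\<lambda>x. x + (e' - e)) ` E"
          using tr by (intro image_eqI[of _ _ "y - (e' - e)"]) auto
      qed
    qed (auto simp: tr)
    have "card (q ` E') = card ((\<lambda>Q. (\<lambda>x. x + (e' - e)) ` Q) ` (q ` E))"
    proof -
      have "q (x + (e' - e)) = (\<lambda>x. x + (e' - e)) ` q x" for x
      proof
        show "q (x + (e' - e)) \<subseteq> (\<lambda>x. x + (e' - e)) ` q x"
        proof
          fix y assume "y \<in> q (x + (e' - e))"
          then have "y - (e' - e) \<in> q x" by (simp add: q_def algebra_simps)
          then show "y \<in> (\<lambda>x. x + (e' - e)) ` q x" by (intro image_eqI[of _ _ "y - (e' - e)"]) auto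
        qed
      qed (auto simp: q_def)
      then show ?thesis unfolding E' image_image by simp
    qed
    also have "\<dots> = card (q ` E)"
      by (intro card_image inj_onI) (simp add: inj_image_eq_iff)
    finally show ?thesis by simp
  qed (use B(4) in simp)
  define X where "X \<Delta> = C \<inter> (\<Inter>i\<in>\<Delta>. D i)" for \<Delta>
  define X' where "X' \<Delta> = C' \<inter> (\<Inter>i\<in>\<Delta>. D' i)" for \<Delta>
  have split: "card (q ` E) = card (q ` (E - D)) + card (q ` (E \<inter> D))"
    if E: "E \<subseteq> C0" "coset_of H C0" and D: "i \<in> J" "coset_of (A i) D" for E D C0 i
  proof -
    have "q x \<noteq> q y" if "x \<in> E - D" "y \<in> E \<inter> D" for x y
    proof
      assume "q x = q y"
      then have "x - y \<in> A i" using D(1) by (auto simp: qq N_def)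
      then show False using D(2) that by (auto simp: coset_of_def)
    qed
    then have "q ` (E - D) \<inter> q ` (E \<inter> D) = {}" by blast
    moreover have "finite (q ` (E - D))" "finite (q ` (E \<inter> D))"
      by (rule finite_subset[OF _ fin[OF E(2)]], use E(1) in blast)+
    moreover have "q ` E = q ` (E - D) \<union> q ` (E \<inter> D)" by blast
    ultimately show ?thesis by (simp add: card_Un_disjoint)
  qed
  have "card (q ` (X \<Delta> - (\<Union>i\<in>M. D i))) = card (q ` (X' \<Delta> - (\<Union>i\<in>M. D' i)))"
    if "\<Delta> \<subseteq> J" "M \<subseteq> J" for \<Delta> M
    using finite_subset[OF that(2) J(1)] that
  proof (induction M arbitrary: \<Delta>)
    case empty
    have "card (q ` X \<Delta>) = card (q ` X' \<Delta>)"
      using empty J(2) A D C H unfolding X_def X'_def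
      by (intro coset_card[of "H \<inter> (\<Inter>i\<in>\<Delta>. A i)"] add_subgroup_Int add_subgroup_INT coset_of_Int coset_of_INT pattern)
        auto
    then show ?case by simp
  next
    case (insert j M)
    have j: "j \<in> J" "j \<in> I" using insert.prems J(2) by auto
    have "card (q ` (X \<Delta> - (\<Union>i\<in>M. D i))) =
        card (q ` (X \<Delta> - (\<Union>i\<in>M. D i) - D j)) + card (q ` ((X \<Delta> - (\<Union>i\<in>M. D i)) \<inter> D j))"
      by (rule split[of _ C]) (use j D C in \<open>auto simp: X_def\<close>)
    moreover have "card (q ` (X' \<Delta> - (\<Union>i\<in>M. D' i))) =
        card (q ` (X' \<Delta> - (\<Union>i\<in>M. D' i) - D' j)) + card (q ` ((X' \<Delta> - (\<Union>i\<in>M. D' i)) \<inter> D' j))"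
      by (rule split[of _ C']) (use j D C in \<open>auto simp: X'_def\<close>)
    moreover have "X \<Delta> - (\<Union>i\<in>M. D i) - D j = X \<Delta> - (\<Union>i\<in>insert j M. D i)"
      "X' \<Delta> - (\<Union>i\<in>M. D' i) - D' j = X' \<Delta> - (\<Union>i\<in>insert j M. D' i)" by auto
    moreover have "(X \<Delta> - (\<Union>i\<in>M. D i)) \<inter> D j = X (insert j \<Delta>) - (\<Union>i\<in>M. D i)"
      "(X' \<Delta> - (\<Union>i\<in>M. D' i)) \<inter> D' j = X' (insert j \<Delta>) - (\<Union>i\<in>M. D' i)"
      by (auto simp: X_def X'_def)
    ultimately show ?case using insert.IH[of \<Delta>] insert.IH[of "insert j \<Delta>"] insert.prems j by simp
  qed
  from this[of "{}" J] have "card (q ` (C' - (\<Union>i\<in>J. D' i))) = 0"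
    using coverJ by (simp add: X_def X'_def Diff_eq_empty_iff[THEN iffD2])
  moreover have "finite (q ` (C' - (\<Union>i\<in>J. D' i)))"
    by (rule finite_subset[OF _ fin[OF C(2)]]) blast
  ultimately have "C' \<subseteq> (\<Union>i\<in>J. D' i)" by auto
  then show ?thesis using J(2) by blast
qed

section \<open>Laurent series over a finite field\<close>

unbundle fps_syntax

definition fls_ball :: "int \<Rightarrow> 'a::zero fls set" where
  "fls_ball N = {x. \<forall>n<N. x $$ n = 0}"

lemma fls_ball_iff: "x \<in> fls_ball N \<longleftrightarrow> x = 0 \<or> fls_subdegree x \<ge> N"
  unfolding fls_ball_def using fls_subdegree_geI[of x N] by fastforce

lemma fls_ball_mono: "x \<in> fls_ball M \<Longrightarrow> N \<le> M \<Longrightarrow> x \<in> fls_ball N"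
  by (auto simp: fls_ball_def)

lemma fls_ball_0: "0 \<in> fls_ball N"
  by (simp add: fls_ball_def)

lemma fls_ball_add: "x \<in> fls_ball N \<Longrightarrow> y \<in> fls_ball N \<Longrightarrow> x + y \<in> fls_ball N"
  for x :: "'a::monoid_add fls"
  by (simp add: fls_ball_def)

lemma fls_ball_diff: "x \<in> fls_ball N \<Longrightarrow> y \<in> fls_ball N \<Longrightarrow> x - y \<in> fls_ball N"
  for x :: "'a::group_add fls"
  by (simp add: fls_ball_def)

lemma fls_ball_uminus: "x \<in> fls_ball N \<Longrightarrow> - x \<in> fls_ball N"
  for x :: "'a::group_add fls"
  by (simp add: fls_ball_def)

lemma fls_ball_sum: "(\<And>i. i \<in> I \<Longrightarrow> f i \<in> fls_ball N) \<Longrightarrow> sum f I \<in> fls_ball N"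
  for f :: "'b \<Rightarrow> 'a::comm_monoid_add fls"
  by (induction I rule: infinite_finite_induct) (auto simp: fls_ball_0 intro: fls_ball_add)

lemma fls_ball_mult: "x \<in> fls_ball M \<Longrightarrow> y \<in> fls_ball N \<Longrightarrow> x * y \<in> fls_ball (M + N)"
  for x :: "'a::field fls"
  by (cases "x = 0 \<or> y = 0") (auto simp: fls_ball_iff)

lemma fls_ball_power: "x \<in> fls_ball N \<Longrightarrow> n > 0 \<Longrightarrow> x ^ n \<in> fls_ball (int n * N)"
  for x :: "'a::field fls"
  by (auto simp: fls_ball_iff fls_subdegree_pow mult_left_mono)

lemma fls_in_ball: "x \<in> fls_ball (fls_subdegree x)"
  by (simp add: fls_ball_iff)

lemma fls_in_ball_finite:
  assumes "finite I"
  shows "\<exists>N. \<forall>i\<in>I. f i \<in> fls_ball N"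
  using assms
proof (induction I)
  case (insert i I)
  then obtain N where "\<forall>j\<in>I. f j \<in> fls_ball N" by blast
  then have "\<forall>j\<in>insert i I. f j \<in> fls_ball (min N (fls_subdegree (f i)))"
    using fls_ball_mono fls_in_ball[of "f i"] by (metis insert_iff min.cobounded1 min.cobounded2)
  then show ?case by blast
qed simp

lemma fls_integers_ball: "fls_integers = fls_ball 0"
  by (auto simp: fls_integers_iff fls_ball_def)

lemma fls_eq_0_ball: "(\<And>N. x \<in> fls_ball N) \<Longrightarrow> x = 0"
  by (rule fls_eqI) (metis (mono_tags, lifting) fls_ball_def fls_zero_nth mem_Collect_eq zless_add1_eq)

definition fls_lim :: "(nat \<Rightarrow> 'a::group_add fls) \<Rightarrow> 'a fls \<Rightarrow> bool" where
  "fls_lim f x \<longleftrightarrow> (\<forall>N. \<exists>n0. \<forall>n\<ge>n0. f n - x \<in> fls_ball N)"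

lemma fls_limD: "fls_lim f x \<Longrightarrow> \<exists>n0. \<forall>n\<ge>n0. f n - x \<in> fls_ball N"
  by (simp add: fls_lim_def)

lemma fls_lim_const: "fls_lim (\<lambda>n. x) x"
  by (simp add: fls_lim_def fls_ball_0)

lemma fls_lim_subseq:
  assumes "fls_lim f x" "strict_mono \<sigma>"
  shows "fls_lim (\<lambda>n. f (\<sigma> n)) x"
  unfolding fls_lim_def
proof
  fix N
  obtain n0 where "\<forall>n\<ge>n0. f n - x \<in> fls_ball N" using fls_limD[OF assms(1)] by blast
  then show "\<exists>n0. \<forall>n\<ge>n0. f (\<sigma> n) - x \<in> fls_ball N"
    using seq_suble[OF assms(2)] by (meson order_trans)
qed

lemma fls_lim_add:
  fixes x y :: "'a::ab_group_add fls"
  assumes "fls_lim f x" "fls_lim g y"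
  shows "fls_lim (\<lambda>n. f n + g n) (x + y)"
  unfolding fls_lim_def
proof
  fix N
  obtain n0 n1 where n: "\<forall>n\<ge>n0. f n - x \<in> fls_ball N" "\<forall>n\<ge>n1. g n - y \<in> fls_ball N"
    using fls_limD assms by metis
  have "f n + g n - (x + y) \<in> fls_ball N" if "n \<ge> max n0 n1" for n
    using fls_ball_add[of "f n - x" N "g n - y"] n that by (simp add: algebra_simps)
  then show "\<exists>n0. \<forall>n\<ge>n0. f n + g n - (x + y) \<in> fls_ball N" by blast
qed

lemma fls_lim_sum:
  fixes x :: "'b \<Rightarrow> 'a::ab_group_add fls"
  assumes "\<And>i. i \<in> I \<Longrightarrow> fls_lim (\<lambda>n. f n i) (x i)"
  shows "fls_lim (\<lambda>n. \<Sum>i\<in>I. f n i) (\<Sum>i\<in>I. x i)"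
  using assms
  by (induction I rule: infinite_finite_induct) (auto simp: fls_lim_const intro: fls_lim_add)

lemma fls_lim_mult:
  fixes c :: "'a::field fls"
  assumes "fls_lim f x"
  shows "fls_lim (\<lambda>n. c * f n) (c * x)"
  unfolding fls_lim_def
proof
  fix N
  obtain n0 where n0: "\<forall>n\<ge>n0. f n - x \<in> fls_ball (N - fls_subdegree c)"
    using fls_limD[OF assms] by blast
  have "c * f n - c * x \<in> fls_ball N" if "n \<ge> n0" for n
    using fls_ball_mult[OF fls_in_ball[of c], of "f n - x"] n0 that by (fastforce simp: algebra_simps)
  then show "\<exists>n0. \<forall>n\<ge>n0. c * f n - c * x \<in> fls_ball N" by blast
qed

lemma fls_lim_uminus:
  fixes x :: "'a::field fls"
  assumes "fls_lim f x"
  shows "fls_lim (\<lambda>n. - f n) (- x)"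
  using fls_lim_mult[OF assms, of "-1"] by simp

lemma fls_lim_unique:
  fixes x :: "'a::ab_group_add fls"
  assumes "fls_lim f x" "fls_lim f y"
  shows "x = y"
proof -
  have "x - y \<in> fls_ball N" for N
  proof -
    obtain n0 n1 where n: "\<forall>n\<ge>n0. f n - x \<in> fls_ball N" "\<forall>n\<ge>n1. f n - y \<in> fls_ball N"
      using fls_limD assms by metis
    define n where "n = max n0 n1"
    show ?thesis
      using fls_ball_diff[of "f n - y" N "f n - x"] n by (simp add: n_def algebra_simps)
  qed
  then show ?thesis using fls_eq_0_ball[of "x - y"] by simp
qed

text \<open>Each coefficient is eventually constant along the sequence.\<close>

lemma fls_complete:
  fixes f :: "nat \<Rightarrow> 'a::ab_group_add fls"
  assumes "\<And>n. f (Suc n) - f n \<in> fls_ball (M + int n)"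
  shows "\<exists>x. \<forall>n. x - f n \<in> fls_ball (M + int n)"
proof -
  define g where "g k = f (nat (k - M + 1)) $$ k" for k
  have stab: "f (m + j) $$ k = f m $$ k" if "k < M + int m" for m j k
  proof (induction j)
    case (Suc j)
    have "(f (Suc (m + j)) - f (m + j)) $$ k = 0"
      using assms[of "m + j"] that by (simp add: fls_ball_def del: fls_minus_nth)
    then show ?case using Suc by simp
  qed simp
  have g: "f m $$ k = g k" if "k < M + int m" for m k
    unfolding g_def using stab[of k "nat (k - M + 1)" "m - nat (k - M + 1)"] that by simp
  define L where "L = min M (fls_subdegree (f 0))"
  have "g k = 0" if "k < L" for k
    using g[of k 0] that by (simp add: L_def)
  then have x: "Abs_fls g $$ k = g k" for k
    by (intro nth_Abs_fls_lower_bound[of L]) simp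
  have "Abs_fls g - f n \<in> fls_ball (M + int n)" for n
    using g x by (simp add: fls_ball_def)
  then show ?thesis by blast
qed

lemma fls_complete_lim:
  fixes f :: "nat \<Rightarrow> 'a::ab_group_add fls"
  assumes "\<And>n. x - f n \<in> fls_ball (M + int n)"
  shows "fls_lim f x"
  unfolding fls_lim_def
proof
  fix N
  have "f n - x \<in> fls_ball N" if "n \<ge> nat (N - M)" for n
    using fls_ball_uminus[OF assms[of n]] that fls_ball_mono[of "f n - x" "M + int n" N] by simp
  then show "\<exists>n0. \<forall>n\<ge>n0. f n - x \<in> fls_ball N" by blast
qed

text \<open>Balls are compact, since only finitely many coefficients can occur in each place.\<close>

lemma fls_ball_seq_compact:
  fixes f :: "nat \<Rightarrow> 'a::{finite,ab_group_add} fls"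
  assumes f: "\<And>n. f n \<in> fls_ball N"
  shows "\<exists>\<sigma> x. strict_mono \<sigma> \<and> fls_lim (\<lambda>n. f (\<sigma> n)) x"
proof -
  define P where "P n T \<longleftrightarrow> infinite (fst T) \<and> snd T \<in> fst T \<and>
      (\<forall>i\<in>fst T. \<forall>j\<in>fst T. f i - f j \<in> fls_ball (N + int n))" for n and T :: "nat set \<times> nat"
  define Q where "Q T T' \<longleftrightarrow> fst T' \<subseteq> fst T \<and> snd T < snd T'" for T T' :: "nat set \<times> nat"
  have "\<exists>T. \<forall>n. P n (T n) \<and> Q (T n) (T (Suc n))"
  proof (rule dependent_nat_choice)
    show "\<exists>T. P 0 T"
      using f by (intro exI[of _ "(UNIV, 0)"]) (simp add: P_def fls_ball_diff)
  next
    fix T n assume "P n T"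
    then have S: "infinite (fst T)" "\<And>i j. i \<in> fst T \<Longrightarrow> j \<in> fst T \<Longrightarrow> f i - f j \<in> fls_ball (N + int n)"
      by (auto simp: P_def)
    obtain a where a: "infinite {i\<in>fst T. f i $$ (N + int n) = a}"
    proof -
      have "\<exists>a\<in>UNIV. infinite {i\<in>fst T. f i $$ (N + int n) = a}"
        by (rule pigeonhole_infinite_rel[OF S(1)]) auto
      then show ?thesis using that by blast
    qed
    let ?S = "{i\<in>fst T. f i $$ (N + int n) = a}"
    obtain r where r: "r \<in> ?S" "snd T < r" using a unfolding infinite_nat_iff_unbounded by blast
    have "f i - f j \<in> fls_ball (N + int (Suc n))" if ij: "i \<in> ?S" "j \<in> ?S" for i j
    proof -
      have "(f i - f j) $$ k = 0" if "k < N + int (Suc n)" for k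
        using S(2)[of i j] ij that by (cases "k = N + int n") (auto simp: fls_ball_def)
      then show ?thesis by (simp add: fls_ball_def)
    qed
    then have "P (Suc n) (?S, r)" "Q T (?S, r)" using a r by (auto simp: P_def Q_def)
    then show "\<exists>T'. P (Suc n) T' \<and> Q T T'" by blast
  qed
  then obtain T where T: "\<And>n. P n (T n)" "\<And>n. Q (T n) (T (Suc n))" by blast
  define \<sigma> where "\<sigma> n = snd (T n)" for n
  have "strict_mono \<sigma>" unfolding strict_mono_Suc_iff \<sigma>_def using T(2) by (simp add: Q_def)
  moreover have "f (\<sigma> (Suc n)) - f (\<sigma> n) \<in> fls_ball (N + int n)" for n
  proof -
    have "\<sigma> (Suc n) \<in> fst (T n)" "\<sigma> n \<in> fst (T n)"
      using T(1)[of n] T(1)[of "Suc n"] T(2)[of n] by (auto simp: P_def Q_def \<sigma>_def)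
    then show ?thesis using T(1)[of n] by (auto simp: P_def)
  qed
  then obtain x where "\<And>n. x - f (\<sigma> n) \<in> fls_ball (N + int n)"
    using fls_complete[of "\<lambda>n. f (\<sigma> n)"] by blast
  then have "fls_lim (\<lambda>n. f (\<sigma> n)) x" by (rule fls_complete_lim)
  ultimately show ?thesis by blast
qed

lemma fls_ball_seq_compact_family:
  fixes w :: "nat \<Rightarrow> 'b \<Rightarrow> 'a::{finite,ab_group_add} fls"
  assumes "finite J" "\<And>n j. j \<in> J \<Longrightarrow> w n j \<in> fls_ball N"
  shows "\<exists>\<sigma> v. strict_mono \<sigma> \<and> (\<forall>j\<in>J. fls_lim (\<lambda>n. w (\<sigma> n) j) (v j))"
  using assms
proof (induction J)
  case empty
  show ?case using strict_mono_id by blast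
next
  case (insert i J)
  obtain \<sigma> v where \<sigma>: "strict_mono \<sigma>" "\<forall>j\<in>J. fls_lim (\<lambda>n. w (\<sigma> n) j) (v j)"
    using insert.IH insert.prems by blast
  obtain \<tau> x where \<tau>: "strict_mono \<tau>" "fls_lim (\<lambda>n. w (\<sigma> (\<tau> n)) i) x"
    using fls_ball_seq_compact[of "\<lambda>n. w (\<sigma> n) i" N] insert.prems by blast
  have "strict_mono (\<sigma> \<circ> \<tau>)" using \<sigma>(1) \<tau>(1) by (rule strict_mono_o)
  moreover have "fls_lim (\<lambda>n. w ((\<sigma> \<circ> \<tau>) n) j) ((v(i := x)) j)" if "j \<in> insert i J" for j
  proof (cases "j = i")
    case False
    then show ?thesis using fls_lim_subseq[OF bspec[OF \<sigma>(2)] \<tau>(1), of j] that by simp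
  qed (use \<tau>(2) in simp)
  ultimately show ?case by blast
qed

locale finite_laurent =
  fixes d k :: nat and residue_field :: "'a::{finite,field} itself"
  assumes card_residue: "card (UNIV :: 'a set) = d" and d_def: "d = CHAR('a) ^ k" and k: "k \<ge> 1"
begin

lemma prime_char: "prime CHAR('a)"
  by (rule prime_CHAR_semidom) (simp add: finite_imp_CHAR_pos)

lemma d_gt_1: "d > 1"
  unfolding d_def using prime_gt_1_nat[OF prime_char] k by (intro one_less_power) auto

lemma frob_add: "(x + y :: 'a fls) ^ (d ^ n) = x ^ (d ^ n) + y ^ (d ^ n)"
  by (rule freshmans_dream'[of _ "k * n"]) (use prime_char in \<open>simp_all add: d_def power_mult\<close>)

lemma frob_sum: "(\<Sum>i\<in>I. f i :: 'a fls) ^ (d ^ n) = (\<Sum>i\<in>I. f i ^ (d ^ n))"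
  by (rule freshmans_dream_sum'[of _ "k * n"]) (use prime_char in \<open>simp_all add: d_def power_mult\<close>)

lemma frob_0: "(0 :: 'a fls) ^ (d ^ n) = 0"
  using d_gt_1 by simp

lemma frob_uminus: "(- x :: 'a fls) ^ (d ^ n) = - (x ^ (d ^ n))"
  using frob_add[of x "- x" n] by (simp add: frob_0 add_eq_0_iff)

lemma frob_diff: "(x - y :: 'a fls) ^ (d ^ n) = x ^ (d ^ n) - y ^ (d ^ n)"
  using frob_add[of x "- y" n] by (simp add: frob_uminus)

lemmas frob1 = frob_add[where n = 1, simplified] frob_sum[where n = 1, simplified]
  frob_0[where n = 1, simplified] frob_uminus[where n = 1, simplified] frob_diff[where n = 1, simplified]

lemma residue_power: "(c :: 'a) ^ d = c"
proof (cases "c = 0")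
  case False
  have "c * (\<Prod>y\<in>UNIV-{0}. c * y) = c * c ^ (card (UNIV :: 'a set) - 1) * \<Prod>(UNIV-{0})"
    by (simp add: prod.distrib mult_ac)
  also have "c * c ^ (card (UNIV :: 'a set) - 1) = c ^ d"
    using d_gt_1 card_residue by (simp flip: power_Suc)
  also have "(\<Prod>y\<in>UNIV-{0}. c * y) = (\<Prod>y\<in>UNIV-{0}. y)"
    by (rule prod.reindex_bij_witness[of _ "\<lambda>y. y / c" "\<lambda>y. c * y"]) (use False in auto)
  finally show ?thesis by simp
qed (use d_gt_1 in auto)

lemma frob_const: "(fls_const c :: 'a fls) ^ d = fls_const c"
  by (simp add: residue_power flip: fls_const_power)

lemma fls_lim_frob:
  assumes "fls_lim f (x :: 'a fls)"
  shows "fls_lim (\<lambda>n. f n ^ d) (x ^ d)"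
  unfolding fls_lim_def
proof
  fix N
  obtain n0 where n0: "\<forall>n\<ge>n0. f n - x \<in> fls_ball (max N 0)" using fls_limD[OF assms] by blast
  have "f n ^ d - x ^ d \<in> fls_ball N" if "n \<ge> n0" for n
  proof -
    have "(f n - x) ^ d \<in> fls_ball (int d * max N 0)" using n0 that d_gt_1 by (intro fls_ball_power) auto
    moreover have "1 * max N 0 \<le> int d * max N 0" using d_gt_1 by (intro mult_right_mono) auto
    then have "N \<le> int d * max N 0" by simp
    ultimately show ?thesis unfolding frob1(5) by (rule fls_ball_mono)
  qed
  then show "\<exists>n0. \<forall>n\<ge>n0. f n ^ d - x ^ d \<in> fls_ball N" by blast
qed


section \<open>Images of additive maps are closed\<close>

definition seq_closed :: "('r \<Rightarrow> 'a fls) set \<Rightarrow> bool" where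
  "seq_closed A \<longleftrightarrow> (\<forall>f c. (\<forall>n. f n \<in> A) \<longrightarrow> (\<forall>r. fls_lim (\<lambda>n. f n r) (c r)) \<longrightarrow> c \<in> A)"

lemma seq_closedD:
  assumes "seq_closed A" "\<And>n. f n \<in> A" "\<And>r. fls_lim (\<lambda>n. f n r) (c r)"
  shows "c \<in> A"
  using assms unfolding seq_closed_def by blast

text \<open>A general additive map that involves the first two powers of Frobenius only, with arguments \<open>w j\<close> for
  \<open>j \<in> J\<close> and values in a power of the field, whose coordinates (rows) are indexed by \<open>'r\<close>.\<close>

definition add_map ::
    "nat set \<Rightarrow> (nat \<Rightarrow> 'r \<Rightarrow> 'a fls) \<Rightarrow> (nat \<Rightarrow> 'r \<Rightarrow> 'a fls) \<Rightarrow> (nat \<Rightarrow> 'a fls) \<Rightarrow> 'r \<Rightarrow> 'a fls" where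
  "add_map J P M w r = (\<Sum>j\<in>J. P j r * w j ^ d + M j r * w j)"

lemma fls_lim_add_map:
  assumes "\<And>j. j \<in> J \<Longrightarrow> fls_lim (\<lambda>n. w n j) (v j)"
  shows "fls_lim (\<lambda>n. add_map J P M (w n) r) (add_map J P M v r)"
  unfolding add_map_def using assms
  by (intro fls_lim_sum fls_lim_add fls_lim_mult fls_lim_frob)

lemma fls_lim_family_ball:
  assumes "finite J" "\<And>j. j \<in> J \<Longrightarrow> fls_lim (\<lambda>n. w n j) (v j)"
  shows "\<exists>n0. \<forall>n\<ge>n0. \<forall>j\<in>J. w n j - v j \<in> fls_ball N"
  using assms
proof (induction J)
  case (insert i J)
  then obtain n0 where n0: "\<forall>n\<ge>n0. \<forall>j\<in>J. w n j - v j \<in> fls_ball N" by blast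
  obtain n1 where "\<forall>n\<ge>n1. w n i - v i \<in> fls_ball N" using fls_limD[OF insert.prems] by blast
  then have "\<forall>n\<ge>max n0 n1. \<forall>j\<in>insert i J. w n j - v j \<in> fls_ball N" using n0 by auto
  then show ?case by blast
qed simp

text \<open>Rescale \<open>w n\<close> so that its largest entry becomes a unit. By compactness the rescaled vectors have a limit
  point \<open>b\<close>, which is nonzero. Since the values of the map stay bounded and \<open>d > 1\<close>, the linear terms
  become negligible and the leading terms vanish at \<open>b\<close>.\<close>

lemma unbounded_direction:
  assumes J: "finite J" and lim: "\<And>r. fls_lim (\<lambda>n. add_map J P M (w n) r) (c r)"
    and unbounded: "\<And>N. \<exists>n0. \<forall>n\<ge>n0. \<exists>j\<in>J. w n j \<notin> fls_ball N"
  shows "\<exists>b. (\<exists>j\<in>J. b j \<noteq> 0) \<and> (\<forall>r. (\<Sum>j\<in>J. P j r * b j ^ d) = 0)"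
proof -
  define S where "S n = (\<lambda>j. fls_subdegree (w n j)) ` {j\<in>J. w n j \<noteq> 0}" for n
  define s where "s n = nat (- Min (S n))" for n
  define u where "u n j = fls_X ^ s n * w n j" for n j
  have S: "finite (S n)" for n using J by (simp add: S_def)
  have Min_S: "\<exists>n0. \<forall>n\<ge>n0. S n \<noteq> {} \<and> Min (S n) < N" for N
  proof -
    obtain n0 where n0: "\<forall>n\<ge>n0. \<exists>j\<in>J. w n j \<notin> fls_ball N" using unbounded by blast
    have "S n \<noteq> {} \<and> Min (S n) < N" if "n \<ge> n0" for n
    proof -
      obtain j where "j \<in> J" "w n j \<notin> fls_ball N" using n0 \<open>n \<ge> n0\<close> by blast
      then have "fls_subdegree (w n j) \<in> S n" "fls_subdegree (w n j) < N"
        by (auto simp: S_def fls_ball_iff)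
      then show ?thesis using Min_le[OF S] by fastforce
    qed
    then show ?thesis by blast
  qed
  obtain n1 where n1: "\<And>n. n \<ge> n1 \<Longrightarrow> S n \<noteq> {} \<and> Min (S n) < 0" using Min_S by blast
  have s_large: "\<exists>n0. \<forall>n\<ge>n0. int (s n) \<ge> N" for N
  proof -
    obtain n0 where n0: "\<forall>n\<ge>n0. S n \<noteq> {} \<and> Min (S n) < - N" using Min_S by blast
    have "int (s n) \<ge> N" if "n \<ge> n0" for n
      using n0 that by (fastforce simp: s_def)
    then show ?thesis by blast
  qed
  have u: "u n j \<in> fls_ball 0" if "n \<ge> n1" "j \<in> J" for n j
  proof (cases "w n j = 0")
    case False
    then have "Min (S n) \<le> fls_subdegree (w n j)" using that(2) by (intro Min_le S) (auto simp: S_def)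
    then show ?thesis using False n1[OF that(1)] by (simp add: u_def fls_ball_iff s_def)
  qed (simp add: u_def fls_ball_0)
  have u0: "\<exists>j\<in>J. u n j $$ 0 \<noteq> 0" if "n \<ge> n1" for n
  proof -
    have "Min (S n) \<in> S n" using n1[OF that] S by (intro Min_in) auto
    then obtain j where j: "j \<in> J" "w n j \<noteq> 0" "fls_subdegree (w n j) = Min (S n)" by (auto simp: S_def)
    then have "fls_subdegree (u n j) = 0" "u n j \<noteq> 0" using n1[OF that] by (auto simp: u_def s_def)
    then show ?thesis using j(1) nth_fls_subdegree_nonzero[of "u n j"] by auto
  qed
  obtain \<sigma> b where \<sigma>: "strict_mono \<sigma>" and b': "\<forall>j\<in>J. fls_lim (\<lambda>n. u (\<sigma> n + n1) j) (b j)"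
    using fls_ball_seq_compact_family[OF J, of "\<lambda>n. u (n + n1)" 0] u by auto
  then have b: "\<And>j. j \<in> J \<Longrightarrow> fls_lim (\<lambda>n. u (\<sigma> n + n1) j) (b j)" by blast
  obtain n2 where "\<forall>n\<ge>n2. \<forall>j\<in>J. u (\<sigma> n + n1) j - b j \<in> fls_ball 1"
    using fls_lim_family_ball[of J "\<lambda>n. u (\<sigma> n + n1)" b 1, OF J b] by blast
  then have n2: "\<forall>j\<in>J. u (\<sigma> n2 + n1) j - b j \<in> fls_ball 1" by blast
  obtain j where "j \<in> J" "u (\<sigma> n2 + n1) j $$ 0 \<noteq> 0" using u0[of "\<sigma> n2 + n1"] by auto
  then have "b j $$ 0 \<noteq> 0" using n2 by (auto simp: fls_ball_def)
  then have nonzero: "\<exists>j\<in>J. b j \<noteq> 0" using \<open>j \<in> J\<close> by (metis fls_zero_nth)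
  have "(\<Sum>j\<in>J. P j r * b j ^ d) = 0" for r
  proof -
    have l1: "fls_lim (\<lambda>n. \<Sum>j\<in>J. P j r * u (\<sigma> n + n1) j ^ d) (\<Sum>j\<in>J. P j r * b j ^ d)"
      by (intro fls_lim_sum fls_lim_mult fls_lim_frob b)
    have "fls_lim (\<lambda>n. \<Sum>j\<in>J. P j r * u (\<sigma> n + n1) j ^ d) 0"
      unfolding fls_lim_def
    proof
      fix N
      define C where "C = fls_subdegree (c r)"
      obtain C' where C': "\<forall>j\<in>J. M j r \<in> fls_ball C'" using fls_in_ball_finite[OF J, of "\<lambda>j. M j r"] by blast
      obtain m0 where m0: "\<And>n. n \<ge> m0 \<Longrightarrow> add_map J P M (w n) r - c r \<in> fls_ball C"
        using fls_limD[OF lim] by blast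
      obtain m1 where m1: "\<And>n. n \<ge> m1 \<Longrightarrow> int (s n) \<ge> max 0 (max (N - C) (N - C'))"
        using s_large by blast
      have "(\<Sum>j\<in>J. P j r * u n j ^ d) \<in> fls_ball N" if n: "n \<ge> max n1 (max m0 m1)" for n
      proof -
        have sn: "int (s n) \<ge> 0" "int (s n) \<ge> N - C" "int (s n) \<ge> N - C'" using m1[of n] n by auto
        have Xs: "(fls_X :: 'a fls) ^ m \<in> fls_ball (int m)" for m by (simp add: fls_ball_iff)
        have d2: "s n \<le> d * s n" "s n \<le> (d - 1) * s n"
          using d_gt_1 by (auto simp: less_eq_Suc_le)
        have "d * s n = (d - 1) * s n + s n" using d_gt_1 by (simp add: algebra_simps)
        then have X: "(fls_X :: 'a fls) ^ (d * s n) * x = fls_X ^ ((d - 1) * s n) * (fls_X ^ s n * x)" for x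
          by (simp add: power_add mult.assoc)
        have Xd: "(fls_X :: 'a fls) ^ (d * s n) = (fls_X ^ s n) ^ d"
          by (subst mult.commute) (rule power_mult)
        have "fls_X ^ (d * s n) * add_map J P M (w n) r =
            (\<Sum>j\<in>J. P j r * u n j ^ d) + (\<Sum>j\<in>J. fls_X ^ ((d - 1) * s n) * (M j r * u n j))"
          unfolding add_map_def sum_distrib_left sum.distrib[symmetric]
        proof (intro sum.cong refl)
          fix j
          have "fls_X ^ (d * s n) * (P j r * w n j ^ d) = P j r * u n j ^ d"
            unfolding u_def power_mult_distrib by (simp only: Xd mult.left_commute)
          moreover have "fls_X ^ (d * s n) * (M j r * w n j) = fls_X ^ ((d - 1) * s n) * (M j r * u n j)"
            by (subst X) (simp only: u_def mult.left_commute)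
          ultimately show "fls_X ^ (d * s n) * (P j r * w n j ^ d + M j r * w n j) =
              P j r * u n j ^ d + fls_X ^ ((d - 1) * s n) * (M j r * u n j)"
            by (simp only: distrib_left)
        qed
        moreover have "fls_X ^ (d * s n) * add_map J P M (w n) r \<in> fls_ball N"
        proof -
          have "add_map J P M (w n) r \<in> fls_ball C"
            using fls_ball_add[OF m0 fls_in_ball[of "c r", folded C_def], of n] n by simp
          from fls_ball_mult[OF Xs this] show ?thesis
            by (rule fls_ball_mono) (use sn(2) d2(1) in linarith)
        qed
        moreover have "(\<Sum>j\<in>J. fls_X ^ ((d - 1) * s n) * (M j r * u n j)) \<in> fls_ball N"
        proof (intro fls_ball_sum)
          fix j assume "j \<in> J"
          then have "fls_X ^ ((d - 1) * s n) * (M j r * u n j) \<in> fls_ball (int ((d - 1) * s n) + (C' + 0))"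
            using C' u n by (intro fls_ball_mult Xs) auto
          then show "fls_X ^ ((d - 1) * s n) * (M j r * u n j) \<in> fls_ball N"
            by (rule fls_ball_mono) (use sn(3) d2(2) in linarith)
        qed
        ultimately have "(\<Sum>j\<in>J. P j r * u n j ^ d) + (\<Sum>j\<in>J. fls_X ^ ((d - 1) * s n) * (M j r * u n j)) -
            (\<Sum>j\<in>J. fls_X ^ ((d - 1) * s n) * (M j r * u n j)) \<in> fls_ball N"
          by (intro fls_ball_diff) (simp_all only:)
        then show ?thesis by (simp only: add_diff_cancel_right')
      qed
      moreover have "\<sigma> n + n1 \<ge> n" for n using seq_suble[OF \<sigma>, of n] by simp
      ultimately show "\<exists>n0. \<forall>n\<ge>n0. (\<Sum>j\<in>J. P j r * u (\<sigma> n + n1) j ^ d) - 0 \<in> fls_ball N"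
        by (intro exI[of _ "max n1 (max m0 m1)"] allI impI) (simp only: diff_zero, blast intro: order_trans)
    qed
    then show ?thesis using fls_lim_unique[OF l1] by blast
  qed
  then show ?thesis using nonzero by blast
qed

text \<open>Either the preimages of a convergent sequence have a bounded subsequence, and compactness yields
  a preimage of the limit, or \<open>unbounded_direction\<close> provides a relation between the leading
  coefficients. In the second case a change of variables splits off a summand \<open>v y\<close> that is linear in the
  new variable \<open>y\<close>. After \<open>v\<close> has been used to clear a row, the induction hypothesis applies to the
  remaining variables.\<close>

lemma seq_closed_add_map:
  fixes P M :: "nat \<Rightarrow> 'r \<Rightarrow> 'a fls"
  assumes "finite J"
  shows "seq_closed (range (add_map J P M))"
  using assms
proof (induction J arbitrary: P M rule: finite_psubset_induct)
  case (psubset J)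
  show ?case
    unfolding seq_closed_def
  proof (intro allI impI)
    fix f :: "nat \<Rightarrow> 'r \<Rightarrow> 'a fls" and c
    assume f: "\<forall>n. f n \<in> range (add_map J P M)" and lim: "\<forall>r. fls_lim (\<lambda>n. f n r) (c r)"
    have "\<forall>n. \<exists>w. f n = add_map J P M w" using f by blast
    then obtain w where w: "\<And>n. f n = add_map J P M (w n)" by metis
    show "c \<in> range (add_map J P M)"
    proof (cases "\<exists>b. (\<exists>j\<in>J. b j \<noteq> 0) \<and> (\<forall>r. (\<Sum>j\<in>J. P j r * b j ^ d) = 0)")
      case True
      then obtain b0 i where b0: "i \<in> J" "b0 i \<noteq> 0" "\<And>r. (\<Sum>j\<in>J. P j r * b0 j ^ d) = 0" by blast
      define b where "b j = b0 j / b0 i" for j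
      have b: "b i = 1" "\<And>r. (\<Sum>j\<in>J. P j r * b j ^ d) = 0"
        using b0 by (simp_all add: b_def power_divide flip: sum_divide_distrib)
      define v where "v r = (\<Sum>j\<in>J. M j r * b j)" for r
      let ?J = "J - {i}"
      have dec: "add_map J P M z r = add_map ?J P M (\<lambda>j. z j - z i * b j) r + v r * z i" for z r
      proof -
        have "add_map J P M z r = (\<Sum>j\<in>J. P j r * (z j - z i * b j) ^ d + M j r * (z j - z i * b j)) +
            (z i ^ d * (\<Sum>j\<in>J. P j r * b j ^ d) + v r * z i)"
          unfolding add_map_def v_def sum_distrib_left sum_distrib_right sum.distrib[symmetric]
          by (intro sum.cong refl) (simp add: frob1 power_mult_distrib algebra_simps)
        also have "(\<Sum>j\<in>J. P j r * (z j - z i * b j) ^ d + M j r * (z j - z i * b j)) =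
            add_map ?J P M (\<lambda>j. z j - z i * b j) r"
          unfolding add_map_def using d_gt_1 b(1)
          by (intro sum.mono_neutral_right psubset.hyps) auto
        finally show ?thesis by (simp add: b(2))
      qed
      have inc: "(\<lambda>r. add_map ?J P M z r + v r * y) \<in> range (add_map J P M)" for z y
      proof -
        define z' where "z' j = (if j = i then y else z j + y * b j)" for j
        have "add_map ?J P M (\<lambda>j. z' j - z' i * b j) r = add_map ?J P M z r" for r
          unfolding add_map_def by (intro sum.cong) (auto simp: z'_def)
        then have "(\<lambda>r. add_map ?J P M z r + v r * y) = add_map J P M z'"
          by (intro ext) (simp add: dec[of z'], simp add: z'_def)
        then show ?thesis by blast
      qed
      have sub: "?J \<subset> J" using b0(1) by blast
      show ?thesis
      proof (cases "\<forall>r. v r = 0")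
        case True
        then have "f n = add_map ?J P M (\<lambda>j. w n j - w n i * b j)" for n
          unfolding w by (intro ext) (simp add: dec[of "w n"])
        then have "f n \<in> range (add_map ?J P M)" for n by simp
        then have "c \<in> range (add_map ?J P M)"
          by (rule seq_closedD[OF psubset.IH[OF sub] _ spec[OF lim]])
        then obtain z where "c = add_map ?J P M z" by blast
        then show ?thesis using inc[of z 0] by simp
      next
        case False
        then obtain r0 where r0: "v r0 \<noteq> 0" by blast
        \<comment> \<open>subtract the multiple of \<open>v\<close> that clears row \<open>r0\<close>\<close>
        define q where "q g r = g r - v r / v r0 * g r0" for g :: "'r \<Rightarrow> 'a fls" and r
        have q_map: "q (add_map ?J P M z) = add_map ?J (\<lambda>j. q (P j)) (\<lambda>j. q (M j)) z" for z
          by (intro ext) (simp add: q_def add_map_def sum_distrib_left algebra_simps flip: sum_subtractf)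
        have "q (f n) = q (add_map ?J P M (\<lambda>j. w n j - w n i * b j))" for n
          using r0 unfolding q_def w by (intro ext) (simp add: dec[of "w n"] field_simps)
        then have "q (f n) \<in> range (add_map ?J (\<lambda>j. q (P j)) (\<lambda>j. q (M j)))" for n
          unfolding q_map by blast
        moreover have "fls_lim (\<lambda>n. q (f n) r) (q c r)" for r
          using fls_lim_add[OF spec[OF lim, of r] fls_lim_mult[OF spec[OF lim, of r0], of "- (v r / v r0)"]]
          by (simp add: q_def)
        ultimately have "q c \<in> range (add_map ?J (\<lambda>j. q (P j)) (\<lambda>j. q (M j)))"
          by (rule seq_closedD[OF psubset.IH[OF sub], of "\<lambda>n. q (f n)"])
        then obtain z where z: "q c = q (add_map ?J P M z)" unfolding q_map by blast
        define y where "y = (c r0 - add_map ?J P M z r0) / v r0"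
        have "c r = add_map ?J P M z r + v r * y" for r
          using fun_cong[OF z, of r] r0 by (simp add: q_def y_def field_simps)
        then have "c = (\<lambda>r. add_map ?J P M z r + v r * y)" by blast
        then show ?thesis using inc by simp
      qed
    next
      case False
      have "\<exists>N. \<forall>n0. \<exists>n\<ge>n0. \<forall>j\<in>J. w n j \<in> fls_ball N"
      proof (rule ccontr)
        assume "\<not> ?thesis"
        then have "\<exists>n0. \<forall>n\<ge>n0. \<exists>j\<in>J. w n j \<notin> fls_ball N" for N by blast
        with lim[unfolded w] False show False
          using unbounded_direction[OF psubset.hyps, of P M w c] by blast
      qed
      then obtain N where N: "\<And>n0. \<exists>n\<ge>n0. \<forall>j\<in>J. w n j \<in> fls_ball N" by blast
      then have "infinite {n. \<forall>j\<in>J. w n j \<in> fls_ball N}"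
        unfolding infinite_nat_iff_unbounded_le by simp
      then obtain \<tau> :: "nat \<Rightarrow> nat" where \<tau>: "strict_mono \<tau>" "\<And>n j. j \<in> J \<Longrightarrow> w (\<tau> n) j \<in> fls_ball N"
        using infinite_enumerate[of "{n. \<forall>j\<in>J. w n j \<in> fls_ball N}"] by blast
      obtain \<sigma> v where \<sigma>: "strict_mono \<sigma>" "\<And>j. j \<in> J \<Longrightarrow> fls_lim (\<lambda>n. w (\<tau> (\<sigma> n)) j) (v j)"
        using fls_ball_seq_compact_family[OF psubset.hyps, of "\<lambda>n. w (\<tau> n)" N] \<tau>(2) by blast
      have "c r = add_map J P M v r" for r
      proof (rule fls_lim_unique)
        show "fls_lim (\<lambda>n. f (\<tau> (\<sigma> n)) r) (c r)"
          using fls_lim_subseq[OF fls_lim_subseq[OF spec[OF lim] \<tau>(1)] \<sigma>(1)] by simp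
        show "fls_lim (\<lambda>n. f (\<tau> (\<sigma> n)) r) (add_map J P M v r)"
          unfolding w by (rule fls_lim_add_map) (rule \<sigma>(2))
      qed
      then show ?thesis by blast
    qed
  qed
qed

text \<open>The sum of \<open>A\<close> and the image of \<open>D\<close> under \<open>x \<mapsto> p x\<^sup>d + m x\<close>, for the column vectors \<open>p\<close>
  and \<open>m\<close>.\<close>

definition plus_column ::
    "'a fls set \<Rightarrow> ('r \<Rightarrow> 'a fls) \<Rightarrow> ('r \<Rightarrow> 'a fls) \<Rightarrow> ('r \<Rightarrow> 'a fls) set \<Rightarrow> ('r \<Rightarrow> 'a fls) set" where
  "plus_column D p m A = {\<lambda>r. a r + (p r * x ^ d + m r * x) | a x. a \<in> A \<and> x \<in> D}"

lemma plus_columnI: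
  "a \<in> A \<Longrightarrow> x \<in> D \<Longrightarrow> (\<lambda>r. a r + (p r * x ^ d + m r * x)) \<in> plus_column D p m A"
  unfolding plus_column_def by blast

inductive column_sum :: "('r \<Rightarrow> 'a fls) set \<Rightarrow> bool" where
  zero: "column_sum {\<lambda>r. 0}"
| full: "column_sum A \<Longrightarrow> column_sum (plus_column UNIV p m A)"
| integral: "column_sum A \<Longrightarrow> column_sum (plus_column (fls_ball 0) p m A)"

lemma seq_closed_plus_column:
  assumes A: "seq_closed A"
  shows "seq_closed (plus_column (fls_ball 0) p m A)"
  unfolding seq_closed_def
proof (intro allI impI)
  fix f c
  assume f: "\<forall>n. f n \<in> plus_column (fls_ball 0) p m A" and lim: "\<forall>r. fls_lim (\<lambda>n. f n r) (c r)"
  have "\<forall>n. \<exists>a x. a \<in> A \<and> x \<in> fls_ball 0 \<and> f n = (\<lambda>r. a r + (p r * x ^ d + m r * x))"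
    using f unfolding plus_column_def by blast
  then obtain a x where ax: "\<And>n. a n \<in> A" "\<And>n. x n \<in> fls_ball 0"
      "\<And>n. f n = (\<lambda>r. a n r + (p r * x n ^ d + m r * x n))" by metis
  obtain \<sigma> y where \<sigma>: "strict_mono \<sigma>" "fls_lim (\<lambda>n. x (\<sigma> n)) y"
    using fls_ball_seq_compact[of x] ax(2) by blast
  obtain n0 where "\<forall>n\<ge>n0. x (\<sigma> n) - y \<in> fls_ball 0" using fls_limD[OF \<sigma>(2)] by blast
  then have "x (\<sigma> n0) - (x (\<sigma> n0) - y) \<in> fls_ball 0" using ax(2) by (rule_tac fls_ball_diff) auto
  then have y: "y \<in> fls_ball 0" by simp
  have "fls_lim (\<lambda>n. a (\<sigma> n) r) (c r - (p r * y ^ d + m r * y))" for r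
  proof -
    have "fls_lim (\<lambda>n. p r * x (\<sigma> n) ^ d + m r * x (\<sigma> n)) (p r * y ^ d + m r * y)"
      by (intro fls_lim_add fls_lim_mult fls_lim_frob \<sigma>(2))
    from fls_lim_add[OF fls_lim_subseq[OF spec[OF lim] \<sigma>(1), of r] fls_lim_uminus[OF this]]
    show ?thesis by (simp add: ax(3) algebra_simps)
  qed
  then have "(\<lambda>r. c r - (p r * y ^ d + m r * y)) \<in> A"
    by (rule seq_closedD[OF A, of "\<lambda>n. a (\<sigma> n)", OF ax(1)])
  from plus_columnI[OF this y, of p m] show "c \<in> plus_column (fls_ball 0) p m A" by simp
qed

text \<open>A column with argument in the valuation ring can be added to a closed set by itself, by compactness.
  The columns with unrestricted argument have to be treated together, so they are collected
  in \<open>add_map J P M\<close> while the induction removes columns from \<open>A\<close>.\<close>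

lemma seq_closed_column_sum_aux:
  assumes "column_sum A" "finite J"
  shows "seq_closed {\<lambda>r. add_map J P M w r + a r | w a. a \<in> A}"
  using assms
proof (induction arbitrary: J P M)
  case zero
  have "{\<lambda>r. add_map J P M w r + a r | w a. a \<in> {\<lambda>r. 0}} = range (add_map J P M)"
    by auto
  then show ?case using seq_closed_add_map[OF zero] by simp
next
  case (full A p m)
  obtain j where j: "j \<notin> J" using ex_new_if_finite[OF infinite_UNIV_nat full.prems] by blast
  have e: "add_map (insert j J) (P(j := p)) (M(j := m)) w r = add_map J P M w r + (p r * w j ^ d + m r * w j)" for w r
  proof -
    have "(\<Sum>i\<in>J. (P(j := p)) i r * w i ^ d + (M(j := m)) i r * w i) = add_map J P M w r"
      unfolding add_map_def using j by (intro sum.cong) auto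
    then show ?thesis using full.prems j by (simp add: add_map_def add.commute)
  qed
  have "{\<lambda>r. add_map J P M w r + a r | w a. a \<in> plus_column UNIV p m A} =
      {\<lambda>r. add_map (insert j J) (P(j := p)) (M(j := m)) w r + a r | w a. a \<in> A}" (is "?L = ?R")
  proof
    show "?L \<subseteq> ?R"
    proof
      fix g assume "g \<in> ?L"
      then obtain w a x where g: "a \<in> A" "g = (\<lambda>r. add_map J P M w r + (a r + (p r * x ^ d + m r * x)))"
        unfolding plus_column_def by blast
      have "add_map J P M (w(j := x)) r = add_map J P M w r" for r
        unfolding add_map_def using j by (intro sum.cong) auto
      then have "g = (\<lambda>r. add_map (insert j J) (P(j := p)) (M(j := m)) (w(j := x)) r + a r)"
        unfolding g(2) e by (simp add: fun_eq_iff)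
      then show "g \<in> ?R" using g(1) by blast
    qed
    show "?R \<subseteq> ?L"
    proof
      fix g assume "g \<in> ?R"
      then obtain w a where g: "a \<in> A" "g = (\<lambda>r. add_map J P M w r + (a r + (p r * w j ^ d + m r * w j)))"
        unfolding e by (auto simp: algebra_simps)
      moreover have "(\<lambda>r. a r + (p r * w j ^ d + m r * w j)) \<in> plus_column UNIV p m A"
        using g(1) unfolding plus_column_def by blast
      ultimately show "g \<in> ?L" by (intro CollectI exI conjI) auto
    qed
  qed
  then show ?case using full.IH[of "insert j J"] full.prems by simp
next
  case (integral A p m)
  have "{\<lambda>r. add_map J P M w r + a r | w a. a \<in> plus_column (fls_ball 0) p m A} =
      plus_column (fls_ball 0) p m {\<lambda>r. add_map J P M w r + a r | w a. a \<in> A}" (is "?L = ?R")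
  proof
    show "?L \<subseteq> ?R"
    proof
      fix g assume "g \<in> ?L"
      then obtain w a x where g: "a \<in> A" "x \<in> fls_ball 0"
          "g = (\<lambda>r. add_map J P M w r + (a r + (p r * x ^ d + m r * x)))"
        unfolding plus_column_def by blast
      have "(\<lambda>r. add_map J P M w r + a r) \<in> {\<lambda>r. add_map J P M w r + a r | w a. a \<in> A}"
        using g(1) by blast
      from plus_columnI[OF this g(2), of p m] show "g \<in> ?R"
        by (simp add: g(3) add.assoc)
    qed
    show "?R \<subseteq> ?L"
    proof
      fix g assume "g \<in> ?R"
      then obtain w a x where g: "a \<in> A" "x \<in> fls_ball 0"
          "g = (\<lambda>r. (add_map J P M w r + a r) + (p r * x ^ d + m r * x))"
        unfolding plus_column_def by blast
      then have "g = (\<lambda>r. add_map J P M w r + (a r + (p r * x ^ d + m r * x)))"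
        by (simp add: add.assoc)
      moreover have "(\<lambda>r. a r + (p r * x ^ d + m r * x)) \<in> plus_column (fls_ball 0) p m A"
        by (rule plus_columnI[OF g(1,2)])
      ultimately show "g \<in> ?L" by (intro CollectI exI conjI) auto
    qed
  qed
  then show ?case using seq_closed_plus_column[OF integral.IH[OF integral.prems]] by simp
qed

lemma seq_closed_column_sum:
  assumes "column_sum A"
  shows "seq_closed A"
proof -
  have "{\<lambda>r. add_map {} P M w r + a r | w a. a \<in> A} = A" for P M by (simp add: add_map_def)
  then show ?thesis using seq_closed_column_sum_aux[OF assms, of "{}"] by simp
qed

text \<open>Two families of rows are combined into one, so that two systems of equations become a single one.\<close>

definition interleave :: "(nat \<Rightarrow> 'b) \<Rightarrow> (nat \<Rightarrow> 'b) \<Rightarrow> nat \<Rightarrow> 'b" where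
  "interleave a b r = (if even r then a (r div 2) else b (r div 2))"

lemma interleave_eq: "interleave a b = interleave a' b' \<longleftrightarrow> a = a' \<and> b = b'"
proof
  assume "interleave a b = interleave a' b'"
  then have "interleave a b (2 * r) = interleave a' b' (2 * r)"
    "interleave a b (2 * r + 1) = interleave a' b' (2 * r + 1)" for r by simp_all
  then show "a = a' \<and> b = b'" by (simp add: interleave_def fun_eq_iff)
qed simp

lemma column_sum_interleave:
  assumes "column_sum A" "column_sum B"
  shows "column_sum {interleave a b | a b. a \<in> A \<and> b \<in> B}"
proof -
  let ?z = "\<lambda>r::nat. 0 :: 'a fls"
  have right: "{interleave a b | a b. a \<in> A \<and> b \<in> plus_column D p m B} =
      plus_column D (interleave ?z p) (interleave ?z m) {interleave a b | a b. a \<in> A \<and> b \<in> B}" for A B p m D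
  proof -
    have "interleave a (\<lambda>r. b r + (p r * x ^ d + m r * x)) =
        (\<lambda>r. interleave a b r + (interleave ?z p r * x ^ d + interleave ?z m r * x))" for a b x
      by (auto simp: interleave_def fun_eq_iff)
    then show ?thesis unfolding plus_column_def by (auto, metis, metis)
  qed
  have left: "{interleave a b | a b. a \<in> plus_column D p m A \<and> b \<in> B} =
      plus_column D (interleave p ?z) (interleave m ?z) {interleave a b | a b. a \<in> A \<and> b \<in> B}" for A B p m D
  proof -
    have "interleave (\<lambda>r. a r + (p r * x ^ d + m r * x)) b =
        (\<lambda>r. interleave a b r + (interleave p ?z r * x ^ d + interleave m ?z r * x))" for a b x
      by (auto simp: interleave_def fun_eq_iff)
    then show ?thesis unfolding plus_column_def by (auto, metis, metis)
  qed
  have zero: "interleave ?z ?z = ?z" by (auto simp: interleave_def)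
  have base: "column_sum {interleave a b | a b. a \<in> {?z} \<and> b \<in> B}"
    using assms(2)
  proof induction
    case zero
    show ?case using column_sum.zero by (simp add: \<open>interleave ?z ?z = ?z\<close>)
  qed (unfold right, auto intro: column_sum.intros)
  show ?thesis
    using assms(1)
  proof induction
    case zero
    show ?case by (rule base)
  qed (unfold left, auto intro: column_sum.intros)
qed

section \<open>Positive primitive sets are closed\<close>

text \<open>The sets of assignments that satisfy a positive primitive formula. Only the simplest atomic formulas are
  needed, because compound terms can be expressed with the help of auxiliary variables
  (\<open>pp_term\<close>).\<close>

inductive pp :: "'a fls set \<Rightarrow> (nat \<Rightarrow> 'a fls) set \<Rightarrow> bool" for K where
  pp_add: "pp K {e. e i = e j + e l}"
| pp_scale: "a \<in> K \<Longrightarrow> pp K {e. e i = a * e j}"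
| pp_frob: "pp K {e. e i = e j ^ d}"
| pp_val: "pp K {e. e i \<in> fls_integers}"
| pp_Int: "pp K S \<Longrightarrow> pp K T \<Longrightarrow> pp K (S \<inter> T)"
| pp_ex: "pp K S \<Longrightarrow> pp K {e. \<exists>x. e(i := x) \<in> S}"

text \<open>Changing a single argument changes the value by a column in the difference of the arguments. In this form
  the property is inherited when an argument is quantified existentially: the function \<open>B\<close> remains
  the same, and the quantifier adds a column to the set \<open>A\<close> in \<open>column_normal\<close>.\<close>

definition frobenius_affine :: "((nat \<Rightarrow> 'a fls) \<Rightarrow> 'r \<Rightarrow> 'a fls) \<Rightarrow> bool" where
  "frobenius_affine B \<longleftrightarrow> (\<forall>i. \<exists>p m. \<forall>e x r.
     B (e(i := x)) r = B e r + (p r * (x - e i) ^ d + m r * (x - e i)))"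

definition column_normal :: "(nat \<Rightarrow> 'a fls) set \<Rightarrow> bool" where
  "column_normal S \<longleftrightarrow>
     (\<exists>(B :: (nat \<Rightarrow> 'a fls) \<Rightarrow> nat \<Rightarrow> 'a fls) A. frobenius_affine B \<and> column_sum A \<and> S = {e. B e \<in> A})"

lemma column_normal_scalar:
  assumes \<beta>: "\<And>i. \<exists>p m. \<forall>e x. \<beta> (e(i := x)) = \<beta> e + (p * (x - e i) ^ d + m * (x - e i))"
    and D: "D = {0} \<or> D = fls_integers"
  shows "column_normal {e. \<beta> e \<in> D}"
proof -
  define B where "B e r = (if r = (0::nat) then \<beta> e else 0)" for e r
  have "frobenius_affine B"
    unfolding frobenius_affine_def
  proof
    fix i
    obtain p m where "\<forall>e x. \<beta> (e(i := x)) = \<beta> e + (p * (x - e i) ^ d + m * (x - e i))" using \<beta> by blast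
    then show "\<exists>p m. \<forall>e x r. B (e(i := x)) r = B e r + (p r * (x - e i) ^ d + m r * (x - e i))"
      by (intro exI[of _ "\<lambda>r. if r = 0 then p else 0"] exI[of _ "\<lambda>r. if r = 0 then m else 0"])
        (simp add: B_def)
  qed
  moreover have "\<exists>A. column_sum A \<and> {e. \<beta> e \<in> D} = {e. B e \<in> A}"
    using D
  proof
    assume "D = {0}"
    then have "{e. \<beta> e \<in> D} = {e. B e \<in> {\<lambda>r. 0}}" by (auto simp: B_def fun_eq_iff)
    then show ?thesis using column_sum.zero by blast
  next
    assume D: "D = fls_integers"
    let ?A = "plus_column (fls_ball 0) (\<lambda>r. 0) (\<lambda>r. if r = (0::nat) then 1 else 0) {\<lambda>r. 0}"
    have "\<beta> e \<in> D \<longleftrightarrow> B e \<in> ?A" for e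
    proof
      assume "\<beta> e \<in> D"
      then show "B e \<in> ?A" unfolding plus_column_def
        by (intro CollectI exI[of _ "\<lambda>r. 0"] exI[of _ "\<beta> e"]) (auto simp: B_def D fls_integers_ball)
    next
      assume "B e \<in> ?A"
      then obtain x where "x \<in> fls_ball 0" "B e = (\<lambda>r. (if r = 0 then 1 else 0) * x)"
        unfolding plus_column_def by auto
      then have "x \<in> fls_ball 0" "B e 0 = x" by simp_all
      then have "x \<in> fls_ball 0" "\<beta> e = x" by (simp_all add: B_def)
      then show "\<beta> e \<in> D" by (simp add: D fls_integers_ball)
    qed
    then show ?thesis using column_sum.integral[OF column_sum.zero] by blast
  qed
  ultimately show ?thesis unfolding column_normal_def by blast
qed

lemma column_normal_pp:
  assumes "pp K S"
  shows "column_normal S"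
  using assms
proof induction
  case (pp_add i j l)
  have "column_normal {e. e i - e j - e l \<in> {0}}"
  proof (rule column_normal_scalar)
    fix n :: nat
    define \<delta> where "\<delta> i = (if i = n then 1 else 0 :: 'a fls)" for i
    show "\<exists>p m. \<forall>(e :: nat \<Rightarrow> 'a fls) x. (e(n := x)) i - (e(n := x)) j - (e(n := x)) l =
        e i - e j - e l + (p * (x - e n) ^ d + m * (x - e n))"
      by (intro exI[of _ 0] exI[of _ "\<delta> i - \<delta> j - \<delta> l"]) (auto simp: \<delta>_def algebra_simps)
  qed simp
  moreover have "{e. e i - e j - e l \<in> {0}} = {e. e i = e j + (e l :: 'a fls)}" by (auto simp: algebra_simps)
  ultimately show ?case by simp
next
  case (pp_scale a i j)
  have "column_normal {e. e i - a * e j \<in> {0}}"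
  proof (rule column_normal_scalar)
    fix n :: nat
    define \<delta> where "\<delta> i = (if i = n then 1 else 0 :: 'a fls)" for i
    show "\<exists>p m. \<forall>(e :: nat \<Rightarrow> 'a fls) x. (e(n := x)) i - a * (e(n := x)) j =
        e i - a * e j + (p * (x - e n) ^ d + m * (x - e n))"
      by (intro exI[of _ 0] exI[of _ "\<delta> i - a * \<delta> j"]) (auto simp: \<delta>_def algebra_simps)
  qed simp
  then show ?case by simp
next
  case (pp_frob i j)
  have "column_normal {e. e i - e j ^ d \<in> {0}}"
  proof (rule column_normal_scalar)
    fix n :: nat
    define \<delta> where "\<delta> i = (if i = n then 1 else 0 :: 'a fls)" for i
    show "\<exists>p m. \<forall>(e :: nat \<Rightarrow> 'a fls) x. (e(n := x)) i - (e(n := x)) j ^ d =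
        e i - e j ^ d + (p * (x - e n) ^ d + m * (x - e n))"
      by (intro exI[of _ "- \<delta> j"] exI[of _ "\<delta> i"]) (auto simp: \<delta>_def frob1 algebra_simps)
  qed simp
  then show ?case by simp
next
  case (pp_val i)
  show ?case
  proof (rule column_normal_scalar)
    fix n
    show "\<exists>p m. \<forall>(e :: nat \<Rightarrow> 'a fls) x. (e(n := x)) i = e i + (p * (x - e n) ^ d + m * (x - e n))"
      by (intro exI[of _ 0] exI[of _ "if i = n then 1 else 0"]) auto
  qed simp
next
  case (pp_Int S T)
  obtain B :: "(nat \<Rightarrow> 'a fls) \<Rightarrow> nat \<Rightarrow> 'a fls" and A where S: "frobenius_affine B" "column_sum A" "S = {e. B e \<in> A}"
    using pp_Int.IH(1) unfolding column_normal_def by blast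
  obtain B' :: "(nat \<Rightarrow> 'a fls) \<Rightarrow> nat \<Rightarrow> 'a fls" and A' where T: "frobenius_affine B'" "column_sum A'" "T = {e. B' e \<in> A'}"
    using pp_Int.IH(2) unfolding column_normal_def by blast
  let ?B = "\<lambda>e. interleave (B e) (B' e)"
  have "frobenius_affine ?B"
    unfolding frobenius_affine_def
  proof
    fix i
    obtain p m p' m' where "\<forall>e x r. B (e(i := x)) r = B e r + (p r * (x - e i) ^ d + m r * (x - e i))"
      "\<forall>e x r. B' (e(i := x)) r = B' e r + (p' r * (x - e i) ^ d + m' r * (x - e i))"
      using S(1) T(1) unfolding frobenius_affine_def by metis
    then show "\<exists>p m. \<forall>e x r. ?B (e(i := x)) r = ?B e r + (p r * (x - e i) ^ d + m r * (x - e i))"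
      by (intro exI[of _ "interleave p p'"] exI[of _ "interleave m m'"]) (simp add: interleave_def)
  qed
  moreover have "S \<inter> T = {e. ?B e \<in> {interleave a b | a b. a \<in> A \<and> b \<in> A'}}"
    unfolding S(3) T(3) by (auto simp: interleave_eq)
  ultimately show ?case unfolding column_normal_def using column_sum_interleave[OF S(2) T(2)] by blast
next
  case (pp_ex S i)
  obtain B :: "(nat \<Rightarrow> 'a fls) \<Rightarrow> nat \<Rightarrow> 'a fls" and A where S: "frobenius_affine B" "column_sum A" "S = {e. B e \<in> A}"
    using pp_ex.IH unfolding column_normal_def by blast
  obtain p m where pm: "\<And>e x r. B (e(i := x)) r = B e r + (p r * (x - e i) ^ d + m r * (x - e i))"
    using S(1) unfolding frobenius_affine_def by blast
  have "(\<exists>x. e(i := x) \<in> S) \<longleftrightarrow> B e \<in> plus_column UNIV p m A" for e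
  proof
    assume "\<exists>x. e(i := x) \<in> S"
    then obtain x where x: "B (e(i := x)) \<in> A" by (auto simp: S(3))
    have "B e = (\<lambda>r. B (e(i := x)) r + (p r * (e i - x) ^ d + m r * (e i - x)))"
      unfolding pm by (simp add: fun_eq_iff frob1 algebra_simps)
    then show "B e \<in> plus_column UNIV p m A" unfolding plus_column_def using x by blast
  next
    assume "B e \<in> plus_column UNIV p m A"
    then obtain a y where a: "a \<in> A" "B e = (\<lambda>r. a r + (p r * y ^ d + m r * y))"
      unfolding plus_column_def by blast
    have "B (e(i := e i - y)) = a"
      by (rule ext) (simp add: pm a(2) frob1 algebra_simps)
    then show "\<exists>x. e(i := x) \<in> S" using a(1) unfolding S(3) by blast
  qed
  then have "{e. \<exists>x. e(i := x) \<in> S} = {e. B e \<in> plus_column UNIV p m A}" by simp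
  then show ?case unfolding column_normal_def using S(1) column_sum.full[OF S(2)] by blast
qed

text \<open>In the normal form \<open>{e. B e \<in> A}\<close> the function \<open>B\<close> is continuous in each argument, and \<open>A\<close> is closed.\<close>

lemma pp_fibre_closed:
  assumes "pp K S" "e(i := x) \<notin> S"
  shows "\<exists>N. \<forall>y. y - x \<in> fls_ball N \<longrightarrow> e(i := y) \<notin> S"
proof (rule ccontr)
  obtain B :: "(nat \<Rightarrow> 'a fls) \<Rightarrow> nat \<Rightarrow> 'a fls" and A where S: "frobenius_affine B" "column_sum A" "S = {e. B e \<in> A}"
    using column_normal_pp[OF assms(1)] unfolding column_normal_def by blast
  obtain p m where pm: "\<And>e x r. B (e(i := x)) r = B e r + (p r * (x - e i) ^ d + m r * (x - e i))"
    using S(1) unfolding frobenius_affine_def by blast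
  assume "\<not> ?thesis"
  then have "\<forall>n::nat. \<exists>y. y - x \<in> fls_ball (int n) \<and> e(i := y) \<in> S" by blast
  then obtain y where y: "\<And>n. y n - x \<in> fls_ball (int n)" "\<And>n. e(i := y n) \<in> S" by metis
  have lim: "fls_lim y x"
    by (rule fls_complete_lim[of _ _ 0]) (use fls_ball_uminus[OF y(1)] in simp)
  have "fls_lim (\<lambda>n. B (e(i := y n)) r) (B (e(i := x)) r)" for r
  proof -
    have "fls_lim (\<lambda>n. B e r + (p r * (y n + - e i) ^ d + m r * (y n + - e i)))
        (B e r + (p r * (x + - e i) ^ d + m r * (x + - e i)))"
      by (intro fls_lim_add fls_lim_mult fls_lim_frob fls_lim_const lim)
    then show ?thesis by (simp add: pm)
  qed
  then have "B (e(i := x)) \<in> A"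
    using seq_closedD[OF seq_closed_column_sum[OF S(2)], of "\<lambda>n. B (e(i := y n))"] y(2) by (simp add: S(3))
  then show False using assms(2) by (simp add: S(3))
qed


section \<open>The henselization as a subfield of the Laurent series\<close>

lemma zero_power_d [simp]: "(0 :: 'a fls) ^ d = 0"
  using d_gt_1 by (simp add: zero_power)

abbreviation K :: "'a fls set" where
  "K \<equiv> rat_henselization"

abbreviation V :: "'a fls set" where
  "V \<equiv> fls_integers"

lemma rational_subset_K: "rational_functions \<subseteq> K"
  by (rule rat_henselization_universal(1))

lemma henselian_K: "henselian K (V \<inter> K)"
  by (rule rat_henselization_universal(2))

lemma subfield_K: "is_subfield K"
  using henselian_K by (simp add: henselian_def valued_field_def)

lemmas K_closed = subringD[OF subfieldD(1)[OF subfield_K]] subfieldD(2,3)[OF subfield_K]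

lemma sum_in_K: "(\<And>i. i \<in> I \<Longrightarrow> f i \<in> K) \<Longrightarrow> sum f I \<in> K"
  by (induction I rule: infinite_finite_induct) (auto intro: K_closed)

lemma X_in_K: "fls_X \<in> K"
  using rational_subset_K fls_X_rational by auto

lemma const_in_K: "fls_const c \<in> K"
  using subsetD[OF rational_subset_K rational_functionsI[of "[:c:]"]] by (simp add: fps_of_poly_pCons)

lemma K_dense: "\<exists>a\<in>K. x - a \<in> fls_ball N"
proof -
  define s where "s = nat (- fls_subdegree x)"
  have "fls_X ^ s * x \<in> V"
    by (cases "x = 0") (auto simp: fls_integers_subdegree s_def)
  then obtain a v where a: "a \<in> rational_functions" "v \<in> V" "fls_X ^ s * x - a = fls_X ^ (s + nat N) * v"
    using rational_approximation[of "fls_X ^ s * x" "s + nat N"] by blast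
  have X: "fls_X ^ n \<noteq> (0 :: 'a fls)" for n by simp
  have "a / fls_X ^ s \<in> K"
    by (intro K_closed(10) K_closed(8) X_in_K subsetD[OF rational_subset_K a(1)])
  moreover have "x - a / y = z" if "y * x - a = y * z" "y \<noteq> 0" for y z :: "'a fls"
    using that by (simp add: field_simps)
  from this[OF _ X] have "x - a / fls_X ^ s = fls_X ^ nat N * v" using a(3) by (simp only: power_add mult.assoc)
  moreover have "fls_X ^ nat N * v \<in> fls_ball (int (nat N) + 0)"
    using a(2) by (intro fls_ball_mult) (auto simp: fls_ball_iff fls_integers_ball)
  moreover have "N \<le> int (nat N) + 0" by simp
  ultimately have "x - a / fls_X ^ s \<in> fls_ball N" by (metis fls_ball_mono)
  then show ?thesis using \<open>a / fls_X ^ s \<in> K\<close> by blast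
qed

text \<open>The nonzero summands have different valuations, since these differ modulo \<open>d\<close>.\<close>

lemma frob_basis_unique:
  fixes a :: "nat \<Rightarrow> 'a fls"
  assumes "(\<Sum>i<d. fls_X ^ i * a i ^ d) = 0" "i < d"
  shows "a i = 0"
proof (rule ccontr)
  assume "a i \<noteq> 0"
  define I where "I = {i. i < d \<and> a i \<noteq> 0}"
  define v where "v i = int i + int d * fls_subdegree (a i)" for i
  have v: "fls_subdegree (fls_X ^ i * a i ^ d) = v i" "fls_X ^ i * a i ^ d \<noteq> 0" if "i \<in> I" for i
    using that by (simp_all add: I_def v_def fls_subdegree_pow)
  have inj: "i = j" if "i \<in> I" "j \<in> I" "v i = v j" for i j
  proof -
    have "int i = v i mod int d" using that(1) by (simp add: v_def I_def)
    also have "\<dots> = int j" unfolding that(3) using that(2) by (simp add: v_def I_def)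
    finally show ?thesis by simp
  qed
  have "finite I" "I \<noteq> {}" using \<open>a i \<noteq> 0\<close> assms(2) by (auto simp: I_def)
  then obtain m where m: "m \<in> I" "\<And>j. j \<in> I \<Longrightarrow> v m \<le> v j"
    using ex_is_arg_min_if_finite[of I v] unfolding is_arg_min_def by (meson linorder_not_less)
  have "0 = (\<Sum>i<d. fls_X ^ i * a i ^ d) $$ v m" using assms(1) by simp
  also have "\<dots> = (\<Sum>i<d. (fls_X ^ i * a i ^ d) $$ v m)" by (rule fls_nth_sum)
  also have "\<dots> = (\<Sum>i<d. if i = m then (fls_X ^ m * a m ^ d) $$ v m else 0)"
  proof (rule sum.cong[OF refl])
    fix i assume "i \<in> {..<d}"
    show "(fls_X ^ i * a i ^ d) $$ v m = (if i = m then (fls_X ^ m * a m ^ d) $$ v m else 0)"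
    proof (cases "i \<in> I \<and> i \<noteq> m")
      case True
      then have "v m < fls_subdegree (fls_X ^ i * a i ^ d)" using m inj[of i m] v by fastforce
      then have "(fls_X ^ i * a i ^ d) $$ v m = 0" by (rule fls_eq0_below_subdegree)
      then show ?thesis using True by simp
    next
      case False
      then show ?thesis using m(1) \<open>i \<in> {..<d}\<close> d_gt_1 by (auto simp: I_def)
    qed
  qed
  also have "\<dots> = (fls_X ^ m * a m ^ d) $$ v m" using m(1) by (simp add: I_def)
  also have "\<dots> \<noteq> 0" using v[OF m(1)] nth_fls_subdegree_nonzero by metis
  finally show False by simp
qed

text \<open>The elements of \<open>K\<close> that have this property form a henselian subfield containing the rational
  functions, so by minimality all elements of \<open>K\<close> have it (\<open>K_frob_expandable\<close>): the field \<open>K\<close> is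
  spanned by \<open>1, X, \<dots>, X\<^bsup>d - 1\<^esup>\<close> over its subfield of \<open>d\<close>-th powers.\<close>

definition frob_expandable :: "'a fls \<Rightarrow> bool" where
  "frob_expandable x \<longleftrightarrow> (\<exists>a. (\<forall>i. a i \<in> K) \<and> x = (\<Sum>i<d. fls_X ^ i * a i ^ d))"

lemma frob_expandable_0: "frob_expandable 0"
  unfolding frob_expandable_def using K_closed(1) by (intro exI[of _ "\<lambda>_. 0"]) (simp add: frob1)

lemma frob_expandable_diff:
  assumes "frob_expandable x" "frob_expandable y"
  shows "frob_expandable (x - y)"
proof -
  obtain a b where "\<forall>i. a i \<in> K" "x = (\<Sum>i<d. fls_X ^ i * a i ^ d)"
      "\<forall>i. b i \<in> K" "y = (\<Sum>i<d. fls_X ^ i * b i ^ d)"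
    using assms unfolding frob_expandable_def by blast
  then show ?thesis unfolding frob_expandable_def
    by (intro exI[of _ "\<lambda>i. a i - b i"]) (auto intro: K_closed simp: frob1 right_diff_distrib sum_subtractf)
qed

lemma frob_expandable_add: "frob_expandable x \<Longrightarrow> frob_expandable y \<Longrightarrow> frob_expandable (x + y)"
  using frob_expandable_diff[of x "0 - y"] frob_expandable_diff[OF frob_expandable_0] by simp

lemma frob_expandable_sum: "(\<And>i. i \<in> I \<Longrightarrow> frob_expandable (f i)) \<Longrightarrow> frob_expandable (sum f I)"
  by (induction I rule: infinite_finite_induct) (auto simp: frob_expandable_0 frob_expandable_add)

lemma frob_expandable_frob_mult:
  assumes "c \<in> K" "frob_expandable x"
  shows "frob_expandable (c ^ d * x)"
proof -
  obtain a where "\<forall>i. a i \<in> K" "x = (\<Sum>i<d. fls_X ^ i * a i ^ d)"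
    using assms(2) unfolding frob_expandable_def by blast
  then show ?thesis unfolding frob_expandable_def using assms(1)
    by (intro exI[of _ "\<lambda>i. c * a i"]) (auto intro: K_closed simp: power_mult_distrib sum_distrib_left mult_ac)
qed

lemma frob_expandable_frob:
  assumes "c \<in> K"
  shows "frob_expandable (c ^ d)"
proof -
  have "(\<Sum>i<d. fls_X ^ i * (if i = 0 then c else 0) ^ d) = (\<Sum>i<d. if i = 0 then c ^ d else 0)"
    using d_gt_1 by (intro sum.cong) auto
  then have "c ^ d = (\<Sum>i<d. fls_X ^ i * (if i = 0 then c else 0) ^ d)" using d_gt_1 by simp
  then show ?thesis unfolding frob_expandable_def using assms K_closed(1)
    by (intro exI[of _ "\<lambda>i. if i = 0 then c else 0"]) auto
qed

lemma frob_expandable_X_mult: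
  assumes "frob_expandable x"
  shows "frob_expandable (fls_X * x)"
proof -
  obtain a where a: "\<forall>i. a i \<in> K" "x = (\<Sum>i<d. fls_X ^ i * a i ^ d)"
    using assms unfolding frob_expandable_def by blast
  obtain m where m: "d = Suc m" using d_gt_1 by (cases d) auto
  define a' where "a' i = (if i = 0 then fls_X * a m else a (i - 1))" for i
  have "fls_X * x = (\<Sum>i<m. fls_X ^ Suc i * a i ^ d) + fls_X ^ d * a m ^ d"
    by (simp add: a(2) m sum_distrib_left distrib_left mult.assoc)
  also have "\<dots> = (\<Sum>i<m. fls_X ^ Suc i * a' (Suc i) ^ d) + fls_X ^ 0 * a' 0 ^ d"
    by (simp add: a'_def power_mult_distrib)
  also have "\<dots> = (\<Sum>i<d. fls_X ^ i * a' i ^ d)"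
    unfolding m by (simp only: sum.lessThan_Suc_shift add.commute)
  finally show ?thesis unfolding frob_expandable_def using a(1) X_in_K K_closed(4)
    by (intro exI[of _ a']) (auto simp: a'_def)
qed

lemma frob_expandable_mult:
  assumes "frob_expandable x" "frob_expandable y"
  shows "frob_expandable (x * y)"
proof -
  obtain a where a: "\<forall>i. a i \<in> K" "x = (\<Sum>i<d. fls_X ^ i * a i ^ d)"
    using assms unfolding frob_expandable_def by blast
  have X: "frob_expandable (fls_X ^ i * z)" if "frob_expandable z" for i z
    using that by (induction i) (auto simp: mult.assoc frob_expandable_X_mult)
  have "x * y = (\<Sum>i<d. fls_X ^ i * (a i ^ d * y))"
    by (simp add: a(2) sum_distrib_right mult.assoc)
  then show ?thesis
    using a(1) assms(2) by (auto intro!: frob_expandable_sum X frob_expandable_frob_mult)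
qed

lemma frob_expandable_inverse:
  assumes "frob_expandable x" "x \<in> K"
  shows "frob_expandable (inverse x)"
proof (cases "x = 0")
  case False
  have "frob_expandable (x ^ n)" if "n > 0" for n
    using that
  proof (induction n)
    case (Suc n)
    then show ?case using assms(1) frob_expandable_mult[OF assms(1)] by (cases "n = 0") auto
  qed simp
  then have "frob_expandable (inverse x ^ d * x ^ (d - 1))"
    using assms(2) d_gt_1 by (intro frob_expandable_frob_mult K_closed) auto
  moreover have "x ^ d = x * x ^ (d - 1)" using d_gt_1 by (simp flip: power_Suc)
  then have "inverse x ^ d * x ^ (d - 1) = inverse x"
    using False by (simp add: power_inverse)
  ultimately show ?thesis by simp
qed (simp add: frob_expandable_0)

lemma frob_expandable_poly: "frob_expandable (fps_to_fls (fps_of_poly p))"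
proof (induction p)
  case (pCons a p)
  have "frob_expandable (fls_const a)"
    using frob_expandable_frob[OF const_in_K[of a]] by (simp add: frob_const)
  moreover have "fps_to_fls (fps_of_poly (pCons a p)) = fls_const a + fls_X * fps_to_fls (fps_of_poly p)"
    by (simp add: fps_of_poly_pCons fls_times_fps_to_fls mult.commute)
  ultimately show ?case
    using pCons.IH by (simp only: frob_expandable_add frob_expandable_X_mult)
qed (simp add: frob_expandable_0)

lemma degree_0_if_mult_linear_power:
  fixes q s :: "'k::field poly"
  assumes "q * s = [:- b, 1:] ^ n" "poly q b \<noteq> 0"
  shows "degree q = 0"
  using assms(1)
proof (induction n arbitrary: s)
  case 0
  then have "q dvd 1" by (metis dvd_triv_left power_0)
  moreover from this have "q \<noteq> 0" by auto
  ultimately show ?case using is_unit_iff_degree by blast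
next
  case (Suc n)
  have "poly (q * s) b = 0" by (simp add: Suc.prems)
  then have "poly s b = 0" using assms(2) by simp
  then obtain s' where "s = [:- b, 1:] * s'" by (auto simp: poly_eq_0_iff_dvd)
  then have "[:- b, 1:] * (q * s') = [:- b, 1:] * [:- b, 1:] ^ n"
    using Suc.prems by (simp only: mult.left_commute power_Suc)
  moreover have "[:- b, 1:] \<noteq> 0" by simp
  ultimately have "q * s' = [:- b, 1:] ^ n" using mult_left_cancel by blast
  then show ?case by (rule Suc.IH)
qed

text \<open>The simple root \<open>b\<close> of \<open>f\<close> is also a root of \<open>T\<^sup>d - b\<^sup>d = (T - b)\<^sup>d\<close>, so its minimal
  polynomial over \<open>S\<close> is both separable and a power of \<open>T - b\<close>, hence linear.\<close>

lemma simple_root_of_frobenius_power: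
  assumes S: "is_subfield S" and f: "\<forall>n. coeff f n \<in> S" "poly f b = 0" "poly (pderiv f) b \<noteq> 0"
    and b: "(b :: 'a fls) ^ d \<in> S"
  shows "b \<in> S"
proof -
  note S' = subringD[OF subfieldD(1)[OF S]] subfieldD(2,3)[OF S]
  define P where "P p \<longleftrightarrow> (\<forall>n. coeff p n \<in> S)" for p
  have "f \<noteq> 0" using f(3) by auto
  then have ex: "\<exists>p. p \<noteq> 0 \<and> P p \<and> poly p b = 0" using f P_def by blast
  define m where "m = arg_min degree (\<lambda>p. p \<noteq> 0 \<and> P p \<and> poly p b = 0)"
  have m: "m \<noteq> 0" "P m" "poly m b = 0"
    and mmin: "\<And>p. p \<noteq> 0 \<Longrightarrow> P p \<Longrightarrow> poly p b = 0 \<Longrightarrow> degree m \<le> degree p"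
    using arg_min_nat_lemma[of "\<lambda>p. p \<noteq> 0 \<and> P p \<and> poly p b = 0" _ degree] ex
    unfolding m_def by blast+
  have mdvd: "\<exists>q. p = m * q" if p: "P p" "poly p b = 0" for p
  proof -
    obtain q r where qr: "P q" "P r" "p = m * q + r" "r = 0 \<or> degree r < degree m"
      using poly_div_subfield[OF S m(2)[unfolded P_def] m(1) p(1)[unfolded P_def]]
      unfolding P_def by blast
    then have "poly r b = 0" using p m by simp
    then have "r = 0" using mmin[of r] qr by fastforce
    then show ?thesis using qr by auto
  qed
  have lin: "[:- b, 1:] ^ d = monom 1 d + [:- (b ^ d):]"
  proof -
    have "([:0, 1:] + [:- b:]) ^ (CHAR('a) ^ k) = [:0, 1:] ^ (CHAR('a) ^ k) + [:- b:] ^ (CHAR('a) ^ k)"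
      by (rule freshmans_dream'[of _ k]) (simp_all add: prime_char)
    then show ?thesis by (simp add: d_def[symmetric] monom_altdef poly_const_pow frob1)
  qed
  have "P (monom 1 d + [:- (b ^ d):])"
    using S' b by (auto simp: P_def coeff_pCons split: nat.split)
  then have "P ([:- b, 1:] ^ d)" by (simp add: lin)
  then obtain s where s: "[:- b, 1:] ^ d = m * s"
    using mdvd[of "[:- b, 1:] ^ d"] d_gt_1 by (auto simp: poly_power)
  obtain g where g: "f = m * g" using mdvd[of f] f P_def by blast
  then have m': "poly (pderiv m) b \<noteq> 0" using f(3) m(3) by (auto simp: pderiv_mult)
  define e where "e = order b m"
  obtain q where q: "m = [:- b, 1:] ^ e * q" "\<not> [:- b, 1:] dvd q"
    unfolding e_def using order_decomp[OF m(1)] by blast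
  have "q * ([:- b, 1:] ^ e * s) = [:- b, 1:] ^ d"
    unfolding s by (simp only: q(1) mult.assoc mult.left_commute)
  moreover have "poly q b \<noteq> 0" using q(2) by (simp add: poly_eq_0_iff_dvd)
  ultimately have "degree q = 0" by (rule degree_0_if_mult_linear_power)
  have "e \<noteq> 0" unfolding e_def using m order_root by blast
  moreover have "\<not> e \<ge> 2"
  proof
    assume "e \<ge> 2"
    then obtain j where "e = Suc (Suc j)" by (metis Suc_le_D numeral_2_eq_2 Suc_le_mono)
    then have "m = [:- b, 1:] * ([:- b, 1:] * ([:- b, 1:] ^ j * q))"
      by (simp only: q(1) power_Suc mult.assoc)
    then have "poly (pderiv m) b = 0" by (simp only: pderiv_mult poly_add poly_mult) simp
    then show False using m' by simp
  qed
  ultimately have "e = 1" by simp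
  moreover obtain c where c: "q = [:c:]" using \<open>degree q = 0\<close> degree_eq_zeroE by blast
  ultimately have m_eq: "m = [:- b * c, c:]" using q(1) by (simp add: mult.commute)
  have "c \<noteq> 0" using m(1) m_eq by auto
  then have "b = - coeff m 0 / coeff m 1" by (simp add: m_eq)
  moreover have "- coeff m 0 / coeff m 1 \<in> S" using m(2) by (intro S'(5,10)) (auto simp: P_def)
  ultimately show ?thesis by simp
qed

text \<open>For the henselian property, a simple root \<open>b \<in> K\<close> of a polynomial over the subfield \<open>S\<close> of
  expandable elements lies in \<open>S\<close> because \<open>b\<^sup>d\<close> does.\<close>

lemma K_frob_expandable:
  assumes "x \<in> K"
  shows "frob_expandable x"
proof -
  define S where "S = {x\<in>K. frob_expandable x}"
  have "1 ^ d \<in> S" using frob_expandable_frob[OF K_closed(2)] K_closed(2) by (simp add: S_def)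
  then have S: "is_subfield S"
    by (auto simp: is_subfield_def is_subring_def S_def K_closed frob_expandable_diff
        frob_expandable_mult frob_expandable_inverse)
  have "rational_functions \<subseteq> S"
  proof
    fix x :: "'a fls" assume x: "x \<in> rational_functions"
    have "fps_to_fls (fps_of_poly p) \<in> S" for p :: "'a poly"
      using frob_expandable_poly rational_functionsI rational_subset_K by (auto simp: S_def)
    then show "x \<in> S"
      using x subfieldD(3)[OF S] unfolding rational_functions_def by auto
  qed
  moreover have "henselian S (V \<inter> S)"
    unfolding henselian_def
  proof (intro conjI valued_field_Int[OF valued_field_fls S] allI ballI impI)
    fix f a assume a: "a \<in> V \<inter> S" and f: "\<forall>n. coeff f n \<in> V \<inter> S"
      and r: "poly f a \<in> max_ideal (V \<inter> S)" "poly (pderiv f) a \<notin> max_ideal (V \<inter> S)"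
    have vS: "valued_field S (V \<inter> S)" by (rule valued_field_Int[OF valued_field_fls S])
    have SK: "S \<subseteq> K" by (auto simp: S_def)
    have f': "poly (pderiv f) a \<in> V \<inter> S"
      using a f by (intro poly_in[OF valued_fieldD(3)[OF vS]] coeff_pderiv_in[OF valued_fieldD(3)[OF vS]]) auto
    have r': "poly f a \<in> max_ideal V" "poly f a \<in> S" "poly (pderiv f) a \<notin> max_ideal V"
      using r f' by (auto simp: max_ideal_Int[OF S])
    have "\<exists>b\<in>V \<inter> K. poly f b = 0 \<and> b - a \<in> max_ideal (V \<inter> K)"
      using henselian_K[unfolded henselian_def, THEN conjunct2, rule_format, of a f] a f r' SK
      by (auto simp: max_ideal_Int[OF subfield_K])
    then obtain b where b: "b \<in> V" "b \<in> K" "poly f b = 0" "b - a \<in> max_ideal V"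
      by (auto simp: max_ideal_Int[OF subfield_K])
    have fV: "\<forall>n. coeff f n \<in> V" using f by auto
    obtain w where w: "w \<in> V" "poly (pderiv f) b = poly (pderiv f) a + (b - a) * w"
      using taylor1[OF valued_fieldD(3)[OF valued_field_fls] coeff_pderiv_in[OF valued_fieldD(3)[OF valued_field_fls] fV] b(1), of a] a
      by auto
    have "poly (pderiv f) b \<notin> max_ideal V"
      using unit_cong[OF valued_field_fls _ r'(3), of "poly (pderiv f) b"]
        max_ideal_mult[OF valued_field_fls b(4) w(1)] w(2) by simp
    then have "poly (pderiv f) b \<noteq> 0" by (auto simp: max_ideal_def fls_integers_iff)
    moreover have "b ^ d \<in> S" using b(2) frob_expandable_frob K_closed(8) by (simp add: S_def)
    ultimately have "b \<in> S" using simple_root_of_frobenius_power[OF S _ b(3)] f by auto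
    then show "\<exists>b\<in>V \<inter> S. poly f b = 0 \<and> b - a \<in> max_ideal (V \<inter> S)"
      using b a subringD(3)[OF subfieldD(1)[OF S]] by (auto simp: max_ideal_Int[OF S])
  qed
  ultimately have "K \<subseteq> S" unfolding rat_henselization_def by (rule henselization_least)
  then show ?thesis using assms by (auto simp: S_def)
qed


text \<open>Expand the coefficients in the \<open>d\<close>-basis: the relation becomes \<open>\<Sum>\<^sub>i X\<^sup>i (\<Sum>\<^sub>j c\<^sub>i\<^sub>j u\<^sub>j)\<^sup>d = 0\<close>, and all
  inner sums vanish.\<close>

lemma frob_relation_descends:
  assumes "finite J" "\<And>j. j \<in> J \<Longrightarrow> a j \<in> K" "(\<Sum>j\<in>J. a j * u j ^ d) = (0 :: 'a fls)"
  shows "\<exists>c. (\<forall>i. \<forall>j\<in>J. c i j \<in> K) \<and> (\<forall>j\<in>J. a j = (\<Sum>i<d. fls_X ^ i * c i j ^ d)) \<and>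
    (\<forall>i<d. (\<Sum>j\<in>J. c i j * u j) = 0)"
proof -
  have "\<forall>j\<in>J. \<exists>c. (\<forall>i. c i \<in> K) \<and> a j = (\<Sum>i<d. fls_X ^ i * c i ^ d)"
    using K_frob_expandable[OF assms(2)] unfolding frob_expandable_def by blast
  then obtain c where c: "\<forall>j\<in>J. (\<forall>i. c j i \<in> K) \<and> a j = (\<Sum>i<d. fls_X ^ i * c j i ^ d)"
    using bchoice[of J "\<lambda>j c. (\<forall>i. c i \<in> K) \<and> a j = (\<Sum>i<d. fls_X ^ i * c i ^ d)"] by blast
  have "0 = (\<Sum>j\<in>J. \<Sum>i<d. fls_X ^ i * (c j i * u j) ^ d)"
  proof -
    have "a j * u j ^ d = (\<Sum>i<d. fls_X ^ i * (c j i * u j) ^ d)" if "j \<in> J" for j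
    proof -
      have "a j = (\<Sum>i<d. fls_X ^ i * c j i ^ d)" using c that by blast
      then show ?thesis by (simp only: sum_distrib_right power_mult_distrib mult.assoc)
    qed
    then show ?thesis using assms(3) by simp
  qed
  also have "\<dots> = (\<Sum>i<d. fls_X ^ i * (\<Sum>j\<in>J. c j i * u j) ^ d)"
    by (subst sum.swap) (simp add: frob1 sum_distrib_left)
  finally have "(\<Sum>j\<in>J. c j i * u j) = 0" if "i < d" for i
    using frob_basis_unique[of "\<lambda>i. \<Sum>j\<in>J. c j i * u j" i] that by simp
  then show ?thesis using c by (intro exI[of _ "\<lambda>i j. c j i"]) auto
qed

text \<open>After the substitution \<open>b = a + X\<^sup>N z\<close> with \<open>a \<in> K\<close> close to \<open>b\<close> and \<open>N\<close> large, all
  nonlinear coefficients of the equation for \<open>z\<close> lie in the maximal ideal, and the henselian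
  property of \<open>K\<close> applies.\<close>

lemma separable_additive_root_in_K:
  assumes E: "\<And>n. n \<in> {1..D} \<Longrightarrow> E n \<in> K" and c: "c \<in> K"
    and b: "b + (\<Sum>n=1..D. E n * b ^ (d ^ n)) = (c :: 'a fls)"
  shows "b \<in> K"
proof -
  obtain C where C: "\<forall>n\<in>{1..D}. E n \<in> fls_ball C" using fls_in_ball_finite[of "{1..D}" E] by blast
  define N where "N = nat (1 - C)"
  obtain a where a: "a \<in> K" "b - a \<in> fls_ball (int N)" using K_dense by blast
  define G where "G n = E n * fls_X ^ (N * (d ^ n - 1))" for n
  define z where "z = (b - a) / fls_X ^ N"
  define g0 where "g0 = (a + (\<Sum>n=1..D. E n * a ^ (d ^ n)) - c) / fls_X ^ N"
  define g where "g = [:g0, 1:] + (\<Sum>n=1..D. monom (G n) (d ^ n))"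
  have X0: "fls_X ^ n \<noteq> (0 :: 'a fls)" for n by simp
  have cancel: "y * (x / y) = x" if "y \<noteq> 0" for x y :: "'a fls"
    using that by simp
  have bz: "b = a + fls_X ^ N * z" unfolding z_def cancel[OF X0] by simp
  have Xg0: "fls_X ^ N * g0 = a + (\<Sum>n=1..D. E n * a ^ (d ^ n)) - c" unfolding g0_def by (rule cancel[OF X0])
  have "b - a = fls_X ^ N * z" using bz by simp
  with a(2) have zV: "z \<in> V" by (cases "z = 0") (auto simp: fls_integers_ball fls_ball_iff)
  have GK: "G n \<in> K" if "n \<in> {1..D}" for n
    unfolding G_def using E[OF that] X_in_K by (intro K_closed)
  have Gm: "G n \<in> fls_ball 1" if "n \<in> {1..D}" for n
  proof -
    have "1 < d ^ n" using that d_gt_1 by (intro one_less_power) auto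
    then have "1 \<le> d ^ n - 1" by linarith
    then have "N * 1 \<le> N * (d ^ n - 1)" by (rule mult_le_mono2)
    moreover have "G n \<in> fls_ball (C + int (N * (d ^ n - 1)))"
      unfolding G_def using C that by (intro fls_ball_mult) (auto simp: fls_ball_iff)
    moreover have "int N \<ge> 1 - C" by (simp add: N_def)
    ultimately show ?thesis by (elim fls_ball_mono) linarith
  qed
  have eval: "poly g y = g0 + y + (\<Sum>n=1..D. G n * y ^ (d ^ n))" for y
    by (simp add: g_def poly_sum poly_monom)
  have gz: "poly g z = 0"
  proof -
    have "fls_X ^ N * (G n * z ^ (d ^ n)) = E n * (fls_X ^ N * z) ^ (d ^ n)" for n
    proof -
      have "N * d ^ n = N + N * (d ^ n - 1)" using d_gt_1 by (simp add: diff_mult_distrib2)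
      then have "(fls_X :: 'a fls) ^ N * fls_X ^ (N * (d ^ n - 1)) = (fls_X ^ N) ^ (d ^ n)"
        by (simp flip: power_add power_mult)
      then show ?thesis unfolding G_def power_mult_distrib by (metis (no_types, opaque_lifting) mult.assoc mult.left_commute)
    qed
    then have "fls_X ^ N * poly g z = (a + fls_X ^ N * z) + (\<Sum>n=1..D. E n * (a + fls_X ^ N * z) ^ (d ^ n)) - c"
      unfolding eval distrib_left sum_distrib_left frob_add Xg0 sum.distrib by simp
    then show ?thesis using b X0 by (simp flip: bz)
  qed
  have VK: "is_subring (V \<inter> K)" using henselian_K by (simp add: henselian_def valued_field_def)
  have "G n * z ^ (d ^ n) \<in> fls_ball 0" if "n \<in> {1..D}" for n
    using fls_ball_mult[OF Gm[OF that] fls_ball_power[of z 0 "d ^ n"]] zV d_gt_1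
      fls_ball_mono[of "G n * z ^ (d ^ n)" 1 0] by (simp add: fls_integers_ball)
  then have s: "(\<Sum>n=1..D. G n * z ^ (d ^ n)) \<in> fls_ball 0" by (rule fls_ball_sum)
  have "g0 + (z + (\<Sum>n=1..D. G n * z ^ (d ^ n))) = 0" using gz unfolding eval by (simp only: add.assoc)
  then have "g0 = - (z + (\<Sum>n=1..D. G n * z ^ (d ^ n)))" by (simp only: eq_neg_iff_add_eq_0)
  then have g0: "g0 \<in> V"
    using zV s by (simp only: fls_integers_ball fls_ball_add fls_ball_uminus)
  have "g0 \<in> K" unfolding g0_def
    by (intro K_closed(3,4,6,8,10) sum_in_K E a(1) c X_in_K)
  have gVK: "\<forall>n. coeff g n \<in> V \<inter> K"
  proof
    fix n
    have "(\<Sum>i=1..D. coeff (monom (G i) (d ^ i)) n) \<in> V"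
      unfolding fls_integers_ball using Gm fls_ball_mono[of _ 1 0]
      by (intro fls_ball_sum) (auto simp: fls_ball_0)
    moreover have "(\<Sum>i=1..D. coeff (monom (G i) (d ^ i)) n) \<in> K"
      using GK K_closed(1) by (intro sum_in_K) auto
    moreover have "coeff [:g0, 1:] n \<in> V \<inter> K"
      using g0 \<open>g0 \<in> K\<close> subringD(1,2)[OF VK] by (auto simp: coeff_pCons split: nat.split)
    ultimately show "coeff g n \<in> V \<inter> K"
      unfolding g_def coeff_add coeff_sum using subringD(6)[OF VK] by blast
  qed
  have "pderiv (monom (G n) (d ^ n)) = 0" if "n \<in> {1..D}" for n
  proof -
    have "CHAR('a fls) dvd d ^ n" using that k
      unfolding d_def power_mult[symmetric] by (simp add: dvd_power)
    then have "(of_nat (d ^ n) :: 'a fls) = 0" by (simp only: of_nat_eq_0_iff_char_dvd)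
    then show ?thesis by (simp only: pderiv_monom) simp
  qed
  then have "pderiv (\<Sum>n\<in>I. monom (G n) (d ^ n)) = 0" if "I \<subseteq> {1..D}" for I
    using that by (induction I rule: infinite_finite_induct) (auto simp: pderiv_add)
  then have "pderiv g = 1"
    unfolding g_def pderiv_add by (simp add: pderiv_pCons)
  then have g': "poly (pderiv g) y \<notin> max_ideal V" for y
    using one_notin_max_ideal[OF valued_field_fls] by simp
  define a0 where "a0 = fls_const (z $$ 0)"
  have a0: "a0 \<in> V \<inter> K" using const_in_K by (simp add: a0_def fls_integers_iff)
  have za0: "z - a0 \<in> max_ideal V"
    using zV a0 by (auto simp: max_ideal_fls fls_integers_iff a0_def)
  have gV: "\<forall>n. coeff g n \<in> V" and gK: "\<forall>n. coeff g n \<in> K" using gVK by auto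
  note VR = valued_fieldD(3)[OF valued_field_fls]
  obtain w where w: "w \<in> V" "poly g z = poly g a0 + (z - a0) * w"
    using taylor1[OF VR gV zV, of a0] a0 by blast
  then have "poly g a0 = - ((z - a0) * w)" using gz by (simp add: eq_neg_iff_add_eq_0)
  then have "poly g a0 \<in> max_ideal V"
    using max_ideal_uminus[OF valued_field_fls max_ideal_mult[OF valued_field_fls za0 w(1)]] by simp
  moreover have "poly g a0 \<in> K" using poly_in[OF subfieldD(1)[OF subfield_K] gK] a0 by blast
  ultimately obtain y where y: "y \<in> V \<inter> K" "poly g y = 0" "y - a0 \<in> max_ideal V"
    using henselian_K[unfolded henselian_def, THEN conjunct2, rule_format, of a0 g] a0 gVK g'
    by (auto simp: max_ideal_Int[OF subfield_K])
  have "z = y"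
    by (rule henselian_root_unique[OF valued_field_fls gV, of a0]) (use a0 zV y gz za0 g' in auto)
  then show ?thesis unfolding bz using y(1) a(1) X_in_K by (auto intro!: K_closed)
qed

text \<open>An inseparable additive relation descends to a relation of smaller degree, because \<open>K\<close> has the same
  \<open>d\<close>-basis \<open>1, X, \<dots>, X\<^bsup>d - 1\<^esup>\<close> as the field of Laurent series.\<close>

lemma additive_root_in_K:
  assumes "\<And>n. n \<le> D \<Longrightarrow> E n \<in> K" "c \<in> K" "\<exists>n\<le>D. E n \<noteq> 0"
    "(\<Sum>n\<le>D. E n * b ^ (d ^ n)) = (c :: 'a fls)"
  shows "b \<in> K"
  using assms
proof (induction D arbitrary: E c)
  case 0
  then have "E 0 * b = c" "E 0 \<noteq> 0" by simp_all
  then have "b = c / E 0" by (simp add: field_simps)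
  then show ?case using 0(1)[of 0] 0(2) K_closed(10) by simp
next
  case (Suc D)
  show ?case
  proof (cases "E 0 = 0")
    case False
    have "E 0 * b + (\<Sum>n=1..Suc D. E n * b ^ (d ^ n)) = c"
      using Suc.prems(4) by (simp add: atMost_atLeast0 sum.atLeast_Suc_atMost add.assoc)
    then have "b + (\<Sum>n=1..Suc D. E n / E 0 * b ^ (d ^ n)) = c / E 0"
      using False by (simp add: sum_divide_distrib[symmetric] field_simps del: sum.cl_ivl_Suc)
    then show ?thesis
      using Suc.prems(1,2) K_closed(10)
      by (rule_tac separable_additive_root_in_K[of "Suc D" "\<lambda>n. E n / E 0" "c / E 0"]) auto
  next
    case True
    define u where "u n = (if n = Suc D then 1 else b ^ (d ^ n))" for n
    define A where "A n = (if n = Suc D then - c else E (Suc n))" for n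
    have "(b ^ (d ^ n)) ^ d = b ^ (d ^ Suc n)" for n
      by (simp add: mult.commute flip: power_mult)
    then have "(\<Sum>n\<le>Suc D. E n * b ^ (d ^ n)) = (\<Sum>n\<le>D. E (Suc n) * (b ^ (d ^ n)) ^ d)"
      unfolding sum.atMost_Suc_shift by (simp only: True mult_zero_left add_0)
    then have "(\<Sum>n\<le>Suc D. A n * u n ^ d) = 0"
      using Suc.prems(4) by (simp add: A_def u_def)
    moreover have "A n \<in> K" if "n \<le> Suc D" for n
      using Suc.prems(1)[of "Suc n"] Suc.prems(2) K_closed(5) that by (auto simp: A_def)
    ultimately obtain C where C: "\<forall>i. \<forall>n\<in>{..Suc D}. C i n \<in> K" "\<forall>n\<in>{..Suc D}. A n = (\<Sum>i<d. fls_X ^ i * C i n ^ d)"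
        "\<forall>i<d. (\<Sum>n\<le>Suc D. C i n * u n) = 0"
      using frob_relation_descends[of "{..Suc D}" A u] by auto
    obtain n where n: "n \<le> D" "E (Suc n) \<noteq> 0"
      using Suc.prems(3) True by (metis Suc_le_mono not0_implies_Suc)
    then have "A n \<noteq> 0" "n \<in> {..Suc D}" by (auto simp: A_def)
    then obtain i where i: "i < d" "C i n \<noteq> 0"
      using C(2) d_gt_1 by (metis (no_types, lifting) lessThan_iff mult_zero_right power_0_left sum.neutral zero_less_one order_less_trans less_irrefl)
    have "(\<Sum>n\<le>D. C i n * b ^ (d ^ n)) + C i (Suc D) = 0"
      using C(3) i(1) by (simp add: u_def)
    then have "(\<Sum>n\<le>D. C i n * b ^ (d ^ n)) = - C i (Suc D)" by (simp add: eq_neg_iff_add_eq_0)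
    then show ?thesis
      using C(1) i n K_closed(5) by (rule_tac Suc.IH[of "C i" "- C i (Suc D)"]) auto
  qed
qed

end

section \<open>Specialising Laurent series to the henselization\<close>

text \<open>The henselization as a type, which makes linear algebra over it available.\<close>

typedef (overloaded) 'a rat_hens = "rat_henselization :: 'a::field fls set"
  using rat_henselization_universal(1) fls_X_rational by blast

setup_lifting type_definition_rat_hens

lemma is_subfield_rat_henselization: "is_subfield (rat_henselization :: 'a::field fls set)"
  using rat_henselization_universal(2)[where ?'a = 'a] by (simp add: henselian_def valued_field_def)

instantiation rat_hens :: (field) field
begin

context
begin

private lemmas closed = subringD[OF subfieldD(1)[OF is_subfield_rat_henselization]]
  subfieldD(2,3)[OF is_subfield_rat_henselization]

lift_definition zero_rat_hens :: "'a rat_hens" is 0 by (rule closed)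
lift_definition one_rat_hens :: "'a rat_hens" is 1 by (rule closed)
lift_definition plus_rat_hens :: "'a rat_hens \<Rightarrow> 'a rat_hens \<Rightarrow> 'a rat_hens" is "(+)" by (rule closed)
lift_definition minus_rat_hens :: "'a rat_hens \<Rightarrow> 'a rat_hens \<Rightarrow> 'a rat_hens" is "(-)" by (rule closed)
lift_definition uminus_rat_hens :: "'a rat_hens \<Rightarrow> 'a rat_hens" is uminus by (rule closed)
lift_definition times_rat_hens :: "'a rat_hens \<Rightarrow> 'a rat_hens \<Rightarrow> 'a rat_hens" is "(*)" by (rule closed)
lift_definition inverse_rat_hens :: "'a rat_hens \<Rightarrow> 'a rat_hens" is inverse by (rule closed)
lift_definition divide_rat_hens :: "'a rat_hens \<Rightarrow> 'a rat_hens \<Rightarrow> 'a rat_hens" is "(/)" by (rule closed)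

lemmas rat_hens_rep = zero_rat_hens.rep_eq one_rat_hens.rep_eq plus_rat_hens.rep_eq minus_rat_hens.rep_eq
  uminus_rat_hens.rep_eq times_rat_hens.rep_eq inverse_rat_hens.rep_eq divide_rat_hens.rep_eq

instance
  by standard (simp_all add: Rep_rat_hens_inject[symmetric] rat_hens_rep distrib_right divide_inverse)

end

end

definition hscale :: "'a::field rat_hens \<Rightarrow> 'a fls \<Rightarrow> 'a fls" where
  "hscale a x = Rep_rat_hens a * x"

interpretation hens: vector_space "hscale :: 'a::field rat_hens \<Rightarrow> _"
  by standard (simp_all add: hscale_def rat_hens_rep distrib_left distrib_right)

context finite_laurent begin

lemma hscale_Abs: "c \<in> K \<Longrightarrow> hscale (Abs_rat_hens c) x = c * x"
  by (simp add: hscale_def Abs_rat_hens_inverse)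

lemma hens_span_scale: "x \<in> hens.span B \<Longrightarrow> c \<in> K \<Longrightarrow> c * x \<in> hens.span B"
  using hens.span_scale[of x B "Abs_rat_hens c"] by (simp add: hscale_Abs)

lemma hens_span_finite:
  assumes "finite B" "x \<in> hens.span B"
  shows "\<exists>c. (\<forall>b. c b \<in> K) \<and> x = (\<Sum>b\<in>B. c b * b)"
proof -
  obtain u where "x = (\<Sum>b\<in>B. hscale (u b) b)"
    using assms hens.span_finite[of B] by blast
  then show ?thesis using Rep_rat_hens
    by (intro exI[of _ "\<lambda>b. Rep_rat_hens (u b)"]) (auto simp: hscale_def)
qed

lemma hens_independentD:
  assumes "finite B" "hens.independent B" "\<And>b. b \<in> B \<Longrightarrow> c b \<in> K" "(\<Sum>b\<in>B. c b * b) = 0" "b \<in> B"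
  shows "c b = 0"
proof -
  have "(\<Sum>b\<in>B. hscale (Abs_rat_hens (c b)) b) = 0"
    using assms by (simp add: hscale_Abs)
  then have "Abs_rat_hens (c b) = 0"
    using hens.independentD[OF assms(2,1) order_refl, of "\<lambda>b. Abs_rat_hens (c b)" b] assms(5) by simp
  then have "Rep_rat_hens (Abs_rat_hens (c b)) = 0" by (simp add: zero_rat_hens.rep_eq)
  then show ?thesis using assms(3)[OF assms(5)] by (simp add: Abs_rat_hens_inverse)
qed

text \<open>This expresses that the field of Laurent series is a separable extension of \<open>K\<close>.\<close>

lemma hens_independent_frob:
  assumes "finite B" "hens.independent B" "\<And>b. b \<in> B \<Longrightarrow> c b \<in> K" "(\<Sum>b\<in>B. c b * b ^ d) = 0" "b \<in> B"
  shows "c b = 0"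
proof -
  obtain C where C: "\<forall>i. \<forall>b\<in>B. C i b \<in> K" "\<forall>b\<in>B. c b = (\<Sum>i<d. fls_X ^ i * C i b ^ d)"
      "\<forall>i<d. (\<Sum>b\<in>B. C i b * b) = 0"
    using frob_relation_descends[of B c "\<lambda>b. b"] assms by blast
  have "C i b = 0" if "i < d" for i
    using hens_independentD[OF assms(1,2), of "C i" b] C assms(5) that by blast
  then show ?thesis using C(2) assms(5) by simp
qed

lemma hens_span_frob:
  fixes B :: "'a fls set"
  assumes "finite B" "x \<in> hens.span B"
  shows "x ^ (d ^ n) \<in> hens.span ((\<lambda>b. b ^ (d ^ n)) ` B)"
proof -
  obtain c where c: "\<forall>b. c b \<in> K" "x = (\<Sum>b\<in>B. c b * b)" using hens_span_finite[OF assms] by blast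
  then show ?thesis
    unfolding c(2) frob_sum power_mult_distrib
    by (intro hens.span_sum hens_span_scale hens.span_base) (auto intro: K_closed(8))
qed

text \<open>The powers \<open>u\<^sub>i\<^bsup>d^n\<^esup>\<close> with \<open>n \<le> m\<close> all lie in the span of \<open>1\<close> and the \<open>u\<^sub>j\<^bsup>d^m\<^esup>\<close>, so for
  large \<open>m\<close> there is an additive relation between them.\<close>

lemma frobenius_system_in_K:
  assumes J: "finite J" and c: "\<And>i. i \<in> J \<Longrightarrow> c i \<in> K" and P: "\<And>i j. i \<in> J \<Longrightarrow> j \<in> J \<Longrightarrow> P i j \<in> K"
    and u: "\<And>i. i \<in> J \<Longrightarrow> u i = c i + (\<Sum>j\<in>J. P i j * u j ^ d)" and i: "i \<in> J"
  shows "u i \<in> K"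
proof -
  define B where "B m = insert 1 ((\<lambda>j. u j ^ (d ^ m)) ` J)" for m
  have step: "u j ^ (d ^ m) \<in> hens.span (B (Suc m))" if "j \<in> J" for j m
  proof -
    have "u j ^ (d ^ m) = c j ^ (d ^ m) * 1 + (\<Sum>l\<in>J. P j l ^ (d ^ m) * u l ^ (d ^ Suc m))"
      by (subst u[OF that]) (simp add: frob_add frob_sum power_mult_distrib flip: power_mult)
    also have "\<dots> \<in> hens.span (B (Suc m))"
      using c[OF that] P[OF that]
      by (intro hens.span_add hens.span_sum hens_span_scale hens.span_base K_closed(8)) (auto simp: B_def)
    finally show ?thesis .
  qed
  have mono: "hens.span (B m) \<subseteq> hens.span (B (m + n))" for m n
  proof (induction n)
    case (Suc n)
    have "B (m + n) \<subseteq> hens.span (B (m + Suc n))"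
      using step[of _ "m + n"] hens.span_base[of 1 "B (m + Suc n)"] by (auto simp: B_def)
    then show ?case using Suc hens.span_mono hens.span_span by blast
  qed simp
  define m where "m = Suc (card J)"
  define b where "b = u i"
  have pow: "b ^ (d ^ n) \<in> hens.span (B m)" if "n \<le> m" for n
  proof -
    have "b ^ (d ^ n) \<in> B n" using i by (auto simp: B_def b_def)
    then show ?thesis using mono[of n "m - n"] hens.span_base[of "b ^ (d ^ n)" "B n"] that by auto
  qed
  show ?thesis
  proof (cases "inj_on (\<lambda>n. b ^ (d ^ n)) {..m}")
    case True
    let ?S = "(\<lambda>n. b ^ (d ^ n)) ` {..m}"
    have "card ?S = Suc m" using card_image[OF True] by simp
    moreover have fin: "finite (B m)" using J by (simp add: B_def)
    moreover have "card (B m) \<le> Suc (card J)"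
      unfolding B_def by (rule order_trans[OF card_insert_le_m1]) (auto intro: card_image_le J)
    moreover have "?S \<subseteq> hens.span (B m)" using pow by blast
    ultimately have "hens.dependent ?S" using hens.independent_span_bound[OF fin, of ?S] by (auto simp: m_def)
    then obtain e where e: "\<exists>x\<in>?S. e x \<noteq> 0" "(\<Sum>x\<in>?S. hscale (e x) x) = 0"
      using hens.dependent_finite[of ?S] by auto
    define E where "E n = Rep_rat_hens (e (b ^ (d ^ n)))" for n
    have "(\<Sum>n\<le>m. E n * b ^ (d ^ n)) = 0"
      using e(2) unfolding sum.reindex[OF True] by (simp add: E_def hscale_def)
    moreover have "\<exists>n\<le>m. E n \<noteq> 0"
      using e(1) by (auto simp: E_def) (metis Rep_rat_hens_inject zero_rat_hens.rep_eq)
    moreover have "E n \<in> K" for n unfolding E_def by (rule Rep_rat_hens)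
    ultimately show ?thesis
      unfolding b_def[symmetric] using K_closed(1) by (rule_tac additive_root_in_K[of m E 0]) auto
  next
    case False
    then obtain n n' where n: "n \<le> m" "n' \<le> m" "n \<noteq> n'" "b ^ (d ^ n) = b ^ (d ^ n')"
      by (auto simp: inj_on_def)
    define E where "E l = (if l = n then 1 else if l = n' then - 1 else 0 :: 'a fls)" for l
    have "(\<Sum>l\<le>m. E l * b ^ (d ^ l)) =
        (\<Sum>l\<le>m. (if l = n then b ^ (d ^ n) else 0) - (if l = n' then b ^ (d ^ n') else 0))"
      using n(3) by (intro sum.cong) (auto simp: E_def)
    then have "(\<Sum>l\<le>m. E l * b ^ (d ^ l)) = 0" using n by (simp add: sum_subtractf)
    moreover have "E l \<in> K" for l using K_closed(1,2) K_closed(5)[OF K_closed(2)] by (simp add: E_def)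
    moreover have "\<exists>l\<le>m. E l \<noteq> 0" using n(1) by (intro exI[of _ n]) (simp add: E_def)
    ultimately show ?thesis
      unfolding b_def[symmetric] using K_closed(1) by (rule_tac additive_root_in_K[of m E 0]) auto
  qed
qed

text \<open>On \<open>fls_ball M\<close> the right-hand side is a contraction, since \<open>d \<ge> 2\<close> and \<open>M\<close> is large compared to the
  coefficients.\<close>

lemma frobenius_system_solvable:
  assumes J: "finite J" and P: "\<And>i j. i \<in> J \<Longrightarrow> j \<in> J \<Longrightarrow> P i j \<in> fls_ball C"
    and M: "M \<ge> 1" "M \<ge> 1 - C" and q: "\<And>i. i \<in> J \<Longrightarrow> q i \<in> fls_ball M"
  shows "\<exists>v. \<forall>i\<in>J. v i \<in> fls_ball M \<and> v i = q i + (\<Sum>j\<in>J. P i j * v j ^ d :: 'a fls)"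
proof -
  define T where "T v i = q i + (\<Sum>j\<in>J. P i j * v j ^ d)" for v i
  define v where "v n = (T ^^ n) (\<lambda>_. 0)" for n
  have v_Suc: "v (Suc n) i = q i + (\<Sum>j\<in>J. P i j * v n j ^ d)" for n i
    by (simp add: v_def T_def)
  have cauchy: "v (Suc n) i - v n i \<in> fls_ball (M + int n)" if "i \<in> J" for i n
    using that
  proof (induction n arbitrary: i)
    case 0
    then show ?case using q[of i] d_gt_1 by (simp add: v_def T_def)
  next
    case (Suc n)
    have "v (Suc (Suc n)) i - v (Suc n) i = (\<Sum>j\<in>J. P i j * (v (Suc n) j - v n j) ^ d)"
      unfolding v_Suc[of "Suc n"] v_Suc[of n i]
      by (simp add: frob1 right_diff_distrib sum_subtractf del: power_Suc)
    also have "\<dots> \<in> fls_ball (M + int (Suc n))"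
    proof (rule fls_ball_sum)
      fix j assume j: "j \<in> J"
      have "2 * (M + int n) \<le> int d * (M + int n)" using d_gt_1 M by (intro mult_right_mono) auto
      then have "M + int (Suc n) \<le> C + int d * (M + int n)" using M by simp
      moreover have "P i j * (v (Suc n) j - v n j) ^ d \<in> fls_ball (C + int d * (M + int n))"
        using P Suc j d_gt_1 by (intro fls_ball_mult fls_ball_power) auto
      ultimately show "P i j * (v (Suc n) j - v n j) ^ d \<in> fls_ball (M + int (Suc n))"
        by (rule fls_ball_mono[rotated])
    qed
    finally show ?case .
  qed
  have "\<forall>i\<in>J. \<exists>x. \<forall>n. x - v n i \<in> fls_ball (M + int n)"
    using fls_complete[of "\<lambda>n. v n _"] cauchy by blast
  then obtain w where w: "\<And>i n. i \<in> J \<Longrightarrow> w i - v n i \<in> fls_ball (M + int n)" by metis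
  have lim: "fls_lim (\<lambda>n. v n i) (w i)" if "i \<in> J" for i
    by (rule fls_complete_lim[OF w[OF that]])
  have "w i \<in> fls_ball M \<and> w i = q i + (\<Sum>j\<in>J. P i j * w j ^ d)" if i: "i \<in> J" for i
  proof
    show "w i \<in> fls_ball M" using w[OF i, of 0] by (simp add: v_def)
    have "fls_lim (\<lambda>n. v (Suc n) i) (q i + (\<Sum>j\<in>J. P i j * w j ^ d))"
      unfolding v_Suc by (intro fls_lim_add fls_lim_const fls_lim_sum fls_lim_mult fls_lim_frob lim)
    moreover have "fls_lim (\<lambda>n. v (Suc n) i) (w i)"
      using fls_lim_subseq[OF lim[OF i], of Suc] by (simp add: strict_mono_Suc_iff)
    ultimately show "w i = q i + (\<Sum>j\<in>J. P i j * w j ^ d)" by (rule fls_lim_unique[rotated])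
  qed
  then show ?thesis by blast
qed


text \<open>Every element of \<open>B1\<close> is a combination of \<open>d\<close>-th powers of the basis \<open>B2\<close>, and \<open>B1\<close> spans all the
  elements of the span of \<open>B2\<close> that are such combinations; so all relations between the basis elements and
  their \<open>d\<close>-th powers follow from one relation for each element of \<open>B1\<close>.\<close>

lemma adapted_basis:
  fixes Z :: "'a fls set"
  assumes Z: "finite Z"
  obtains B1 B2 P where "finite B2" "B1 \<subseteq> B2" "1 \<in> B1" "hens.independent B2" "Z \<subseteq> hens.span B2"
    "\<And>w b. w \<in> B1 \<Longrightarrow> P w b \<in> K" "\<And>w. w \<in> B1 \<Longrightarrow> w = (\<Sum>b\<in>B2. P w b * b ^ d)"
    "\<And>u. u \<in> hens.span B2 \<Longrightarrow> u ^ d \<in> hens.span B2 \<Longrightarrow> u ^ d \<in> hens.span B1"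
proof -
  define U where "U = hens.span (insert 1 Z)"
  define E where "E = U \<inter> hens.span ((\<lambda>u. u ^ d) ` U)"
  have U1: "1 \<in> U" unfolding U_def by (intro hens.span_base) simp
  have "1 \<in> E" unfolding E_def using U1 by (auto intro!: hens.span_base image_eqI[of _ _ 1])
  moreover have ind1: "hens.independent {1}" by (simp add: hens.dependent_single)
  ultimately obtain B1 where B1: "{1} \<subseteq> B1" "B1 \<subseteq> E" "hens.independent B1" "E \<subseteq> hens.span B1"
    using hens.maximal_independent_subset_extend[of "{1}" E] by auto
  have "B1 \<subseteq> U" using B1(2) by (auto simp: E_def)
  then obtain B2 where B2: "B1 \<subseteq> B2" "B2 \<subseteq> U" "hens.independent B2" "U \<subseteq> hens.span B2"
    using hens.maximal_independent_subset_extend[OF _ B1(3), of U] by metis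
  have fin: "finite B2"
    using hens.independent_span_bound[OF _ B2(3), of "insert 1 Z"] Z B2(2) by (simp add: U_def)
  have spanB2: "hens.span B2 \<subseteq> U"
    unfolding U_def by (rule hens.span_minimal) (use B2(2) in \<open>simp_all add: U_def\<close>)
  have "\<exists>P. (\<forall>b. P b \<in> K) \<and> w = (\<Sum>b\<in>B2. P b * b ^ d)" if w: "w \<in> B1" for w
  proof -
    have "(\<lambda>u. u ^ d) ` U \<subseteq> hens.span ((\<lambda>b. b ^ d) ` B2)"
      using hens_span_frob[OF fin, of _ 1] B2(4) by auto
    then have "w \<in> hens.span ((\<lambda>b. b ^ d) ` B2)"
      using w B1(2) hens.span_minimal[of "(\<lambda>u. u ^ d) ` U" "hens.span ((\<lambda>b. b ^ d) ` B2)"]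
      by (auto simp: E_def)
    then obtain c where c: "\<forall>b. c b \<in> K" "w = (\<Sum>b\<in>(\<lambda>b. b ^ d) ` B2. c b * b)"
      using hens_span_finite[of "(\<lambda>b. b ^ d) ` B2" w] fin by blast
    have "inj_on (\<lambda>b::'a fls. b ^ d) B2"
    proof (rule inj_onI)
      fix x y :: "'a fls" assume "x ^ d = y ^ d"
      then have "(x - y) ^ d = 0" by (simp add: frob1)
      then show "x = y" using d_gt_1 by simp
    qed
    then have "w = (\<Sum>b\<in>B2. c (b ^ d) * b ^ d)" using c(2) by (simp add: sum.reindex)
    then show ?thesis using c(1) by (intro exI[of _ "\<lambda>b. c (b ^ d)"]) simp
  qed
  then obtain P where P: "\<forall>w\<in>B1. (\<forall>b. P w b \<in> K) \<and> w = (\<Sum>b\<in>B2. P w b * b ^ d)"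
    using bchoice[of B1 "\<lambda>w P. (\<forall>b. P b \<in> K) \<and> w = (\<Sum>b\<in>B2. P b * b ^ d)"] by blast
  show thesis
  proof (rule that[of B2 B1 P])
    show "u ^ d \<in> hens.span B1" if "u \<in> hens.span B2" "u ^ d \<in> hens.span B2" for u
    proof -
      have "u ^ d \<in> hens.span ((\<lambda>u. u ^ d) ` U)" using that(1) spanB2 by (intro hens.span_base) auto
      then show ?thesis using that(2) spanB2 B1(4) by (auto simp: E_def)
    qed
    show "Z \<subseteq> hens.span B2"
      using B2(4) hens.span_superset[of "insert 1 Z"] by (auto simp: U_def)
  qed (use P fin B2 B1(1) in auto)
qed

text \<open>Take a basis as in \<open>adapted_basis\<close>. The map \<open>\<eta>\<close> is the \<open>K\<close>-linear map that fixes \<open>1\<close>, sends the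
  basis elements outside \<open>B1\<close> to nearby elements of \<open>K\<close>, and sends the elements of \<open>B1\<close> to the
  corresponding solution of their relations. This solution is a small perturbation of the given one
  by \<open>frobenius_system_solvable\<close> and lies in \<open>K\<close> by \<open>frobenius_system_in_K\<close>.\<close>

lemma specialization:
  fixes Z :: "'a fls set"
  assumes Z: "finite Z"
  shows "\<exists>\<eta>. (\<forall>x. \<eta> x \<in> K) \<and> (\<forall>x\<in>K. \<eta> x = x) \<and> (\<forall>u\<in>Z. \<forall>v\<in>Z. \<eta> (u + v) = \<eta> u + \<eta> v) \<and>
    (\<forall>a\<in>K. \<forall>u\<in>Z. \<eta> (a * u) = a * \<eta> u) \<and> (\<forall>u\<in>Z. u ^ d \<in> Z \<longrightarrow> \<eta> (u ^ d) = \<eta> u ^ d) \<and>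
    (\<forall>u\<in>Z. \<eta> u - u \<in> fls_ball N)"
proof -
  obtain B1 B2 P where fin: "finite B2" and B: "B1 \<subseteq> B2" "1 \<in> B1" and ind: "hens.independent B2"
    and ZB: "Z \<subseteq> hens.span B2" and PK: "\<And>w b. w \<in> B1 \<Longrightarrow> P w b \<in> K"
    and P: "\<And>w. w \<in> B1 \<Longrightarrow> w = (\<Sum>b\<in>B2. P w b * b ^ d)"
    and frob_span: "\<And>u. u \<in> hens.span B2 \<Longrightarrow> u ^ d \<in> hens.span B2 \<Longrightarrow> u ^ d \<in> hens.span B1"
    by (rule adapted_basis[OF Z]) (rule that)
  have fin1: "finite B1" using fin B(1) finite_subset by blast
  define J where "J = B1 - {1}"
  define Fr where "Fr = B2 - B1"
  have J: "finite J" using fin1 by (simp add: J_def)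
  have split: "(\<Sum>b\<in>B2. g b) = g 1 + (\<Sum>b\<in>J. g b) + (\<Sum>b\<in>Fr. g b)" for g :: "'a fls \<Rightarrow> 'a fls"
    using sum.subset_diff[OF B(1) fin, of g] sum.remove[OF fin1 B(2), of g]
    by (simp add: J_def Fr_def algebra_simps)
  define coef where "coef x b = Rep_rat_hens (hens.representation B2 x b)" for x b
  have coefK: "coef x b \<in> K" for x b unfolding coef_def by (rule Rep_rat_hens)
  have coef_sum: "(\<Sum>b\<in>B2. coef x b * b) = x" if "x \<in> hens.span B2" for x
    using hens.sum_representation_eq[OF ind that fin order_refl] by (simp add: coef_def hscale_def)
  obtain C where C: "\<forall>(w, b)\<in>B1 \<times> B2. P w b \<in> fls_ball C"
    using fls_in_ball_finite[of "B1 \<times> B2" "\<lambda>(w, b). P w b"] fin1 fin by auto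
  obtain C' where C': "\<forall>(u, b)\<in>Z \<times> B2. coef u b \<in> fls_ball C'"
    using fls_in_ball_finite[of "Z \<times> B2" "\<lambda>(u, b). coef u b"] Z fin by auto
  define M where "M = max (max 1 (1 - C)) (N - C')"
  have M: "M \<ge> 1" "M \<ge> 1 - C" "M \<ge> N - C'" by (auto simp: M_def)
  \<comment> \<open>the basis elements outside \<open>B1\<close> are free: replace them by any elements of \<open>K\<close> close to them\<close>
  have "\<forall>b. \<exists>a\<in>K. b - a \<in> fls_ball M" using K_dense by blast
  then obtain g where g: "\<And>b. g b \<in> K" "\<And>b. b - g b \<in> fls_ball M" by metis
  define q where "q w = (\<Sum>b\<in>Fr. P w b * (g b - b) ^ d)" for w
  have qM: "q w \<in> fls_ball M" if w: "w \<in> J" for w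
    unfolding q_def
  proof (rule fls_ball_sum)
    fix b assume b: "b \<in> Fr"
    have "g b - b \<in> fls_ball M" using fls_ball_uminus[OF g(2)[of b]] by simp
    then have "P w b * (g b - b) ^ d \<in> fls_ball (C + int d * M)"
      using C w b d_gt_1 by (intro fls_ball_mult fls_ball_power) (auto simp: J_def Fr_def)
    moreover have "2 * M \<le> int d * M" using d_gt_1 M by (intro mult_right_mono) auto
    then have "M \<le> C + int d * M" using M by linarith
    ultimately show "P w b * (g b - b) ^ d \<in> fls_ball M" by (rule fls_ball_mono)
  qed
  have "P w b \<in> fls_ball C" if "w \<in> J" "b \<in> J" for w b
    using C that B by (auto simp: J_def)
  then obtain v where v: "\<And>w. w \<in> J \<Longrightarrow> v w \<in> fls_ball M" "\<And>w. w \<in> J \<Longrightarrow> v w = q w + (\<Sum>j\<in>J. P w j * v j ^ d)"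
    using frobenius_system_solvable[OF J, of P C M q] M(1,2) qM by blast
  define f where "f b = (if b = 1 then 1 else if b \<in> J then b + v b else g b)" for b
  have f1: "f 1 = 1" and fFr: "b \<in> Fr \<Longrightarrow> f b = g b" and fJ: "b \<in> J \<Longrightarrow> f b = b + v b" for b
    using B by (auto simp: f_def J_def Fr_def)
  have f_sum: "f w = (\<Sum>b\<in>B2. P w b * f b ^ d)" if w: "w \<in> J" for w
  proof -
    have "(\<Sum>b\<in>B2. P w b * f b ^ d) = (\<Sum>b\<in>B2. P w b * b ^ d) + (\<Sum>b\<in>B2. P w b * (f b - b) ^ d)"
      by (simp add: frob1 sum_subtractf right_diff_distrib)
    also have "(\<Sum>b\<in>B2. P w b * b ^ d) = w" using P[of w] w by (simp add: J_def)
    also have "(\<Sum>b\<in>B2. P w b * (f b - b) ^ d) = v w"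
      unfolding split using w by (simp add: f1 fJ fFr v(2)[OF w] q_def)
    finally show ?thesis using fJ[OF w] by simp
  qed
  have fK: "f w \<in> K" if "w \<in> J" for w
  proof (rule frobenius_system_in_K[OF J _ _ _ that, where c = "\<lambda>w. P w 1 + (\<Sum>b\<in>Fr. P w b * g b ^ d)" and P = P])
    show "P w 1 + (\<Sum>b\<in>Fr. P w b * g b ^ d) \<in> K" if "w \<in> J" for w
      using PK[of w] that g(1) by (intro K_closed(4,6,8) sum_in_K) (auto simp: J_def)
    show "P i j \<in> K" if "i \<in> J" for i j using PK that by (simp add: J_def)
    show "f i = P i 1 + (\<Sum>b\<in>Fr. P i b * g b ^ d) + (\<Sum>j\<in>J. P i j * f j ^ d)" if "i \<in> J" for i
      using f_sum[OF that] unfolding split by (simp add: f1 fFr algebra_simps)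
  qed
  have f_in: "f b \<in> K" for b
  proof (cases "b \<in> J")
    case False
    then show ?thesis using g(1) K_closed(2) by (simp add: f_def)
  qed (rule fK)
  have f_near: "f b - b \<in> fls_ball M" if "b \<in> B2" for b
    using that v(1) fls_ball_uminus[OF g(2)[of b]] B
    by (auto simp: f_def J_def fls_ball_0)
  have f_B1: "f w = (\<Sum>b\<in>B2. P w b * f b ^ d)" if "w \<in> B1" for w
  proof (cases "w = 1")
    case True
    define \<delta> where "\<delta> b = P 1 b - (if b = 1 then 1 else 0)" for b
    have "(\<Sum>b\<in>B2. (if b = 1 then 1 else 0) * b ^ d) = (\<Sum>b\<in>B2. if b = 1 then 1 else (0 :: 'a fls))"
      by (intro sum.cong) auto
    then have "(\<Sum>b\<in>B2. \<delta> b * b ^ d) = 0"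
      using P[OF B(2)] fin B by (auto simp: \<delta>_def left_diff_distrib sum_subtractf)
    moreover have "\<delta> b \<in> K" for b using PK[OF B(2)] K_closed(1,2) by (auto simp: \<delta>_def intro!: K_closed(3))
    ultimately have "P 1 b = (if b = 1 then 1 else 0)" if "b \<in> B2" for b
      using hens_independent_frob[OF fin ind, of \<delta> b] that by (simp add: \<delta>_def split: if_splits)
    then have "(\<Sum>b\<in>B2. P 1 b * f b ^ d) = (\<Sum>b\<in>B2. if b = 1 then 1 else 0)"
      by (intro sum.cong) (auto simp: f1)
    also have "\<dots> = f 1" using fin B by (simp add: f1 subset_iff)
    finally show ?thesis by (simp add: True)
  next
    case False
    then show ?thesis using f_sum that by (simp add: J_def)
  qed
  define \<eta> where "\<eta> x = (\<Sum>b\<in>B2. coef x b * f b)" for x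
  have \<eta>_comb: "\<eta> (\<Sum>b\<in>B2. c b * b) = (\<Sum>b\<in>B2. c b * f b)" if c: "\<And>b. b \<in> B2 \<Longrightarrow> c b \<in> K" for c
  proof -
    let ?x = "\<Sum>b\<in>B2. c b * b"
    have "?x \<in> hens.span B2" using c by (intro hens.span_sum hens_span_scale hens.span_base)
    then have "(\<Sum>b\<in>B2. (coef ?x b - c b) * b) = 0"
      by (simp add: left_diff_distrib sum_subtractf coef_sum)
    then have "coef ?x b - c b = 0" if "b \<in> B2" for b
      using hens_independentD[OF fin ind, of "\<lambda>b. coef ?x b - c b" b] c that coefK K_closed(3) by simp
    then show ?thesis unfolding \<eta>_def by (intro sum.cong) auto
  qed
  have one: "1 \<in> B2" using B by blast
  have \<eta>_scale: "\<eta> (a * u) = a * \<eta> u" if "u \<in> hens.span B2" "a \<in> K" for a u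
  proof -
    have "a * u = (\<Sum>b\<in>B2. (a * coef u b) * b)"
      using coef_sum[OF that(1)] by (simp add: mult.assoc flip: sum_distrib_left)
    then show ?thesis using \<eta>_comb[of "\<lambda>b. a * coef u b"] that(2) coefK K_closed(4)
      by (simp add: \<eta>_def sum_distrib_left mult.assoc)
  qed
  have \<eta>_add: "\<eta> (u + v) = \<eta> u + \<eta> v" if "u \<in> hens.span B2" "v \<in> hens.span B2" for u v
  proof -
    have "u + v = (\<Sum>b\<in>B2. (coef u b + coef v b) * b)"
      using coef_sum that by (simp add: distrib_right sum.distrib)
    then show ?thesis using \<eta>_comb[of "\<lambda>b. coef u b + coef v b"] coefK K_closed(6)
      by (simp add: \<eta>_def distrib_right sum.distrib)
  qed
  have \<eta>_K: "\<eta> x = x" if "x \<in> K" for x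
  proof -
    have "(\<Sum>b\<in>B2. (if b = 1 then x else 0) * h b) = x * h 1" for h :: "'a fls \<Rightarrow> 'a fls"
    proof -
      have "(\<Sum>b\<in>B2. (if b = 1 then x else 0) * h b) = (\<Sum>b\<in>B2. if b = 1 then x * h 1 else 0)"
        by (intro sum.cong) auto
      then show ?thesis using fin one by simp
    qed
    from this[of "\<lambda>b. b"] this[of f] show ?thesis
      using \<eta>_comb[of "\<lambda>b. if b = 1 then x else 0"] that K_closed(1) f1 by simp
  qed
  have \<eta>_frob: "\<eta> (u ^ d) = \<eta> u ^ d" if u: "u \<in> hens.span B2" "u ^ d \<in> hens.span B2" for u
  proof -
    obtain e where e: "\<And>w. e w \<in> K" "u ^ d = (\<Sum>w\<in>B1. e w * w)"
      using hens_span_finite[OF fin1 frob_span[OF u]] by blast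
    have "u ^ d = (\<Sum>b\<in>B2. (if b \<in> B1 then e b else 0) * b)"
      unfolding e(2) using fin B(1) by (intro sum.mono_neutral_cong_left) auto
    then have "\<eta> (u ^ d) = (\<Sum>b\<in>B2. (if b \<in> B1 then e b else 0) * f b)"
      using \<eta>_comb[of "\<lambda>b. if b \<in> B1 then e b else 0"] e(1) K_closed(1) by simp
    also have "\<dots> = (\<Sum>w\<in>B1. e w * f w)"
      using fin B(1) by (intro sum.mono_neutral_cong_right) auto
    also have "\<dots> = (\<Sum>b\<in>B2. (\<Sum>w\<in>B1. e w * P w b) * f b ^ d)"
      unfolding sum_distrib_right by (subst sum.swap) (simp add: f_B1 sum_distrib_left mult.assoc)
    also have "\<dots> = (\<Sum>b\<in>B2. coef u b ^ d * f b ^ d)"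
    proof (intro sum.cong refl)
      fix b assume b: "b \<in> B2"
      define \<delta> where "\<delta> b = coef u b ^ d - (\<Sum>w\<in>B1. e w * P w b)" for b
      have "u ^ d = (\<Sum>b\<in>B2. coef u b ^ d * b ^ d)"
        by (subst coef_sum[OF u(1), symmetric]) (simp only: frob1 power_mult_distrib)
      moreover have "u ^ d = (\<Sum>w\<in>B1. e w * (\<Sum>b\<in>B2. P w b * b ^ d))"
        unfolding e(2) using P by (intro sum.cong) auto
      then have "u ^ d = (\<Sum>b\<in>B2. (\<Sum>w\<in>B1. e w * P w b) * b ^ d)"
        unfolding sum_distrib_right by (subst sum.swap) (simp add: sum_distrib_left mult.assoc)
      ultimately have "(\<Sum>b\<in>B2. \<delta> b * b ^ d) = 0"
        by (simp add: \<delta>_def left_diff_distrib sum_subtractf)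
      moreover have "\<delta> b \<in> K" for b
        unfolding \<delta>_def using coefK e(1) PK by (intro K_closed(3,4,8) sum_in_K)
      ultimately have "\<delta> b = 0" using hens_independent_frob[OF fin ind, of \<delta> b] b by blast
      then show "(\<Sum>w\<in>B1. e w * P w b) * f b ^ d = coef u b ^ d * f b ^ d" by (simp add: \<delta>_def)
    qed
    also have "\<dots> = \<eta> u ^ d" by (simp add: \<eta>_def frob1 power_mult_distrib)
    finally show ?thesis .
  qed
  have \<eta>_near: "\<eta> u - u \<in> fls_ball N" if "u \<in> Z" for u
  proof -
    have "\<eta> u - u = (\<Sum>b\<in>B2. coef u b * (f b - b))"
      using coef_sum[of u] that ZB by (auto simp: \<eta>_def right_diff_distrib sum_subtractf)
    also have "\<dots> \<in> fls_ball N"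
    proof (rule fls_ball_sum)
      fix b assume "b \<in> B2"
      then have "coef u b * (f b - b) \<in> fls_ball (C' + M)"
        using C' that f_near by (intro fls_ball_mult) auto
      then show "coef u b * (f b - b) \<in> fls_ball N" by (rule fls_ball_mono) (use M in simp)
    qed
    finally show ?thesis .
  qed
  show ?thesis
  proof (intro exI[of _ \<eta>] conjI allI ballI impI)
    show "\<eta> x \<in> K" for x unfolding \<eta>_def using coefK f_in by (intro sum_in_K K_closed(4))
  qed (use \<eta>_K \<eta>_add \<eta>_scale \<eta>_frob \<eta>_near subsetD[OF ZB] in simp_all)
qed

end

lemma finite_term_vars: "finite (term_vars u)"
  by (induction u) auto

lemma eval_term_cong: "(\<And>i. i \<in> term_vars u \<Longrightarrow> e i = f i) \<Longrightarrow> eval_term M e u = eval_term M f u"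
  by (induction u) auto

lemma eval_term_upd: "m \<notin> term_vars u \<Longrightarrow> eval_term M (e(m := x)) u = eval_term M e u"
  by (rule eval_term_cong) auto

context finite_laurent begin

section \<open>Density of the rational points of positive primitive sets\<close>

text \<open>What \<open>specialization\<close> yields on the finite set \<open>Z\<close>; a larger \<open>Z\<close> gives a stronger condition.\<close>

definition specializes :: "('a fls \<Rightarrow> 'a fls) \<Rightarrow> 'a fls set \<Rightarrow> bool" where
  "specializes \<eta> Z \<longleftrightarrow> (\<forall>u\<in>Z. \<forall>v\<in>Z. \<eta> (u + v) = \<eta> u + \<eta> v) \<and> (\<forall>a\<in>K. \<forall>u\<in>Z. \<eta> (a * u) = a * \<eta> u) \<and>
    (\<forall>u\<in>Z. u ^ d \<in> Z \<longrightarrow> \<eta> (u ^ d) = \<eta> u ^ d) \<and> (\<forall>u\<in>Z. \<eta> u - u \<in> V)"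

lemma specializes_mono: "specializes \<eta> Z \<Longrightarrow> Y \<subseteq> Z \<Longrightarrow> specializes \<eta> Y"
  by (simp add: specializes_def subset_iff)

text \<open>The atomic conditions are preserved by definition, and a witness for an existential quantifier is mapped
  to a witness. This uses \<open>\<eta>\<close> at finitely many elements only.\<close>

lemma pp_specialize:
  assumes "pp K S" "w \<in> S"
  shows "\<exists>Z. finite Z \<and> (\<forall>\<eta>. specializes \<eta> Z \<longrightarrow> \<eta> \<circ> w \<in> S)"
  using assms
proof (induction arbitrary: w)
  case (pp_add i j l)
  then show ?case by (intro exI[of _ "{w j, w l}"]) (auto simp: specializes_def)
next
  case (pp_scale a i j)
  then show ?case by (intro exI[of _ "{w j}"]) (auto simp: specializes_def)
next
  case (pp_frob i j)
  then show ?case by (intro exI[of _ "{w j, w j ^ d}"]) (auto simp: specializes_def)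
next
  case (pp_val i)
  have "\<eta> (w i) \<in> V" if "\<eta> (w i) - w i \<in> V" for \<eta>
    using subringD(6)[OF valued_fieldD(3)[OF valued_field_fls] that, of "w i"] pp_val by simp
  then show ?case by (intro exI[of _ "{w i}"]) (auto simp: specializes_def)
next
  case (pp_Int S T)
  obtain Y where "finite Y" "\<forall>\<eta>. specializes \<eta> Y \<longrightarrow> \<eta> \<circ> w \<in> S"
    using pp_Int.IH(1)[OF IntD1[OF pp_Int.prems]] by (elim exE conjE) (rule that)
  moreover obtain Z where "finite Z" "\<forall>\<eta>. specializes \<eta> Z \<longrightarrow> \<eta> \<circ> w \<in> T"
    using pp_Int.IH(2)[OF IntD2[OF pp_Int.prems]] by (elim exE conjE) (rule that)
  moreover have "specializes \<eta> Y \<and> specializes \<eta> Z" if "specializes \<eta> (Y \<union> Z)" for \<eta>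
    using specializes_mono[OF that] by blast
  ultimately show ?case by (intro exI[of _ "Y \<union> Z"]) blast
next
  case (pp_ex S i)
  from pp_ex.prems obtain x where x: "w(i := x) \<in> S" by auto
  obtain Z where Z: "finite Z" "\<forall>\<eta>. specializes \<eta> Z \<longrightarrow> \<eta> \<circ> w(i := x) \<in> S"
    using pp_ex.IH[OF x] by (elim exE conjE) (rule that)
  have "(\<eta> \<circ> w)(i := \<eta> x) \<in> S" if "specializes \<eta> Z" for \<eta>
    using Z(2) that by (simp add: fun_upd_comp)
  then show ?case using Z(1) by blast
qed

lemma pp_fibre_dense:
  assumes S: "pp K S" and e: "\<And>i. e i \<in> K" and x: "e(n := x) \<in> S"
  shows "\<exists>y\<in>K. y - x \<in> fls_ball N \<and> e(n := y) \<in> S"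
proof -
  obtain Z where Z: "finite Z" "\<And>\<eta>. specializes \<eta> Z \<Longrightarrow> \<eta> \<circ> e(n := x) \<in> S"
    using pp_specialize[OF S x] by blast
  obtain \<eta> where \<eta>: "\<forall>x. \<eta> x \<in> K" "\<forall>x\<in>K. \<eta> x = x" "\<forall>u\<in>insert x Z. \<forall>v\<in>insert x Z. \<eta> (u + v) = \<eta> u + \<eta> v"
      "\<forall>a\<in>K. \<forall>u\<in>insert x Z. \<eta> (a * u) = a * \<eta> u" "\<forall>u\<in>insert x Z. u ^ d \<in> insert x Z \<longrightarrow> \<eta> (u ^ d) = \<eta> u ^ d"
      "\<forall>u\<in>insert x Z. \<eta> u - u \<in> fls_ball (max N 0)"
    using specialization[of "insert x Z" "max N 0"] Z(1) by auto
  have ball: "\<eta> u - u \<in> fls_ball N" "\<eta> u - u \<in> V" if "u \<in> insert x Z" for u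
    using \<eta>(6) that by (auto simp: fls_integers_ball intro: fls_ball_mono)
  then have "specializes \<eta> Z" using \<eta>(3,4,5) by (simp add: specializes_def)
  then have "\<eta> \<circ> e(n := x) \<in> S" by (rule Z(2))
  moreover have "\<eta> \<circ> e(n := x) = e(n := \<eta> x)" using \<eta>(2) e by (auto simp: fun_eq_iff)
  ultimately show ?thesis using \<eta>(1) ball(1) by auto
qed

section \<open>Elimination of quantifiers up to positive primitive sets\<close>

lemma pp_zero: "pp K S \<Longrightarrow> (\<lambda>_. 0) \<in> S"
proof (induction rule: pp.induct)
  case (pp_ex S i)
  have "(\<lambda>_. 0)(i := 0) = (\<lambda>_. 0 :: 'a fls)" by auto
  then show ?case using pp_ex.IH by (metis (mono_tags, lifting) mem_Collect_eq)
qed (auto simp: fls_integers_iff)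

lemma pp_diff: "pp K S \<Longrightarrow> e \<in> S \<Longrightarrow> f \<in> S \<Longrightarrow> (\<lambda>i. e i - f i) \<in> S"
proof (induction arbitrary: e f rule: pp.induct)
  case (pp_ex S i)
  then obtain x y where "e(i := x) \<in> S" "f(i := y) \<in> S" by blast
  then have "(\<lambda>j. (e(i := x)) j - (f(i := y)) j) \<in> S" by (rule pp_ex.IH)
  moreover have "(\<lambda>j. (e(i := x)) j - (f(i := y)) j) = (\<lambda>j. e j - f j)(i := x - y)" by auto
  ultimately have "(\<lambda>j. e j - f j)(i := x - y) \<in> S" by simp
  then show ?case by blast
qed (simp_all add: right_diff_distrib frob1 fls_integers_iff)

lemma pp_Inter: "finite \<F> \<Longrightarrow> (\<And>S. S \<in> \<F> \<Longrightarrow> pp K S) \<Longrightarrow> pp K (\<Inter>\<F>)"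
proof (induction \<F> rule: finite_induct)
  case empty
  have "pp K {e. e 0 = 1 * e 0}" by (intro pp.pp_scale K_closed(2))
  then show ?case by simp
qed (auto intro: pp.pp_Int)

definition fibre :: "nat \<Rightarrow> (nat \<Rightarrow> 'a fls) set \<Rightarrow> (nat \<Rightarrow> 'a fls) \<Rightarrow> 'a fls set" where
  "fibre n S e = {x. e(n := x) \<in> S}"

lemma add_subgroup_fibre:
  assumes "pp K S"
  shows "add_subgroup (fibre n S (\<lambda>_. 0))"
  unfolding add_subgroup_def fibre_def
proof (intro conjI ballI)
  show "0 \<in> {x. (\<lambda>_. 0)(n := x) \<in> S}" using pp_zero[OF assms] by (simp add: fun_upd_idem)
  fix x y assume "x \<in> {x. (\<lambda>_. 0)(n := x) \<in> S}" "y \<in> {x. (\<lambda>_. 0)(n := x) \<in> S}"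
  then have "(\<lambda>i. ((\<lambda>_. 0)(n := x)) i - ((\<lambda>_. 0)(n := y)) i) \<in> S" using pp_diff[OF assms] by blast
  moreover have "(\<lambda>i. ((\<lambda>_. 0)(n := x)) i - ((\<lambda>_. 0)(n := y)) i) = (\<lambda>_. 0)(n := x - y)" by auto
  ultimately show "x - y \<in> {x. (\<lambda>_. 0)(n := x) \<in> S}" by simp
qed

lemma coset_of_fibre:
  assumes "pp K S"
  shows "coset_of (fibre n S (\<lambda>_. 0)) (fibre n S e)"
  unfolding coset_of_def
proof (intro ballI allI)
  fix x y assume "x \<in> fibre n S e"
  then have x: "e(n := x) \<in> S" by (simp add: fibre_def)
  show "y \<in> fibre n S e \<longleftrightarrow> y - x \<in> fibre n S (\<lambda>_. 0)"
  proof
    assume "y \<in> fibre n S e"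
    then have "e(n := y) \<in> S" by (simp add: fibre_def)
    from pp_diff[OF assms this x] have "(\<lambda>i. (e(n := y)) i - (e(n := x)) i) \<in> S" .
    moreover have "(\<lambda>i. (e(n := y)) i - (e(n := x)) i) = (\<lambda>_. 0)(n := y - x)" by auto
    ultimately show "y - x \<in> fibre n S (\<lambda>_. 0)" by (simp add: fibre_def)
  next
    assume "y - x \<in> fibre n S (\<lambda>_. 0)"
    then have "(\<lambda>_. 0)(n := y - x) \<in> S" by (simp add: fibre_def)
    then have "(\<lambda>i. (e(n := x)) i - (0 - ((\<lambda>_. 0)(n := y - x)) i)) \<in> S"
      by (intro pp_diff[OF assms] x pp_zero[OF assms])
    moreover have "(\<lambda>i. (e(n := x)) i - (0 - ((\<lambda>_. 0)(n := y - x)) i)) = e(n := y)" by auto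
    ultimately show "y \<in> fibre n S e" by (simp add: fibre_def)
  qed
qed

text \<open>For finite \<open>\<F>\<close> this says that \<open>D\<close> is a Boolean combination of members of \<open>\<F>\<close>.\<close>

definition determined_by :: "(nat \<Rightarrow> 'a fls) set set \<Rightarrow> (nat \<Rightarrow> 'a fls) set \<Rightarrow> bool" where
  "determined_by \<F> D \<longleftrightarrow> (\<forall>e f. (\<forall>S\<in>\<F>. e \<in> S \<longleftrightarrow> f \<in> S) \<longrightarrow> (e \<in> D \<longleftrightarrow> f \<in> D))"

lemma determined_by_mono: "determined_by \<F> D \<Longrightarrow> \<F> \<subseteq> \<G> \<Longrightarrow> determined_by \<G> D"
  by (simp add: determined_by_def subset_iff)

lemma determined_byD:
  "determined_by \<F> D \<Longrightarrow> (\<And>S. S \<in> \<F> \<Longrightarrow> e \<in> S \<longleftrightarrow> f \<in> S) \<Longrightarrow> e \<in> D \<longleftrightarrow> f \<in> D"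
  by (simp add: determined_by_def)

lemma determined_by_Int:
  assumes "determined_by \<F> D" "determined_by \<F> E"
  shows "determined_by \<F> (D \<inter> E)"
  unfolding determined_by_def[of _ "D \<inter> E"]
proof (intro allI impI)
  fix e f assume "\<forall>S\<in>\<F>. e \<in> S \<longleftrightarrow> f \<in> S"
  then show "e \<in> D \<inter> E \<longleftrightarrow> f \<in> D \<inter> E"
    using determined_byD[OF assms(1), of e f] determined_byD[OF assms(2), of e f] by simp
qed

definition pp_definable :: "(nat \<Rightarrow> 'a fls) set \<Rightarrow> bool" where
  "pp_definable D \<longleftrightarrow> (\<exists>\<F>. finite \<F> \<and> (\<forall>S\<in>\<F>. pp K S) \<and> determined_by \<F> D)"

lemma pp_definableE:
  assumes "pp_definable D"
  obtains \<F> where "finite \<F>" "\<And>S. S \<in> \<F> \<Longrightarrow> pp K S" "determined_by \<F> D"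
  using assms unfolding pp_definable_def by (elim exE conjE) (rule that, simp_all)

text \<open>Let \<open>\<G>\<close> consist of the sets \<open>S \<in> \<F>\<close> that contain \<open>e(n := x)\<close>. If no \<open>y\<close> were suitable, the
  fibre of \<open>\<Inter>\<G>\<close> over \<open>f\<close> would be covered by the fibres of the other sets in \<open>\<F>\<close>. By assumption the
  same intersections of fibres are empty over \<open>e\<close> and over \<open>f\<close>, so by \<open>coset_cover_transfer\<close> the
  fibre over \<open>e\<close> would be covered as well, but \<open>x\<close> is not.\<close>

lemma pp_back_and_forth:
  assumes \<F>: "finite \<F>" "\<And>S. S \<in> \<F> \<Longrightarrow> pp K S"
    and agree: "\<And>\<G>. \<G> \<subseteq> \<F> \<Longrightarrow> (\<exists>x. e(n := x) \<in> \<Inter>\<G>) \<longleftrightarrow> (\<exists>x. f(n := x) \<in> \<Inter>\<G>)"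
  shows "\<exists>y. \<forall>S\<in>\<F>. e(n := x) \<in> S \<longleftrightarrow> f(n := y) \<in> S"
proof -
  define \<G> where "\<G> = {S\<in>\<F>. e(n := x) \<in> S}"
  define I where "I = \<F> - \<G>"
  have G: "pp K (\<Inter>\<G>)" using \<F> by (intro pp_Inter) (auto simp: \<G>_def)
  have "\<not> fibre n (\<Inter>\<G>) f \<subseteq> (\<Union>S\<in>I. fibre n S f)"
  proof
    assume cover: "fibre n (\<Inter>\<G>) f \<subseteq> (\<Union>S\<in>I. fibre n S f)"
    have "fibre n (\<Inter>\<G>) e \<subseteq> (\<Union>S\<in>I. fibre n S e)"
    proof (rule coset_cover_transfer[where A = "\<lambda>S. fibre n S (\<lambda>_. 0)" and D = "\<lambda>S. fibre n S f"])
      show "add_subgroup (fibre n (\<Inter>\<G>) (\<lambda>_. 0))" by (rule add_subgroup_fibre[OF G])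
      show "coset_of (fibre n (\<Inter>\<G>) (\<lambda>_. 0)) (fibre n (\<Inter>\<G>) f)"
        "coset_of (fibre n (\<Inter>\<G>) (\<lambda>_. 0)) (fibre n (\<Inter>\<G>) e)" by (rule coset_of_fibre[OF G])+
      show "finite I" using \<F>(1) by (simp add: I_def)
      show "add_subgroup (fibre n S (\<lambda>_. 0))" "coset_of (fibre n S (\<lambda>_. 0)) (fibre n S f)"
        "coset_of (fibre n S (\<lambda>_. 0)) (fibre n S e)" if "S \<in> I" for S
        using \<F>(2)[of S] that add_subgroup_fibre coset_of_fibre by (auto simp: I_def)
      show "fibre n (\<Inter>\<G>) f \<inter> (\<Inter>S\<in>\<Delta>. fibre n S f) = {} \<longleftrightarrow>
          fibre n (\<Inter>\<G>) e \<inter> (\<Inter>S\<in>\<Delta>. fibre n S e) = {}" if "\<Delta> \<subseteq> I" for \<Delta>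
      proof -
        have "fibre n (\<Inter>\<G>) g \<inter> (\<Inter>S\<in>\<Delta>. fibre n S g) = {x. g(n := x) \<in> \<Inter>(\<G> \<union> \<Delta>)}" for g
          by (auto simp: fibre_def)
        moreover have "\<G> \<union> \<Delta> \<subseteq> \<F>" using that by (auto simp: I_def \<G>_def)
        ultimately show ?thesis using agree[of "\<G> \<union> \<Delta>"] by auto
      qed
    qed (rule cover)
    moreover have "x \<in> fibre n (\<Inter>\<G>) e" by (auto simp: fibre_def \<G>_def)
    ultimately show False by (auto simp: fibre_def I_def \<G>_def)
  qed
  then obtain y where "y \<in> fibre n (\<Inter>\<G>) f" "\<And>S. S \<in> I \<Longrightarrow> y \<notin> fibre n S f" by blast
  then have "\<forall>S\<in>\<F>. e(n := x) \<in> S \<longleftrightarrow> f(n := y) \<in> S" by (auto simp: fibre_def I_def \<G>_def)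
  then show ?thesis by blast
qed

lemma pp_definable_all:
  assumes "pp_definable D"
  shows "pp_definable {e. \<forall>x. e(n := x) \<in> D}"
proof -
  obtain \<F> where \<F>: "finite \<F>" "\<And>S. S \<in> \<F> \<Longrightarrow> pp K S" "determined_by \<F> D"
    by (rule pp_definableE[OF assms]) (rule that)
  define \<H> where "\<H> = (\<lambda>\<G>. {e. \<exists>x. e(n := x) \<in> \<Inter>\<G>}) ` Pow \<F>"
  have *: "f(n := y) \<in> D" if "\<forall>S\<in>\<H>. e \<in> S \<longleftrightarrow> f \<in> S" "\<forall>x. e(n := x) \<in> D" for e f y
  proof -
    have "(\<exists>x. f(n := x) \<in> \<Inter>\<G>) \<longleftrightarrow> (\<exists>x. e(n := x) \<in> \<Inter>\<G>)" if "\<G> \<subseteq> \<F>" for \<G>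
    proof -
      have "{e. \<exists>x. e(n := x) \<in> \<Inter>\<G>} \<in> \<H>" unfolding \<H>_def using that by (intro imageI) simp
      from bspec[OF \<open>\<forall>S\<in>\<H>. e \<in> S \<longleftrightarrow> f \<in> S\<close> this] show ?thesis by simp
    qed
    then obtain x where "\<forall>S\<in>\<F>. f(n := y) \<in> S \<longleftrightarrow> e(n := x) \<in> S"
      using pp_back_and_forth[OF \<F>(1,2), of f n e y] by blast
    then show ?thesis
      using determined_byD[OF \<F>(3), of "f(n := y)" "e(n := x)"] that(2) by simp
  qed
  have "determined_by \<H> {e. \<forall>x. e(n := x) \<in> D}"
    unfolding determined_by_def
  proof (intro allI impI)
    fix e f assume "\<forall>S\<in>\<H>. e \<in> S \<longleftrightarrow> f \<in> S"
    moreover from this have "\<forall>S\<in>\<H>. f \<in> S \<longleftrightarrow> e \<in> S" by simp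
    ultimately show "e \<in> {e. \<forall>x. e(n := x) \<in> D} \<longleftrightarrow> f \<in> {e. \<forall>x. e(n := x) \<in> D}"
      using *[of e f] *[of f e] by (simp only: mem_Collect_eq) metis
  qed
  moreover have "finite \<H>" using \<F>(1) by (simp add: \<H>_def)
  moreover have "pp K S" if S: "S \<in> \<H>" for S
  proof -
    obtain \<G> where G: "\<G> \<in> Pow \<F>" "S = {e. \<exists>x. e(n := x) \<in> \<Inter>\<G>}"
      using S unfolding \<H>_def by (elim imageE) (rule that)
    then have "pp K (\<Inter>\<G>)" using \<F>(1,2) by (intro pp_Inter) (auto intro: finite_subset)
    then show ?thesis unfolding G(2) by (rule pp.pp_ex)
  qed
  ultimately show ?thesis unfolding pp_definable_def by (intro exI[of _ \<H>]) simp
qed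

lemma pp_definable_pp: "pp K S \<Longrightarrow> pp_definable S"
  unfolding pp_definable_def determined_by_def by (intro exI[of _ "{S}"]) simp

lemma pp_definable_not: "pp_definable D \<Longrightarrow> pp_definable {e. e \<notin> D}"
  by (simp add: pp_definable_def determined_by_def)

lemma pp_definable_and:
  assumes "pp_definable D" "pp_definable E"
  shows "pp_definable (D \<inter> E)"
proof -
  obtain \<F> where "finite \<F>" "\<And>S. S \<in> \<F> \<Longrightarrow> pp K S" "determined_by \<F> D" by (rule pp_definableE[OF assms(1)]) (rule that)
  moreover obtain \<G> where "finite \<G>" "\<And>S. S \<in> \<G> \<Longrightarrow> pp K S" "determined_by \<G> E" by (rule pp_definableE[OF assms(2)]) (rule that)
  ultimately have "finite (\<F> \<union> \<G>)" "\<And>S. S \<in> \<F> \<union> \<G> \<Longrightarrow> pp K S"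
    "determined_by (\<F> \<union> \<G>) D" "determined_by (\<F> \<union> \<G>) E"
    by (auto intro: determined_by_mono)
  then show ?thesis unfolding pp_definable_def
    by (intro exI[of _ "\<F> \<union> \<G>"]) (simp add: determined_by_Int)
qed

text \<open>Positive primitive sets have closed fibres, and their fibres over \<open>K\<close> have dense \<open>K\<close>-points; so
  near \<open>x\<close> there is a point of \<open>K\<close> that satisfies the same positive primitive conditions as \<open>x\<close>.\<close>

lemma pp_definable_point_in_K:
  assumes "pp_definable D" and e: "\<And>i. e i \<in> K"
  shows "\<exists>y\<in>K. e(n := x) \<in> D \<longleftrightarrow> e(n := y) \<in> D"
proof -
  obtain \<F> where \<F>: "finite \<F>" "\<And>S. S \<in> \<F> \<Longrightarrow> pp K S" "determined_by \<F> D"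
    by (rule pp_definableE[OF assms(1)]) (rule that)
  define \<G> where "\<G> = {S\<in>\<F>. e(n := x) \<in> S}"
  have "\<exists>N. \<forall>S\<in>\<H>. \<forall>y. y - x \<in> fls_ball N \<longrightarrow> e(n := y) \<notin> S" if "\<H> \<subseteq> \<F> - \<G>" for \<H>
    using finite_subset[OF that finite_Diff[OF \<F>(1)]] that
  proof (induction \<H>)
    case (insert S \<H>)
    then obtain N where N: "\<forall>S\<in>\<H>. \<forall>y. y - x \<in> fls_ball N \<longrightarrow> e(n := y) \<notin> S" by blast
    have "pp K S" "e(n := x) \<notin> S" using insert.prems \<F>(2) by (auto simp: \<G>_def)
    then obtain N' where N': "\<forall>y. y - x \<in> fls_ball N' \<longrightarrow> e(n := y) \<notin> S" using pp_fibre_closed by blast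
    have "y - x \<in> fls_ball N \<and> y - x \<in> fls_ball N'" if "y - x \<in> fls_ball (max N N')" for y
      using that by (auto intro: fls_ball_mono)
    then have "\<forall>T\<in>insert S \<H>. \<forall>y. y - x \<in> fls_ball (max N N') \<longrightarrow> e(n := y) \<notin> T"
      using N N' by blast
    then show ?case by blast
  qed simp
  then obtain N where N: "\<forall>S\<in>\<F> - \<G>. \<forall>y. y - x \<in> fls_ball N \<longrightarrow> e(n := y) \<notin> S" by blast
  have "pp K (\<Inter>\<G>)" using \<F> by (intro pp_Inter) (auto simp: \<G>_def)
  moreover have "e(n := x) \<in> \<Inter>\<G>" by (auto simp: \<G>_def)
  ultimately obtain y where y: "y \<in> K" "y - x \<in> fls_ball N" "e(n := y) \<in> \<Inter>\<G>"
    using pp_fibre_dense[of "\<Inter>\<G>" e n x N] e by blast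
  have "e(n := x) \<in> S \<longleftrightarrow> e(n := y) \<in> S" if "S \<in> \<F>" for S
  proof (cases "S \<in> \<G>")
    case True
    then show ?thesis using InterD[OF y(3) True] by (simp add: \<G>_def)
  next
    case False
    then have "e(n := y) \<notin> S" using N y(2) that by simp
    then show ?thesis using False that by (simp add: \<G>_def)
  qed
  then have "e(n := x) \<in> D \<longleftrightarrow> e(n := y) \<in> D"
    by (rule determined_byD[OF \<F>(3)])
  then show ?thesis using y(1) by blast
qed

section \<open>The henselization is an elementary substructure\<close>

abbreviation R :: "'a fls poly set" where
  "R \<equiv> carrier (skew_poly_ring d K)"

abbreviation KS :: "('a fls poly, 'a fls) lo_structure" where
  "KS \<equiv> field_structure d V K"

abbreviation LS :: "('a fls poly, 'a fls) lo_structure" where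
  "LS \<equiv> field_structure d V UNIV"

lemma R_iff: "r \<in> R \<longleftrightarrow> (\<forall>n. coeff r n \<in> K)"
  by (simp add: skew_poly_ring_def)

lemma skew_act_upto:
  assumes "degree r \<le> n"
  shows "skew_act d (x :: 'a fls) r = (\<Sum>i\<le>n. coeff r i * x ^ (d ^ i))"
  unfolding skew_act_def using assms by (intro sum.mono_neutral_left) (auto simp: coeff_eq_0)

lemma skew_act_zero: "skew_act d (x :: 'a fls) 0 = 0"
  by (simp add: skew_act_def)

lemma skew_act_pCons: "skew_act d (x :: 'a fls) (pCons a r) = a * x + skew_act d (x ^ d) r"
proof -
  have "skew_act d x (pCons a r) = (\<Sum>i\<le>Suc (degree r). coeff (pCons a r) i * x ^ (d ^ i))"
    by (rule skew_act_upto) (rule degree_pCons_le)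
  also have "\<dots> = a * x + (\<Sum>i\<le>degree r. coeff r i * (x ^ d) ^ (d ^ i))"
    unfolding sum.atMost_Suc_shift by (simp flip: power_mult)
  finally show ?thesis by (simp add: skew_act_def)
qed

lemma pp_skew_act:
  assumes "\<forall>n. coeff r n \<in> K"
  shows "pp K {e. e m = skew_act d (e i) r}"
  using assms
proof (induction r arbitrary: i m)
  case 0
  have "pp K {e. e m = 0 * e m}" by (intro pp.pp_scale K_closed(1))
  then show ?case by (simp add: skew_act_zero)
next
  case (pCons a r)
  have a: "a \<in> K" "\<forall>n. coeff r n \<in> K"
    using pCons.prems[rule_format, of 0] pCons.prems[rule_format, of "Suc _"] by auto
  define n where "n = Suc (max i m)"
  have n: "i \<noteq> n" "i \<noteq> Suc n" "i \<noteq> Suc (Suc n)" "m \<noteq> n" "m \<noteq> Suc n" "m \<noteq> Suc (Suc n)"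
    by (auto simp: n_def)
  let ?T = "{e. e n = a * e i} \<inter> {e. e (Suc n) = e i ^ d} \<inter>
    {e. e (Suc (Suc n)) = skew_act d (e (Suc n)) r} \<inter> {e. e m = e n + e (Suc (Suc n))}"
  have "pp K {e. \<exists>x. e(n := x) \<in> {e. \<exists>y. e(Suc n := y) \<in> {e. \<exists>z. e(Suc (Suc n) := z) \<in> ?T}}}"
    by (intro pp.pp_ex pp.pp_Int pp.pp_scale pp.pp_frob pp.pp_add a pCons.IH)
  also have "{e. \<exists>x. e(n := x) \<in> {e. \<exists>y. e(Suc n := y) \<in> {e. \<exists>z. e(Suc (Suc n) := z) \<in> ?T}}} =
      {e. e m = skew_act d (e i) (pCons a r)}"
    using n by (simp add: skew_act_pCons)
  finally show ?case .
qed

lemma not_mem_if_bounded: "\<forall>i\<in>A. i < (n::nat) \<Longrightarrow> n \<le> j \<Longrightarrow> j \<notin> A"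
  by auto

lemma pp_term:
  assumes "scalars u \<subseteq> R" "\<forall>i\<in>term_vars u. i < m"
  shows "pp K {e. e m = eval_term LS e u}"
  using assms
proof (induction u arbitrary: m)
  case (LVar i)
  have "pp K {e. e m = 1 * e i}" by (intro pp.pp_scale K_closed(2))
  then show ?case by simp
next
  case LZero
  have "pp K {e. e m = 0 * e m}" by (intro pp.pp_scale K_closed(1))
  then show ?case by (simp add: field_structure_def)
next
  case (LAdd u v)
  have m: "m \<notin> term_vars u" "Suc m \<notin> term_vars u" "Suc (Suc m) \<notin> term_vars u"
    "Suc m \<notin> term_vars v" "Suc (Suc m) \<notin> term_vars v"
    using not_mem_if_bounded[OF LAdd.prems(2)] by auto
  let ?T = "{e. e (Suc m) = eval_term LS e u} \<inter> {e. e (Suc (Suc m)) = eval_term LS e v} \<inter>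
    {e. e m = e (Suc m) + e (Suc (Suc m))}"
  have "pp K {e. \<exists>x. e(Suc m := x) \<in> {e. \<exists>y. e(Suc (Suc m) := y) \<in> ?T}}"
    using LAdd.prems by (intro pp.pp_ex pp.pp_Int pp.pp_add LAdd.IH) (auto intro: less_SucI)
  also have "{e. \<exists>x. e(Suc m := x) \<in> {e. \<exists>y. e(Suc (Suc m) := y) \<in> ?T}} = {e. e m = eval_term LS e (LAdd u v)}"
    using m by (simp add: eval_term_upd field_structure_def)
  finally show ?case .
next
  case (LNeg u)
  have m: "m \<notin> term_vars u" "Suc m \<notin> term_vars u" using not_mem_if_bounded[OF LNeg.prems(2)] by auto
  let ?T = "{e. e (Suc m) = eval_term LS e u} \<inter> {e. e m = (- 1) * e (Suc m)}"
  have "pp K {e. \<exists>x. e(Suc m := x) \<in> ?T}"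
    using LNeg.prems by (intro pp.pp_ex pp.pp_Int pp.pp_scale LNeg.IH K_closed(5) K_closed(2)) (auto intro: less_SucI)
  also have "{e. \<exists>x. e(Suc m := x) \<in> ?T} = {e. e m = eval_term LS e (LNeg u)}"
    using m by (simp add: eval_term_upd field_structure_def)
  finally show ?case .
next
  case (LScal u r)
  have m: "m \<notin> term_vars u" "Suc m \<notin> term_vars u" using not_mem_if_bounded[OF LScal.prems(2)] by auto
  let ?T = "{e. e (Suc m) = eval_term LS e u} \<inter> {e. e m = skew_act d (e (Suc m)) r}"
  have "pp K {e. \<exists>x. e(Suc m := x) \<in> ?T}"
    using LScal.prems R_iff by (intro pp.pp_ex pp.pp_Int pp_skew_act LScal.IH) (auto intro: less_SucI)
  also have "{e. \<exists>x. e(Suc m := x) \<in> ?T} = {e. e m = eval_term LS e (LScal u r)}"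
    using m by (simp add: eval_term_upd field_structure_def)
  finally show ?case .
qed

lemma term_fresh: "\<exists>m. \<forall>i\<in>term_vars u \<union> term_vars v. i < m"
  unfolding finite_nat_set_iff_bounded[symmetric] by (simp add: finite_term_vars)

lemma pp_definable_sat:
  assumes "form_scalars \<phi> \<subseteq> R"
  shows "pp_definable {e. sat LS e \<phi>}"
  using assms
proof (induction \<phi>)
  case (FEq u v)
  obtain m where m: "\<forall>i\<in>term_vars u \<union> term_vars v. i < m" using term_fresh by blast
  have "m \<notin> term_vars u" "Suc m \<notin> term_vars u" "m \<notin> term_vars v" "Suc m \<notin> term_vars v"
    using not_mem_if_bounded[OF m] by auto
  then have "{e. sat LS e (FEq u v)} = {e. \<exists>x. e(m := x) \<in> {e. \<exists>y. e(Suc m := y) \<in>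
      {e. e m = eval_term LS e u} \<inter> {e. e (Suc m) = eval_term LS e v} \<inter> {e. e m = 1 * e (Suc m)}}}"
    by (simp add: eval_term_upd)
  moreover have "pp K \<dots>"
    using FEq m by (intro pp.pp_ex pp.pp_Int pp.pp_scale K_closed(2) pp_term) (auto intro: less_SucI)
  ultimately show ?case using pp_definable_pp by simp
next
  case (FVal u)
  obtain m where m: "\<forall>i\<in>term_vars u \<union> term_vars u. i < m" using term_fresh by blast
  have "m \<notin> term_vars u" using not_mem_if_bounded[OF m, of m] by auto
  then have "{e. sat LS e (FVal u)} = {e. \<exists>x. e(m := x) \<in> {e. e m = eval_term LS e u} \<inter> {e. e m \<in> V}}"
    by (auto simp add: eval_term_upd field_structure_def)
  moreover have "pp K \<dots>"
    using FVal m by (intro pp.pp_ex pp.pp_Int pp.pp_val pp_term) auto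
  ultimately show ?case using pp_definable_pp by simp
next
  case (FNot \<phi>)
  then show ?case using pp_definable_not[of "{e. sat LS e \<phi>}"] by simp
next
  case (FAnd \<phi> \<psi>)
  then show ?case using pp_definable_and[of "{e. sat LS e \<phi>}" "{e. sat LS e \<psi>}"] by (simp add: Collect_conj_eq)
next
  case (FAll n \<phi>)
  then show ?case using pp_definable_all[of "{e. sat LS e \<phi>}" n] by (simp add: field_structure_def)
qed


lemma skew_act_in_K: "x \<in> K \<Longrightarrow> r \<in> R \<Longrightarrow> skew_act d x r \<in> K"
  unfolding skew_act_def R_iff by (intro sum_in_K K_closed(4,8)) auto

lemma eval_term_in_K:
  assumes "range e \<subseteq> K" "scalars u \<subseteq> R"
  shows "eval_term LS e u \<in> K"
  using assms(2)
proof (induction u)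
  case (LVar i)
  then show ?case using assms(1) by auto
next
  case (LScal u r)
  then show ?case using skew_act_in_K by (simp add: field_structure_def)
qed (simp_all add: field_structure_def K_closed(1,5,6))

text \<open>This is the criterion of Tarski and Vaught; the points in \<open>K\<close> come from
  \<open>pp_definable_point_in_K\<close>.\<close>

lemma sat_henselization_iff:
  assumes "form_scalars \<phi> \<subseteq> R" "range e \<subseteq> K"
  shows "sat KS e \<phi> \<longleftrightarrow> sat LS e \<phi>"
  using assms
proof (induction \<phi> arbitrary: e)
  have eval: "eval_term KS e u = eval_term LS e u" for e u
    by (induction u) (simp_all add: field_structure_def)
  case (FEq u v)
  then show ?case by (simp add: eval)
next
  have eval: "eval_term KS e u = eval_term LS e u" for e u
    by (induction u) (simp_all add: field_structure_def)
  case (FVal u)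
  then show ?case using eval_term_in_K[of e u] by (simp add: eval) (simp add: field_structure_def)
next
  case (FAll n \<phi>)
  have IH: "sat KS (e(n := y)) \<phi> \<longleftrightarrow> sat LS (e(n := y)) \<phi>" if "y \<in> K" for y
    using FAll that by (intro FAll.IH) auto
  have "pp_definable {e. sat LS e \<phi>}" using FAll.prems by (intro pp_definable_sat) simp
  then have "\<exists>y\<in>K. sat LS (e(n := x)) \<phi> \<longleftrightarrow> sat LS (e(n := y)) \<phi>" for x
    using pp_definable_point_in_K[of "{e. sat LS e \<phi>}" e n x] FAll.prems(2) by auto
  then have "(\<forall>y\<in>K. sat LS (e(n := y)) \<phi>) \<longleftrightarrow> (\<forall>x. sat LS (e(n := x)) \<phi>)" by blast
  moreover have "universe KS = K" "universe LS = UNIV" by (simp_all add: field_structure_def)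
  ultimately show ?case using IH by simp
qed simp_all

end

section \<open>Sentences describing the type of an element\<close>

lemma finite_free_vars: "finite (free_vars \<phi>)"
  by (induction \<phi>) (simp_all add: finite_term_vars)

lemma sat_cong: "(\<And>i. i \<in> free_vars \<phi> \<Longrightarrow> e i = f i) \<Longrightarrow> sat M e \<phi> \<longleftrightarrow> sat M f \<phi>"
proof (induction \<phi> arbitrary: e f)
  case (FEq u v)
  then show ?case using eval_term_cong[of u e f M] eval_term_cong[of v e f M] by simp
next
  case (FVal u)
  then show ?case using eval_term_cong[of u e f M] by simp
next
  case (FNot \<phi>)
  have "sat M e \<phi> \<longleftrightarrow> sat M f \<phi>" using FNot.prems by (intro FNot.IH) simp
  then show ?case by simp
next
  case (FAnd \<phi> \<psi>)
  have "sat M e \<phi> \<longleftrightarrow> sat M f \<phi>" using FAnd.prems by (intro FAnd.IH(1)) simp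
  moreover have "sat M e \<psi> \<longleftrightarrow> sat M f \<psi>" using FAnd.prems by (intro FAnd.IH(2)) simp
  ultimately show ?case by simp
next
  case (FAll n \<phi>)
  have "sat M (e(n := x)) \<phi> \<longleftrightarrow> sat M (f(n := x)) \<phi>" for x
    using FAll.prems by (intro FAll.IH) simp
  then show ?case by simp
qed

definition FImp :: "'r lo_form \<Rightarrow> 'r lo_form \<Rightarrow> 'r lo_form" where
  "FImp \<phi> \<psi> = FNot (FAnd \<phi> (FNot \<psi>))"

lemma FImp_simps [simp]:
  "sat M e (FImp \<phi> \<psi>) \<longleftrightarrow> (sat M e \<phi> \<longrightarrow> sat M e \<psi>)"
  "free_vars (FImp \<phi> \<psi>) = free_vars \<phi> \<union> free_vars \<psi>"
  "form_scalars (FImp \<phi> \<psi>) = form_scalars \<phi> \<union> form_scalars \<psi>"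
  by (auto simp: FImp_def)

lemma free_vars_FAlls: "free_vars (foldr FAll ns \<phi>) = free_vars \<phi> - set ns"
  by (induction ns) auto

lemma form_scalars_FAlls: "form_scalars (foldr FAll ns \<phi>) = form_scalars \<phi>"
  by (induction ns) auto

lemma sat_FAlls:
  "sat M e (foldr FAll ns \<phi>) \<longleftrightarrow>
     (\<forall>f. (\<forall>i\<in>set ns. f i \<in> universe M) \<longrightarrow> (\<forall>i. i \<notin> set ns \<longrightarrow> f i = e i) \<longrightarrow> sat M f \<phi>)"
proof (induction ns arbitrary: e)
  case Nil
  have "f = e" if "\<forall>i. f i = e i" for f using that by blast
  then show ?case by auto
next
  case (Cons n ns)
  show ?case
  proof
    assume L: "sat M e (foldr FAll (n # ns) \<phi>)"
    show "\<forall>f. (\<forall>i\<in>set (n # ns). f i \<in> universe M) \<longrightarrow> (\<forall>i. i \<notin> set (n # ns) \<longrightarrow> f i = e i) \<longrightarrow> sat M f \<phi>"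
    proof (intro allI impI)
      fix f assume f: "\<forall>i\<in>set (n # ns). f i \<in> universe M" "\<forall>i. i \<notin> set (n # ns) \<longrightarrow> f i = e i"
      then have "sat M (e(n := f n)) (foldr FAll ns \<phi>)" using L by simp
      then show "sat M f \<phi>" unfolding Cons.IH using f by simp
    qed
  next
    assume R: "\<forall>f. (\<forall>i\<in>set (n # ns). f i \<in> universe M) \<longrightarrow> (\<forall>i. i \<notin> set (n # ns) \<longrightarrow> f i = e i) \<longrightarrow> sat M f \<phi>"
    have "sat M (e(n := x)) (foldr FAll ns \<phi>)" if x: "x \<in> universe M" for x
      unfolding Cons.IH
    proof (intro allI impI)
      fix f assume f: "\<forall>i\<in>set ns. f i \<in> universe M" "\<forall>i. i \<notin> set ns \<longrightarrow> f i = (e(n := x)) i"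
      have "f n \<in> universe M" using f x by (cases "n \<in> set ns") auto
      then show "sat M f \<phi>" using R f by simp
    qed
    then show "sat M e (foldr FAll (n # ns) \<phi>)" by simp
  qed
qed

context finite_laurent begin

section \<open>The type of a nonzero fixed point of Frobenius\<close>

text \<open>A fixed point has valuation \<open>0\<close>, and so has \<open>x\<close> minus its constant coefficient unless it vanishes.\<close>

lemma frobenius_fixed_point:
  assumes "x ^ d = (x :: 'a fls)" "x \<noteq> 0"
  shows "\<exists>a. a \<noteq> 0 \<and> x = fls_const a"
proof -
  define y where "y = x - fls_const (x $$ 0)"
  have "y = 0"
  proof (rule ccontr)
    assume "y \<noteq> 0"
    have "y ^ d = y" by (simp add: y_def frob1 frob_const assms(1))
    then have "int d * fls_subdegree y = fls_subdegree y" by (metis fls_subdegree_pow)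
    then have "fls_subdegree y = 0" using d_gt_1 by simp
    moreover have "y $$ 0 = 0" by (simp add: y_def)
    ultimately show False using \<open>y \<noteq> 0\<close> nth_fls_subdegree_nonzero by metis
  qed
  then show ?thesis using assms(2) by (intro exI[of _ "x $$ 0"]) (auto simp: y_def)
qed

text \<open>Multiplication by a nonzero constant is an automorphism of the structure.\<close>

lemma sat_const_mult:
  assumes "a \<noteq> 0"
  shows "sat LS (\<lambda>i. fls_const a * e i) \<phi> \<longleftrightarrow> sat LS e \<phi>"
proof (induction \<phi> arbitrary: e)
  let ?c = "fls_const a :: 'a fls"
  have pow: "?c ^ (d ^ n) = ?c" for n by (induction n) (simp_all add: power_mult frob_const)
  have c0: "?c \<noteq> 0" using assms by simp
  have eval: "eval_term LS (\<lambda>i. ?c * e i) u = ?c * eval_term LS e u" for e u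
  proof (induction u)
    case (LScal u r)
    have "skew_act d (?c * x) r = ?c * skew_act d x r" for x
      unfolding skew_act_def sum_distrib_left by (intro sum.cong) (simp_all add: power_mult_distrib pow)
    then show ?case using LScal by (simp add: field_structure_def)
  qed (simp_all add: field_structure_def distrib_left)
  {
    case (FEq u v)
    show ?case using c0 by (simp add: eval)
  next
    case (FVal u)
    have "?c * x \<in> V \<longleftrightarrow> x \<in> V" for x
      using assms by (auto simp: fls_integers_iff)
    then show ?case by (simp add: eval) (simp add: field_structure_def)
  next
    case (FAll n \<phi>)
    have upd: "(\<lambda>i. ?c * e i)(n := ?c * y) = (\<lambda>i. ?c * (e(n := y)) i)" for y by auto
    have "(\<forall>x. sat LS ((\<lambda>i. ?c * e i)(n := x)) \<phi>) \<longleftrightarrow> (\<forall>y. sat LS ((\<lambda>i. ?c * e i)(n := ?c * y)) \<phi>)"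
    proof
      assume all: "\<forall>y. sat LS ((\<lambda>i. ?c * e i)(n := ?c * y)) \<phi>"
      have "y * (x / y) = x" if "y \<noteq> 0" for x y :: "'a fls" using that by simp
      from this[OF c0] show "\<forall>x. sat LS ((\<lambda>i. ?c * e i)(n := x)) \<phi>" using all by metis
    qed blast
    moreover have "universe LS = UNIV" by (simp add: field_structure_def)
    ultimately show ?case unfolding upd FAll.IH by (simp only: sat.simps ball_UNIV)
  }
qed simp_all

definition fixed_point_form :: "nat \<Rightarrow> 'a fls poly lo_form" where
  "fixed_point_form z = FAnd (FEq (LScal (LVar z) [:- 1, 1:]) LZero) (FNot (FEq (LVar z) LZero))"

text \<open>The sentence saying that \<open>\<phi>\<close> holds at \<open>(z e\<^sub>1, z e\<^sub>2, \<dots>)\<close> for all nonzero fixed points \<open>z\<close> of \<open>t\<close>.\<close>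

definition type_sentence :: "(nat \<Rightarrow> 'a fls) \<Rightarrow> nat list \<Rightarrow> nat \<Rightarrow> 'a fls poly lo_form \<Rightarrow> 'a fls poly lo_form" where
  "type_sentence e ns z \<phi> = FAll z (FImp (fixed_point_form z)
     (foldr FAll ns (foldr (\<lambda>i. FImp (FEq (LVar i) (LScal (LVar z) [:e i:]))) ns \<phi>)))"

lemma const_poly_in_R: "a \<in> K \<Longrightarrow> [:a:] \<in> R"
  using K_closed(1) by (auto simp: R_iff coeff_pCons split: nat.split)

lemma fixed_point_scalar_in_R: "[:- 1, 1:] \<in> R"
  using K_closed(1,2) K_closed(5)[OF K_closed(2)] by (auto simp: R_iff coeff_pCons split: nat.split)

lemma guards:
  shows "sat M f (foldr (\<lambda>i. FImp (FEq (LVar i) (LScal (LVar z) [:e i:]))) ns \<phi>) \<longleftrightarrow>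
      ((\<forall>i\<in>set ns. f i = scal_of M (f z) [:e i:]) \<longrightarrow> sat M f \<phi>)"
    and "free_vars (foldr (\<lambda>i. FImp (FEq (LVar i) (LScal (LVar z) [:e i:]))) ns \<phi>) \<subseteq> free_vars \<phi> \<union> set ns \<union> {z}"
    and "form_scalars (foldr (\<lambda>i. FImp (FEq (LVar i) (LScal (LVar z) [:e i:]))) ns \<phi>) \<subseteq>
      form_scalars \<phi> \<union> (\<lambda>i. [:e i:]) ` set ns"
  by (induction ns) auto

lemma type_sentence_sentence:
  assumes "form_scalars \<phi> \<subseteq> R" "range e \<subseteq> K" "free_vars \<phi> \<subseteq> set ns"
  shows "type_sentence e ns z \<phi> \<in> lo_sentences R"
proof -
  let ?\<psi> = "foldr (\<lambda>i. FImp (FEq (LVar i) (LScal (LVar z) [:e i:]))) ns \<phi>"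
  have "form_scalars ?\<psi> \<subseteq> R"
    using guards(3)[where ns = ns and \<phi> = \<phi> and z = z and e = e] assms(1,2) const_poly_in_R by blast
  moreover have "free_vars ?\<psi> - set ns \<subseteq> {z}"
    using guards(2)[where ns = ns and \<phi> = \<phi> and z = z and e = e] assms(3) by blast
  ultimately show ?thesis
    using fixed_point_scalar_in_R
    by (auto simp: lo_sentences_def lo_formulas_def type_sentence_def fixed_point_form_def
        free_vars_FAlls form_scalars_FAlls)
qed

lemma type_sentence_holds:
  assumes "sat LS e \<phi>" "free_vars \<phi> \<subseteq> set ns" "z \<notin> set ns"
  shows "holds_in LS (type_sentence e ns z \<phi>)"
  unfolding holds_in_def
proof (intro allI impI)
  fix g :: "nat \<Rightarrow> 'a fls"
  have "sat LS f \<phi>"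
    if x: "sat LS (g(z := x)) (fixed_point_form z)" and f: "\<forall>i. i \<notin> set ns \<longrightarrow> f i = (g(z := x)) i"
      "\<forall>i\<in>set ns. f i = skew_act d (f z) [:e i:]" for x f
  proof -
    have "x ^ d = x" "x \<noteq> 0"
      using x by (simp_all add: fixed_point_form_def field_structure_def skew_act_pCons skew_act_zero)
    then obtain a where a: "a \<noteq> 0" "x = fls_const a" using frobenius_fixed_point by blast
    have "f z = x" using f(1) assms(3) by simp
    then have "f i = fls_const a * e i" if "i \<in> free_vars \<phi>" for i
      using f(2) that assms(2) by (auto simp: a(2) skew_act_pCons skew_act_zero mult.commute)
    then have "sat LS f \<phi> \<longleftrightarrow> sat LS (\<lambda>i. fls_const a * e i) \<phi>" by (rule sat_cong)
    then show ?thesis using sat_const_mult[OF a(1)] assms(1) by simp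
  qed
  then show "sat LS g (type_sentence e ns z \<phi>)"
    by (simp add: type_sentence_def sat_FAlls guards(1)) (simp add: field_structure_def)
qed

lemma model_has_fixed_point:
  fixes M :: "('a fls poly, 'm) lo_structure"
  assumes M: "is_model R (complete_theory R LS) M"
  shows "\<exists>m\<in>universe M. \<forall>e z. sat M (e(z := m)) (fixed_point_form z)"
proof -
  define \<phi> where "\<phi> = FNot (FAll 0 (FNot (fixed_point_form 0)))"
  have "\<phi> \<in> lo_sentences R"
    using fixed_point_scalar_in_R
    by (auto simp: \<phi>_def lo_sentences_def lo_formulas_def fixed_point_form_def)
  moreover have "sat LS e \<phi>" for e
    by (auto simp: \<phi>_def fixed_point_form_def field_structure_def skew_act_pCons skew_act_zero intro!: exI[of _ 1])
  then have "holds_in LS \<phi>" by (simp add: holds_in_def)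
  ultimately have "holds_in M \<phi>" using M by (simp add: is_model_def complete_theory_def)
  moreover have "zero_of M \<in> universe M" using M by (simp add: is_model_def is_lo_structure_def)
  ultimately have "sat M (\<lambda>_. zero_of M) \<phi>" by (auto simp: holds_in_def)
  then show ?thesis by (auto simp: \<phi>_def fixed_point_form_def)
qed

text \<open>All nonzero fixed points of Frobenius are conjugate under automorphisms, so every formula
  true of one of them is true of all of them, and this is part of the theory.\<close>

lemma sat_model_if_sat_LS:
  fixes M :: "('a fls poly, 'm) lo_structure"
  assumes M: "is_model R (complete_theory R LS) M"
    and m: "m \<in> universe M" "\<And>e z. sat M (e(z := m)) (fixed_point_form z)"
    and \<phi>: "form_scalars \<phi> \<subseteq> R" and e: "range e \<subseteq> K" and sat: "sat LS e \<phi>"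
  shows "sat M (\<lambda>i. scal_of M m [:e i:]) \<phi>"
proof -
  obtain ns where ns: "set ns = free_vars \<phi>" using finite_list[OF finite_free_vars] by blast
  obtain z where z: "z \<notin> set ns" using ex_new_if_finite[OF infinite_UNIV_nat, of "set ns"] by auto
  have "type_sentence e ns z \<phi> \<in> complete_theory R LS"
    using type_sentence_sentence[OF \<phi> e, of ns z] type_sentence_holds[OF sat _ z] ns
    by (simp add: complete_theory_def)
  then have holds: "holds_in M (type_sentence e ns z \<phi>)" using M by (simp add: is_model_def)
  have closed: "zero_of M \<in> universe M" "\<And>x r. x \<in> universe M \<Longrightarrow> r \<in> R \<Longrightarrow> scal_of M x r \<in> universe M"
    using M by (auto simp: is_model_def is_lo_structure_def)
  define g where "g = (\<lambda>_::nat. zero_of M)"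
  have "sat M g (type_sentence e ns z \<phi>)"
    using holds closed(1) by (auto simp: holds_in_def g_def)
  then have all: "sat M (g(z := m)) (foldr FAll ns (foldr (\<lambda>i. FImp (FEq (LVar i) (LScal (LVar z) [:e i:]))) ns \<phi>))"
    using m by (simp add: type_sentence_def)
  define f where "f i = (if i \<in> set ns then scal_of M m [:e i:] else (g(z := m)) i)" for i
  have "\<forall>i\<in>set ns. f i \<in> universe M"
    using closed(2)[OF m(1) const_poly_in_R] e by (auto simp: f_def)
  moreover have "\<forall>i. i \<notin> set ns \<longrightarrow> f i = (g(z := m)) i" by (simp add: f_def)
  moreover have "\<forall>i\<in>set ns. f i = scal_of M (f z) [:e i:]" using z by (simp add: f_def)
  ultimately have "sat M f \<phi>" using all[unfolded sat_FAlls guards(1)] by blast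
  moreover have "sat M f \<phi> \<longleftrightarrow> sat M (\<lambda>i. scal_of M m [:e i:]) \<phi>"
    by (rule sat_cong) (simp add: f_def ns)
  ultimately show ?thesis by simp
qed

lemma henselization_embeds_elementarily:
  fixes M :: "('a fls poly, 'm) lo_structure"
  assumes M: "is_model R (complete_theory R LS) M"
  shows "\<exists>h. elementary_embedding R KS M h"
proof -
  obtain m where m: "m \<in> universe M" "\<And>e z. sat M (e(z := m)) (fixed_point_form z)"
    using model_has_fixed_point[OF M] by blast
  define h where "h a = scal_of M m [:a:]" for a
  have "h ` K \<subseteq> universe M"
    using M m(1) const_poly_in_R by (auto simp: is_model_def is_lo_structure_def h_def)
  moreover have "sat KS e \<phi> \<longleftrightarrow> sat M (h \<circ> e) \<phi>" if \<phi>: "form_scalars \<phi> \<subseteq> R" and e: "range e \<subseteq> K" for \<phi> e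
  proof -
    have "sat M (h \<circ> e) \<psi>" if "sat LS e \<psi>" "form_scalars \<psi> \<subseteq> R" for \<psi>
      using sat_model_if_sat_LS[OF M m that(2) e that(1)] by (simp add: h_def comp_def)
    from this[of \<phi>] this[of "FNot \<phi>"] have "sat LS e \<phi> \<longleftrightarrow> sat M (h \<circ> e) \<phi>" using \<phi> by auto
    then show ?thesis using sat_henselization_iff[OF \<phi> e] by simp
  qed
  ultimately show ?thesis
    unfolding elementary_embedding_def lo_formulas_def by (intro exI[of _ h]) (simp add: field_structure_def)
qed

lemma henselization_is_model: "is_model R (complete_theory R LS) KS"
  unfolding is_model_def
proof
  show "is_lo_structure R KS"
    using skew_act_in_K by (auto simp: is_lo_structure_def field_structure_def K_closed(1,5,6))
  show "\<forall>\<phi>\<in>complete_theory R LS. holds_in KS \<phi>"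
  proof
    fix \<phi> assume "\<phi> \<in> complete_theory R LS"
    then have "form_scalars \<phi> \<subseteq> R" "holds_in LS \<phi>"
      by (auto simp: complete_theory_def lo_sentences_def lo_formulas_def)
    moreover have "universe KS = K" "universe LS = UNIV" by (simp_all add: field_structure_def)
    ultimately show "holds_in KS \<phi>" by (simp add: holds_in_def sat_henselization_iff)
  qed
qed

end

lemma CHAR_eq_if_card_prime_power:
  assumes "prime p" "card (UNIV :: 'a::{finite,field} set) = p ^ n"
  shows "CHAR('a) = p"
proof -
  have "(\<Sum>x\<in>(UNIV :: 'a set). x + 1) = (\<Sum>x\<in>UNIV. x)"
    by (rule sum.reindex_bij_witness[of _ "\<lambda>x. x - 1" "\<lambda>x. x + 1"]) auto
  then have "(of_nat (p ^ n) :: 'a) = 0" by (simp add: sum.distrib assms(2))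
  then have "CHAR('a) dvd p ^ n" by (simp only: of_nat_eq_0_iff_char_dvd)
  moreover have "prime CHAR('a)" by (rule prime_CHAR_semidom) (simp add: finite_imp_CHAR_pos)
  ultimately show ?thesis using assms(1) prime_dvd_power primes_dvd_imp_eq by blast
qed

theorem corollary5p8:
  fixes p k d :: nat
    and K :: "'a::{finite,field} fls set"
    and R :: "'a fls poly set"
    and KS LS :: "('a fls poly, 'a fls) lo_structure"
    and T :: "'a fls poly lo_form set"
  assumes "prime p" and "k \<ge> 1" and "d = p ^ k" and "card (UNIV :: 'a set) = d"
    and "K = rat_henselization"
    and "R = carrier (skew_poly_ring d K)"
    and "KS = field_structure d fls_integers K"
    and "LS = field_structure d fls_integers UNIV"
    and "T = complete_theory R LS"
  shows "is_model R T KS \<and>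
    (\<forall>M :: ('a fls poly, 'm) lo_structure. is_model R T M \<longrightarrow> (\<exists>h. elementary_embedding R KS M h))"
proof -
  have "CHAR('a) = p" using CHAR_eq_if_card_prime_power assms(1,3,4) by blast
  then interpret finite_laurent d k "TYPE('a)"
    using assms(2,3,4) by unfold_locales simp_all
  show ?thesis
    unfolding assms(5-9) using henselization_is_model henselization_embeds_elementarily by blast
qed

end
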